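(* Let $M$ be a monoid. The Grothendieck construction yields 2-functors $$\mathsf{Groth}_{pf}:\mathfrak{LaxMon}_M\to\mathfrak{PFib}_M,\qquad \mathsf{Groth}_{f}:\mathfrak{PsMon}_M\to\mathfrak{Fib}_M$$ from the 2-category of lax $M$-monoids to the 2-category of prefibrations of monoids over $M$, and (by restriction) from the 2-category of pseudo $M$-monoids to the 2-category of fibrations of monoids over $M$. For any monoid $M$, the 2-functors $\mathsf{Groth}_{pf}$ and $\mathsf{Groth}_f$ are 2-equivalences.
   Context: $A^{\times}$ denotes the group of invertible elements of a monoid $A$; $\mathrm{Ker}(\sigma)=\sigma^{-1}(1)$ for a monoid homomorphism $\sigma$. **Lax $M$-monoids.** A lax $M$-monoid is a triple $(A,\phi,\gamma)$ with $A$ a monoid and maps $\phi:A\times M\to A$, $(a,m)\mapsto\phi_m(a)$, and $\gamma:M\times M\to A$, $(m,n)\mapsto\gamma_{m,n}$, such that for all $a,b\in A$, $m,n,k\in M$: (i) $\phi_1(a)=a$; (ii) $\gamma_{m,n}\phi_n(\phi_m(a))=\phi_{mn}(a)\gamma_{m,n}$; (iii) $\gamma_{mn,k}\phi_k(\gamma_{m,n})=\gamma_{m,nk}\gamma_{n,k}$; (iv) $\gamma_{1,m}=1=\gamma_{m,1}$; (v) $\phi_m(1)=1$, $\phi_m(ab)=\phi_m(a)\phi_m(b)$. It is a pseudo $M$-monoid if all $\gamma_{m,n}\in A^\times$. A lax $M$-homomorphism $(A,\phi,\gamma)\to(A',\phi',\gamma')$ is a pair $(\alpha,\tau)$ with $\alpha:A\to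 A'$ a monoid homomorphism and $\tau:M\to A'$, $m\mapsto\tau_m$, a map with $\tau_1=1$, $\phi'_m(\alpha(a))\tau_m=\tau_m\alpha(\phi_m(a))$ and $\gamma'_{m,n}\phi'_n(\tau_m)\tau_n=\tau_{mn}\alpha(\gamma_{m,n})$ for all $a\in A$, $m,n\in M$. It is a pseudo $M$-homomorphism if $\tau$ is invertible (all $\tau_m\in A'^\times$). Composition: $(\alpha',\tau')(\alpha,\tau)=(\alpha'\alpha,\ m\mapsto\tau'_m\alpha'(\tau_m))$. A lax 2-cell $(\alpha,\tau)\Rightarrow(\beta,\theta)$ between lax $M$-homomorphisms $(A,\phi,\gamma)\to(A',\phi',\gamma')$ is an element $c'\in A'$ with $c'\alpha(a)=\beta(a)c'$ and $\phi'_m(c')\tau_m=\theta_mc'$ for all $a\in A$, $m\in M$; it is a pseudo 2-cell if $c'$ is invertible. Vertical composition is multiplication in $A'$. $\mathfrak{LaxMon}_M$ is the 2-category of lax $M$-monoids, lax $M$-homomorphisms and lax 2-cells; $\mathfrak{PsMon}_M$ is its sub-2-category of pseudo $M$-monoids, pseudo $M$-homomorphisms and pseudo 2-cells. **Prefibrations and fibrations.** Let $\sigma:E\to M$ be a monoid homomorphism. An element $x\in E$ is $\sigma$-precartesian if for every $z\in E$ with $\sigma(z)=\sigma(x)$ there is a unique $y\in\mathrm{Ker}(\sigma)$ with $z=xy$. It is $\sigma$-cartesian if (i) for every $z\in E$, $v\in M$ with $\sigma(z)=\sigma(x)v$ there is $y\in E$ with $z=xy$, $\sigma(y)=v$; and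 (ii) $xy_1=xy_2$ and $\sigma(y_1)=\sigma(y_2)$ imply $y_1=y_2$. $\sigma$ is a prefibration (resp. fibration) if above each element of $M$ there is a $\sigma$-precartesian (resp. $\sigma$-cartesian) element. $\mathfrak{PFib}_M$: objects are prefibrations $\sigma:E\to M$; morphisms from $\sigma:E\to M$ to $\sigma':E'\to M$ are monoid homomorphisms $\alpha:E\to E'$ with $\sigma'\alpha=\sigma$; 2-morphisms $\alpha\Rightarrow\beta$ are elements $c\in E'$ with $\sigma'(c)=1$ and $c\,\alpha(x)=\beta(x)\,c$ for all $x\in E$. $\mathfrak{Fib}_M$: the sub-2-category of $\mathfrak{PFib}_M$ whose objects are the fibrations and whose morphisms are the cartesian morphisms, i.e. those $\alpha$ mapping $\sigma$-precartesian elements to $\sigma'$-precartesian elements. **Grothendieck construction.** $\mathsf{Groth}(A,\phi,\gamma)$ is the set $M\times A$ with multiplication $(m,a)(n,b)=(mn,\gamma_{m,n}\phi_n(a)b)$. The 2-functors send $(A,\phi,\gamma)$ to the projection $\mathsf{Groth}(A,\phi,\gamma)\to M$, $(m,a)\mapsto m$; they send $(\alpha,\tau)$ to $\bar\alpha(m,a)=(m,\tau_m\alpha(a))$, and a 2-cell $c'$ to $(1,c')$.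
   Formalization: Groth_f is no 2-equivalence PsMon_M→Fib_M as defined (2-cells of 1→(ℕ,+), M=1); proved instead for PsMon_M→Fib_M with invertible 2-cells and for pseudo monoids with all lax 2-cells→Fib_M. Monoids live in a set U with M×U embedding in U; over M, in M×U. *)

theory Defs
  imports "HOL-Algebra.Coset"
begin

section \<open>Strict 2-categories, 2-functors and 2-equivalences\<close>

text \<open>
  A cell need not determine its boundary: the same element may be a 2-cell between several pairs of
  1-cells, and the same function a 1-cell between several pairs of objects.  The operations
  therefore receive the boundary as explicit arguments, and the axioms only concern cells with
  matching boundary.  Compositions are written in applicative order:
  \<open>Comp1 C x y z g f\<close> is $g \circ f$ for $f : x \to y$ and $g : y \to z$;
  \<open>VComp C x y f g h t s\<close> is $t \cdot s$ for $s : f \Rightarrow g$ and $t : g \Rightarrow h$ in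
  the hom-category from \<open>x\<close> to \<open>y\<close>;
  \<open>HComp C x y z f g h k t s\<close> is $t * s : h \circ f \Rightarrow k \circ g$ for
  $s : f \Rightarrow g : x \to y$ and $t : h \Rightarrow k : y \to z$.
\<close>

record ('o, 'f, 't) two_cat =
  Ob :: "'o set"
  Hom :: "'o \<Rightarrow> 'o \<Rightarrow> 'f set"
  Cell :: "'o \<Rightarrow> 'o \<Rightarrow> 'f \<Rightarrow> 'f \<Rightarrow> 't set"
  Id1 :: "'o \<Rightarrow> 'f"
  Comp1 :: "'o \<Rightarrow> 'o \<Rightarrow> 'o \<Rightarrow> 'f \<Rightarrow> 'f \<Rightarrow> 'f"
  Id2 :: "'o \<Rightarrow> 'o \<Rightarrow> 'f \<Rightarrow> 't"
  VComp :: "'o \<Rightarrow> 'o \<Rightarrow> 'f \<Rightarrow> 'f \<Rightarrow> 'f \<Rightarrow> 't \<Rightarrow> 't \<Rightarrow> 't"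
  HComp :: "'o \<Rightarrow> 'o \<Rightarrow> 'o \<Rightarrow> 'f \<Rightarrow> 'f \<Rightarrow> 'f \<Rightarrow> 'f \<Rightarrow> 't \<Rightarrow> 't \<Rightarrow> 't"

locale two_category =
  fixes C :: "('o, 'f, 't) two_cat"
  assumes Id1_in: "x \<in> Ob C \<Longrightarrow> Id1 C x \<in> Hom C x x"
    and Comp1_in: "\<lbrakk>x \<in> Ob C; y \<in> Ob C; z \<in> Ob C; f \<in> Hom C x y; g \<in> Hom C y z\<rbrakk>
      \<Longrightarrow> Comp1 C x y z g f \<in> Hom C x z"
    and Comp1_Id1_left: "\<lbrakk>x \<in> Ob C; y \<in> Ob C; f \<in> Hom C x y\<rbrakk>
      \<Longrightarrow> Comp1 C x y y (Id1 C y) f = f"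
    and Comp1_Id1_right: "\<lbrakk>x \<in> Ob C; y \<in> Ob C; f \<in> Hom C x y\<rbrakk>
      \<Longrightarrow> Comp1 C x x y f (Id1 C x) = f"
    and Comp1_assoc: "\<lbrakk>w \<in> Ob C; x \<in> Ob C; y \<in> Ob C; z \<in> Ob C;
        f \<in> Hom C w x; g \<in> Hom C x y; h \<in> Hom C y z\<rbrakk>
      \<Longrightarrow> Comp1 C w x z (Comp1 C x y z h g) f = Comp1 C w y z h (Comp1 C w x y g f)"
    and Id2_in: "\<lbrakk>x \<in> Ob C; y \<in> Ob C; f \<in> Hom C x y\<rbrakk> \<Longrightarrow> Id2 C x y f \<in> Cell C x y f f"
    and VComp_in: "\<lbrakk>x \<in> Ob C; y \<in> Ob C; f \<in> Hom C x y; g \<in> Hom C x y; h \<in> Hom C x y;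
        s \<in> Cell C x y f g; t \<in> Cell C x y g h\<rbrakk>
      \<Longrightarrow> VComp C x y f g h t s \<in> Cell C x y f h"
    and VComp_Id2_left: "\<lbrakk>x \<in> Ob C; y \<in> Ob C; f \<in> Hom C x y; g \<in> Hom C x y;
        s \<in> Cell C x y f g\<rbrakk>
      \<Longrightarrow> VComp C x y f g g (Id2 C x y g) s = s"
    and VComp_Id2_right: "\<lbrakk>x \<in> Ob C; y \<in> Ob C; f \<in> Hom C x y; g \<in> Hom C x y;
        s \<in> Cell C x y f g\<rbrakk>
      \<Longrightarrow> VComp C x y f f g s (Id2 C x y f) = s"
    and VComp_assoc: "\<lbrakk>x \<in> Ob C; y \<in> Ob C;
        f \<in> Hom C x y; g \<in> Hom C x y; h \<in> Hom C x y; k \<in> Hom C x y;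
        s \<in> Cell C x y f g; t \<in> Cell C x y g h; u \<in> Cell C x y h k\<rbrakk>
      \<Longrightarrow> VComp C x y f g k (VComp C x y g h k u t) s
          = VComp C x y f h k u (VComp C x y f g h t s)"
    and HComp_in: "\<lbrakk>x \<in> Ob C; y \<in> Ob C; z \<in> Ob C;
        f \<in> Hom C x y; g \<in> Hom C x y; h \<in> Hom C y z; k \<in> Hom C y z;
        s \<in> Cell C x y f g; t \<in> Cell C y z h k\<rbrakk>
      \<Longrightarrow> HComp C x y z f g h k t s \<in> Cell C x z (Comp1 C x y z h f) (Comp1 C x y z k g)"
    and HComp_Id2: "\<lbrakk>x \<in> Ob C; y \<in> Ob C; z \<in> Ob C; f \<in> Hom C x y; h \<in> Hom C y z\<rbrakk>
      \<Longrightarrow> HComp C x y z f f h h (Id2 C y z h) (Id2 C x y f) = Id2 C x z (Comp1 C x y z h f)"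
    and interchange: "\<lbrakk>x \<in> Ob C; y \<in> Ob C; z \<in> Ob C;
        f \<in> Hom C x y; f' \<in> Hom C x y; f'' \<in> Hom C x y;
        h \<in> Hom C y z; h' \<in> Hom C y z; h'' \<in> Hom C y z;
        s \<in> Cell C x y f f'; s' \<in> Cell C x y f' f'';
        t \<in> Cell C y z h h'; t' \<in> Cell C y z h' h''\<rbrakk>
      \<Longrightarrow> HComp C x y z f f'' h h'' (VComp C y z h h' h'' t' t) (VComp C x y f f' f'' s' s)
          = VComp C x z (Comp1 C x y z h f) (Comp1 C x y z h' f') (Comp1 C x y z h'' f'')
              (HComp C x y z f' f'' h' h'' t' s') (HComp C x y z f f' h h' t s)"
    and HComp_Id_left: "\<lbrakk>x \<in> Ob C; y \<in> Ob C; f \<in> Hom C x y; g \<in> Hom C x y;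
        s \<in> Cell C x y f g\<rbrakk>
      \<Longrightarrow> HComp C x y y f g (Id1 C y) (Id1 C y) (Id2 C y y (Id1 C y)) s = s"
    and HComp_Id_right: "\<lbrakk>x \<in> Ob C; y \<in> Ob C; f \<in> Hom C x y; g \<in> Hom C x y;
        s \<in> Cell C x y f g\<rbrakk>
      \<Longrightarrow> HComp C x x y (Id1 C x) (Id1 C x) f g s (Id2 C x x (Id1 C x)) = s"
    and HComp_assoc: "\<lbrakk>w \<in> Ob C; x \<in> Ob C; y \<in> Ob C; z \<in> Ob C;
        f \<in> Hom C w x; f' \<in> Hom C w x; g \<in> Hom C x y; g' \<in> Hom C x y;
        h \<in> Hom C y z; h' \<in> Hom C y z;
        s \<in> Cell C w x f f'; t \<in> Cell C x y g g'; u \<in> Cell C y z h h'\<rbrakk>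
      \<Longrightarrow> HComp C w x z f f' (Comp1 C x y z h g) (Comp1 C x y z h' g')
            (HComp C x y z g g' h h' u t) s
          = HComp C w y z (Comp1 C w x y g f) (Comp1 C w x y g' f') h h'
              u (HComp C w x y f f' g g' t s)"

record ('o, 'f, 't, 'p, 'g, 'u) two_fun =
  F0 :: "'o \<Rightarrow> 'p"
  F1 :: "'o \<Rightarrow> 'o \<Rightarrow> 'f \<Rightarrow> 'g"
  F2 :: "'o \<Rightarrow> 'o \<Rightarrow> 'f \<Rightarrow> 'f \<Rightarrow> 't \<Rightarrow> 'u"

locale two_functor = C: two_category C + D: two_category D
  for C :: "('o, 'f, 't) two_cat" and D :: "('p, 'g, 'u) two_cat" +
  fixes F :: "('o, 'f, 't, 'p, 'g, 'u) two_fun"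
  assumes F0_in: "x \<in> Ob C \<Longrightarrow> F0 F x \<in> Ob D"
    and F1_in: "\<lbrakk>x \<in> Ob C; y \<in> Ob C; f \<in> Hom C x y\<rbrakk> \<Longrightarrow> F1 F x y f \<in> Hom D (F0 F x) (F0 F y)"
    and F2_in: "\<lbrakk>x \<in> Ob C; y \<in> Ob C; f \<in> Hom C x y; g \<in> Hom C x y; s \<in> Cell C x y f g\<rbrakk>
      \<Longrightarrow> F2 F x y f g s \<in> Cell D (F0 F x) (F0 F y) (F1 F x y f) (F1 F x y g)"
    and F1_Id1: "x \<in> Ob C \<Longrightarrow> F1 F x x (Id1 C x) = Id1 D (F0 F x)"
    and F1_Comp1: "\<lbrakk>x \<in> Ob C; y \<in> Ob C; z \<in> Ob C; f \<in> Hom C x y; g \<in> Hom C y z\<rbrakk>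
      \<Longrightarrow> F1 F x z (Comp1 C x y z g f)
          = Comp1 D (F0 F x) (F0 F y) (F0 F z) (F1 F y z g) (F1 F x y f)"
    and F2_Id2: "\<lbrakk>x \<in> Ob C; y \<in> Ob C; f \<in> Hom C x y\<rbrakk>
      \<Longrightarrow> F2 F x y f f (Id2 C x y f) = Id2 D (F0 F x) (F0 F y) (F1 F x y f)"
    and F2_VComp: "\<lbrakk>x \<in> Ob C; y \<in> Ob C; f \<in> Hom C x y; g \<in> Hom C x y; h \<in> Hom C x y;
        s \<in> Cell C x y f g; t \<in> Cell C x y g h\<rbrakk>
      \<Longrightarrow> F2 F x y f h (VComp C x y f g h t s)
          = VComp D (F0 F x) (F0 F y) (F1 F x y f) (F1 F x y g) (F1 F x y h)
              (F2 F x y g h t) (F2 F x y f g s)"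
    and F2_HComp: "\<lbrakk>x \<in> Ob C; y \<in> Ob C; z \<in> Ob C;
        f \<in> Hom C x y; g \<in> Hom C x y; h \<in> Hom C y z; k \<in> Hom C y z;
        s \<in> Cell C x y f g; t \<in> Cell C y z h k\<rbrakk>
      \<Longrightarrow> F2 F x z (Comp1 C x y z h f) (Comp1 C x y z k g) (HComp C x y z f g h k t s)
          = HComp D (F0 F x) (F0 F y) (F0 F z)
              (F1 F x y f) (F1 F x y g) (F1 F y z h) (F1 F y z k)
              (F2 F y z h k t) (F2 F x y f g s)"

definition two_id :: "('o, 'f, 't, 'o, 'f, 't) two_fun" where
  "two_id = \<lparr>F0 = \<lambda>x. x, F1 = \<lambda>x y f. f, F2 = \<lambda>x y f g s. s\<rparr>"

definition two_comp ::
  "('p, 'g, 'u, 'q, 'h, 'v) two_fun \<Rightarrow> ('o, 'f, 't, 'p, 'g, 'u) two_fun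
    \<Rightarrow> ('o, 'f, 't, 'q, 'h, 'v) two_fun" where
  "two_comp G F =
    \<lparr>F0 = \<lambda>x. F0 G (F0 F x),
     F1 = \<lambda>x y f. F1 G (F0 F x) (F0 F y) (F1 F x y f),
     F2 = \<lambda>x y f g s. F2 G (F0 F x) (F0 F y) (F1 F x y f) (F1 F x y g) (F2 F x y f g s)\<rparr>"

definition iso1 :: "('o, 'f, 't) two_cat \<Rightarrow> 'o \<Rightarrow> 'o \<Rightarrow> 'f \<Rightarrow> bool" where
  "iso1 C x y f \<longleftrightarrow> f \<in> Hom C x y \<and>
    (\<exists>g \<in> Hom C y x. Comp1 C x y x g f = Id1 C x \<and> Comp1 C y x y f g = Id1 C y)"

definition iso2 :: "('o, 'f, 't) two_cat \<Rightarrow> 'o \<Rightarrow> 'o \<Rightarrow> 'f \<Rightarrow> 'f \<Rightarrow> 't \<Rightarrow> bool" where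
  "iso2 C x y f g s \<longleftrightarrow> s \<in> Cell C x y f g \<and>
    (\<exists>t \<in> Cell C x y g f. VComp C x y f g f t s = Id2 C x y f
                        \<and> VComp C x y g f g s t = Id2 C x y g)"

text \<open>A strict 2-natural isomorphism \<open>F \<Rightarrow> G\<close> between 2-functors from \<open>C\<close> to \<open>D\<close>.\<close>

definition two_nat_iso ::
  "('o, 'f, 't) two_cat \<Rightarrow> ('p, 'g, 'u) two_cat \<Rightarrow> ('o, 'f, 't, 'p, 'g, 'u) two_fun
    \<Rightarrow> ('o, 'f, 't, 'p, 'g, 'u) two_fun \<Rightarrow> ('o \<Rightarrow> 'g) \<Rightarrow> bool" where
  "two_nat_iso C D F G \<eta> \<longleftrightarrow>
    (\<forall>x \<in> Ob C. iso1 D (F0 F x) (F0 G x) (\<eta> x)) \<and>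
    (\<forall>x \<in> Ob C. \<forall>y \<in> Ob C. \<forall>f \<in> Hom C x y.
      Comp1 D (F0 F x) (F0 G x) (F0 G y) (F1 G x y f) (\<eta> x)
      = Comp1 D (F0 F x) (F0 F y) (F0 G y) (\<eta> y) (F1 F x y f)) \<and>
    (\<forall>x \<in> Ob C. \<forall>y \<in> Ob C. \<forall>f \<in> Hom C x y. \<forall>g \<in> Hom C x y. \<forall>s \<in> Cell C x y f g.
      HComp D (F0 F x) (F0 G x) (F0 G y) (\<eta> x) (\<eta> x) (F1 G x y f) (F1 G x y g)
        (F2 G x y f g s) (Id2 D (F0 F x) (F0 G x) (\<eta> x))
      = HComp D (F0 F x) (F0 F y) (F0 G y) (F1 F x y f) (F1 F x y g) (\<eta> y) (\<eta> y)
        (Id2 D (F0 F y) (F0 G y) (\<eta> y)) (F2 F x y f g s))"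

definition two_equivalence ::
  "('o, 'f, 't) two_cat \<Rightarrow> ('p, 'g, 'u) two_cat \<Rightarrow> ('o, 'f, 't, 'p, 'g, 'u) two_fun
    \<Rightarrow> bool" where
  "two_equivalence C D F \<longleftrightarrow> two_functor C D F \<and>
    (\<exists>G \<eta> \<epsilon>. two_functor D C G \<and>
      two_nat_iso C C two_id (two_comp G F) \<eta> \<and>
      two_nat_iso D D (two_comp F G) two_id \<epsilon>)"

definition inv_cells :: "('o, 'f, 't) two_cat \<Rightarrow> ('o, 'f, 't) two_cat" where
  "inv_cells C = C\<lparr>Cell := \<lambda>x y f g. {s. iso2 C x y f g s}\<rparr>"


section \<open>Lax and pseudo \<open>M\<close>-monoids\<close>

text \<open>
  The library's \<^const>\<open>hom\<close> does not require preservation of the unit.  Maps that are 1-cells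
  are extensional, so that HOL equality is equality of maps on the carrier.
\<close>

definition mon_hom :: "('a, 'x) monoid_scheme \<Rightarrow> ('b, 'y) monoid_scheme \<Rightarrow> ('a \<Rightarrow> 'b) set" where
  "mon_hom A B = {f \<in> hom A B. f \<one>\<^bsub>A\<^esub> = \<one>\<^bsub>B\<^esub>} \<inter> extensional (carrier A)"

text \<open>\<open>act A m a\<close> is $\phi_m(a)$ and \<open>coh A m n\<close> is $\gamma_{m,n}$.\<close>

record ('a, 'm) lax_mon = "'a monoid" +
  act :: "'m \<Rightarrow> 'a \<Rightarrow> 'a"
  coh :: "'m \<Rightarrow> 'm \<Rightarrow> 'a"

locale lax_monoid = M: monoid M + A: monoid A
  for M :: "'m monoid" and A :: "('a, 'm) lax_mon" +
  assumes act_in: "act A \<in> carrier M \<rightarrow>\<^sub>E carrier A \<rightarrow>\<^sub>E carrier A"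
    and coh_in: "coh A \<in> carrier M \<rightarrow>\<^sub>E carrier M \<rightarrow>\<^sub>E carrier A"
    and act_one: "a \<in> carrier A \<Longrightarrow> act A \<one>\<^bsub>M\<^esub> a = a"
    and coh_act: "\<lbrakk>a \<in> carrier A; m \<in> carrier M; n \<in> carrier M\<rbrakk>
      \<Longrightarrow> coh A m n \<otimes>\<^bsub>A\<^esub> act A n (act A m a) = act A (m \<otimes>\<^bsub>M\<^esub> n) a \<otimes>\<^bsub>A\<^esub> coh A m n"
    and coh_cocycle: "\<lbrakk>m \<in> carrier M; n \<in> carrier M; k \<in> carrier M\<rbrakk>
      \<Longrightarrow> coh A (m \<otimes>\<^bsub>M\<^esub> n) k \<otimes>\<^bsub>A\<^esub> act A k (coh A m n)
          = coh A m (n \<otimes>\<^bsub>M\<^esub> k) \<otimes>\<^bsub>A\<^esub> coh A n k"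
    and coh_one_left: "m \<in> carrier M \<Longrightarrow> coh A \<one>\<^bsub>M\<^esub> m = \<one>\<^bsub>A\<^esub>"
    and coh_one_right: "m \<in> carrier M \<Longrightarrow> coh A m \<one>\<^bsub>M\<^esub> = \<one>\<^bsub>A\<^esub>"
    and act_of_one: "m \<in> carrier M \<Longrightarrow> act A m \<one>\<^bsub>A\<^esub> = \<one>\<^bsub>A\<^esub>"
    and act_mult: "\<lbrakk>a \<in> carrier A; b \<in> carrier A; m \<in> carrier M\<rbrakk>
      \<Longrightarrow> act A m (a \<otimes>\<^bsub>A\<^esub> b) = act A m a \<otimes>\<^bsub>A\<^esub> act A m b"

definition pseudo_monoid :: "'m monoid \<Rightarrow> ('a, 'm) lax_mon \<Rightarrow> bool" where
  "pseudo_monoid M A \<longleftrightarrow> lax_monoid M A \<and>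
    (\<forall>m \<in> carrier M. \<forall>n \<in> carrier M. coh A m n \<in> Units A)"

definition lax_hom ::
  "'m monoid \<Rightarrow> ('a, 'm) lax_mon \<Rightarrow> ('b, 'm) lax_mon \<Rightarrow> (('a \<Rightarrow> 'b) \<times> ('m \<Rightarrow> 'b)) set" where
  "lax_hom M A A' = {(\<alpha>, \<tau>).
    \<alpha> \<in> mon_hom A A' \<and>
    \<tau> \<in> carrier M \<rightarrow>\<^sub>E carrier A' \<and>
    \<tau> \<one>\<^bsub>M\<^esub> = \<one>\<^bsub>A'\<^esub> \<and>
    (\<forall>m \<in> carrier M. \<forall>a \<in> carrier A.
      act A' m (\<alpha> a) \<otimes>\<^bsub>A'\<^esub> \<tau> m = \<tau> m \<otimes>\<^bsub>A'\<^esub> \<alpha> (act A m a)) \<and>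
    (\<forall>m \<in> carrier M. \<forall>n \<in> carrier M.
      coh A' m n \<otimes>\<^bsub>A'\<^esub> act A' n (\<tau> m) \<otimes>\<^bsub>A'\<^esub> \<tau> n
      = \<tau> (m \<otimes>\<^bsub>M\<^esub> n) \<otimes>\<^bsub>A'\<^esub> \<alpha> (coh A m n))}"

definition pseudo_hom ::
  "'m monoid \<Rightarrow> ('a, 'm) lax_mon \<Rightarrow> ('b, 'm) lax_mon \<Rightarrow> (('a \<Rightarrow> 'b) \<times> ('m \<Rightarrow> 'b)) set" where
  "pseudo_hom M A A' = {(\<alpha>, \<tau>) \<in> lax_hom M A A'. \<forall>m \<in> carrier M. \<tau> m \<in> Units A'}"

definition lax_cell ::
  "'m monoid \<Rightarrow> ('a, 'm) lax_mon \<Rightarrow> ('b, 'm) lax_mon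
    \<Rightarrow> ('a \<Rightarrow> 'b) \<times> ('m \<Rightarrow> 'b) \<Rightarrow> ('a \<Rightarrow> 'b) \<times> ('m \<Rightarrow> 'b) \<Rightarrow> 'b set" where
  "lax_cell M A A' = (\<lambda>(\<alpha>, \<tau>) (\<beta>, \<theta>). {c \<in> carrier A'.
    (\<forall>a \<in> carrier A. c \<otimes>\<^bsub>A'\<^esub> \<alpha> a = \<beta> a \<otimes>\<^bsub>A'\<^esub> c) \<and>
    (\<forall>m \<in> carrier M. act A' m c \<otimes>\<^bsub>A'\<^esub> \<tau> m = \<theta> m \<otimes>\<^bsub>A'\<^esub> c)})"

type_synonym ('a, 'm) lax_two_cat =
  "(('a, 'm) lax_mon, ('a \<Rightarrow> 'a) \<times> ('m \<Rightarrow> 'a), 'a) two_cat"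

text \<open>
  Horizontal composition: for $c : (\alpha,\tau) \Rightarrow (\beta,\theta)$ and
  $c' : (\alpha',\tau') \Rightarrow (\beta',\theta')$ the composite is
  $c'\,\alpha'(c) = \beta'(c)\,c'$, as for natural transformations.
\<close>

definition LaxMon :: "'m monoid \<Rightarrow> ('a, 'm) lax_two_cat" where
  "LaxMon M =
    \<lparr>Ob = {A. lax_monoid M A},
     Hom = lax_hom M,
     Cell = lax_cell M,
     Id1 = \<lambda>A. (\<lambda>a \<in> carrier A. a, \<lambda>m \<in> carrier M. \<one>\<^bsub>A\<^esub>),
     Comp1 = \<lambda>A A' A'' (\<alpha>', \<tau>') (\<alpha>, \<tau>).
       (compose (carrier A) \<alpha>' \<alpha>, \<lambda>m \<in> carrier M. \<tau>' m \<otimes>\<^bsub>A''\<^esub> \<alpha>' (\<tau> m)),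
     Id2 = \<lambda>A A' f. \<one>\<^bsub>A'\<^esub>,
     VComp = \<lambda>A A' f g h d c. d \<otimes>\<^bsub>A'\<^esub> c,
     HComp = \<lambda>A A' A'' f g h k d c. d \<otimes>\<^bsub>A''\<^esub> fst h c\<rparr>"

text \<open>Pseudo \<open>M\<close>-monoids and pseudo homomorphisms with, respectively, all lax 2-cells and only
  the pseudo (invertible) ones.\<close>

definition PsMonLax :: "'m monoid \<Rightarrow> ('a, 'm) lax_two_cat" where
  "PsMonLax M = (LaxMon M)\<lparr>Ob := {A. pseudo_monoid M A}, Hom := pseudo_hom M\<rparr>"

definition PsMon :: "'m monoid \<Rightarrow> ('a, 'm) lax_two_cat" where
  "PsMon M = (PsMonLax M)\<lparr>Cell := \<lambda>A A' f g. lax_cell M A A' f g \<inter> Units A'\<rparr>"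


section \<open>Prefibrations and fibrations of monoids\<close>

record ('e, 'm) mon_over = "'e monoid" +
  proj :: "'e \<Rightarrow> 'm"

definition precartesian :: "'m monoid \<Rightarrow> ('e, 'm) mon_over \<Rightarrow> 'e \<Rightarrow> bool" where
  "precartesian M E x \<longleftrightarrow> x \<in> carrier E \<and>
    (\<forall>z \<in> carrier E. proj E z = proj E x \<longrightarrow>
      (\<exists>!y. y \<in> kernel E M (proj E) \<and> z = x \<otimes>\<^bsub>E\<^esub> y))"

definition cartesian :: "'m monoid \<Rightarrow> ('e, 'm) mon_over \<Rightarrow> 'e \<Rightarrow> bool" where
  "cartesian M E x \<longleftrightarrow> x \<in> carrier E \<and>
    (\<forall>z \<in> carrier E. \<forall>v \<in> carrier M. proj E z = proj E x \<otimes>\<^bsub>M\<^esub> v \<longrightarrow>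
      (\<exists>y \<in> carrier E. z = x \<otimes>\<^bsub>E\<^esub> y \<and> proj E y = v)) \<and>
    (\<forall>y1 \<in> carrier E. \<forall>y2 \<in> carrier E.
      x \<otimes>\<^bsub>E\<^esub> y1 = x \<otimes>\<^bsub>E\<^esub> y2 \<and> proj E y1 = proj E y2 \<longrightarrow> y1 = y2)"

definition monoid_over :: "'m monoid \<Rightarrow> ('e, 'm) mon_over \<Rightarrow> bool" where
  "monoid_over M E \<longleftrightarrow> monoid M \<and> monoid E \<and> proj E \<in> mon_hom E M"

definition prefibration :: "'m monoid \<Rightarrow> ('e, 'm) mon_over \<Rightarrow> bool" where
  "prefibration M E \<longleftrightarrow> monoid_over M E \<and>
    (\<forall>m \<in> carrier M. \<exists>x. precartesian M E x \<and> proj E x = m)"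

definition fibration :: "'m monoid \<Rightarrow> ('e, 'm) mon_over \<Rightarrow> bool" where
  "fibration M E \<longleftrightarrow> monoid_over M E \<and>
    (\<forall>m \<in> carrier M. \<exists>x. cartesian M E x \<and> proj E x = m)"

definition over_hom :: "('e, 'm) mon_over \<Rightarrow> ('d, 'm) mon_over \<Rightarrow> ('e \<Rightarrow> 'd) set" where
  "over_hom E E' = {\<alpha> \<in> mon_hom E E'. \<forall>x \<in> carrier E. proj E' (\<alpha> x) = proj E x}"

definition cart_hom :: "'m monoid \<Rightarrow> ('e, 'm) mon_over \<Rightarrow> ('d, 'm) mon_over \<Rightarrow> ('e \<Rightarrow> 'd) set"
  where
  "cart_hom M E E' =
    {\<alpha> \<in> over_hom E E'. \<forall>x. precartesian M E x \<longrightarrow> precartesian M E' (\<alpha> x)}"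

definition over_cell ::
  "'m monoid \<Rightarrow> ('e, 'm) mon_over \<Rightarrow> ('d, 'm) mon_over \<Rightarrow> ('e \<Rightarrow> 'd) \<Rightarrow> ('e \<Rightarrow> 'd) \<Rightarrow> 'd set"
  where
  "over_cell M E E' \<alpha> \<beta> = {c \<in> carrier E'. proj E' c = \<one>\<^bsub>M\<^esub> \<and>
    (\<forall>x \<in> carrier E. c \<otimes>\<^bsub>E'\<^esub> \<alpha> x = \<beta> x \<otimes>\<^bsub>E'\<^esub> c)}"

type_synonym ('e, 'm) over_two_cat = "(('e, 'm) mon_over, 'e \<Rightarrow> 'e, 'e) two_cat"

definition PFib :: "'m monoid \<Rightarrow> ('e, 'm) over_two_cat" where
  "PFib M =
    \<lparr>Ob = {E. prefibration M E},
     Hom = over_hom,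
     Cell = over_cell M,
     Id1 = \<lambda>E. \<lambda>x \<in> carrier E. x,
     Comp1 = \<lambda>E E' E'' \<beta> \<alpha>. compose (carrier E) \<beta> \<alpha>,
     Id2 = \<lambda>E E' \<alpha>. \<one>\<^bsub>E'\<^esub>,
     VComp = \<lambda>E E' \<alpha> \<beta> \<delta> d c. d \<otimes>\<^bsub>E'\<^esub> c,
     HComp = \<lambda>E E' E'' \<alpha> \<beta> \<alpha>' \<beta>' d c. d \<otimes>\<^bsub>E''\<^esub> \<alpha>' c\<rparr>"

definition Fib :: "'m monoid \<Rightarrow> ('e, 'm) over_two_cat" where
  "Fib M = (PFib M)\<lparr>Ob := {E. fibration M E}, Hom := cart_hom M\<rparr>"


section \<open>The Grothendieck construction\<close>

definition groth_obj :: "'m monoid \<Rightarrow> ('a, 'm) lax_mon \<Rightarrow> ('m \<times> 'a, 'm) mon_over" where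
  "groth_obj M A =
    \<lparr>carrier = carrier M \<times> carrier A,
     mult = \<lambda>(m, a) (n, b). (m \<otimes>\<^bsub>M\<^esub> n, coh A m n \<otimes>\<^bsub>A\<^esub> act A n a \<otimes>\<^bsub>A\<^esub> b),
     one = (\<one>\<^bsub>M\<^esub>, \<one>\<^bsub>A\<^esub>),
     proj = \<lambda>(m, a) \<in> carrier M \<times> carrier A. m\<rparr>"

definition Groth ::
  "'m monoid \<Rightarrow> (('a, 'm) lax_mon, ('a \<Rightarrow> 'a) \<times> ('m \<Rightarrow> 'a), 'a,
    ('m \<times> 'a, 'm) mon_over, 'm \<times> 'a \<Rightarrow> 'm \<times> 'a, 'm \<times> 'a) two_fun" where
  "Groth M =
    \<lparr>F0 = groth_obj M,
     F1 = \<lambda>A A' (\<alpha>, \<tau>). \<lambda>(m, a) \<in> carrier M \<times> carrier A. (m, \<tau> m \<otimes>\<^bsub>A'\<^esub> \<alpha> a),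
     F2 = \<lambda>A A' f g c. (\<one>\<^bsub>M\<^esub>, c)\<rparr>"

text \<open>
  Two points about the use of \<^const>\<open>Groth\<close> as a 2-equivalence.

  \<^item> Lax \<open>M\<close>-monoids are carried by subsets of a type \<open>'a\<close> and monoids over \<open>M\<close> by subsets of
    \<open>'m \<times> 'a\<close>.  These universes must have the same size, that is, \<open>'m \<times> 'a\<close> must embed into
    \<open>'a\<close>: otherwise a prefibration carried by \<open>'m \<times> 'a\<close> may have a kernel that does not fit
    into \<open>'a\<close>.

  \<^item> All 2-cells of \<^const>\<open>PsMon\<close> are invertible, those of \<^const>\<open>Fib\<close> in general are not: for
    trivial \<open>M\<close>, every natural number is an endo-2-cell of the map from the trivial monoid to
    $(\mathbb{N},+)$.  A 2-equivalence is bijective on 2-cells, so on the level of 2-cells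
    \<^const>\<open>PsMon\<close> corresponds to \<^term>\<open>inv_cells (Fib M)\<close>, and \<^const>\<open>Fib\<close> to
    \<^const>\<open>PsMonLax\<close>.
\<close>

end

theory Submission
  imports Defs
begin

text \<open>
  A 2-functor that is bijective on 1-cells and on 2-cells, and that hits every object up to an
  invertible 1-cell, is a 2-equivalence (\<open>two_equivalence_if_essentially_surjective\<close>): choose
  for each object of the target an isomorphic object in the image, conjugate 1-cells and 2-cells
  with the chosen isomorphisms, and take preimages.  So everything reduces to three facts about
  the Grothendieck construction.

  Local bijectivity.  In $M \times A$ every element factors as $(m,a) = (m,1)(1,a)$.  Hence a monoid
  homomorphism over \<open>M\<close> between Grothendieck constructions is determined by its values on the
  elements $(1,a)$ and $(m,1)$, that is, by a map $\alpha$ and a family $\tau$.  The products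
  $(1,a)(1,b)$, $(1,a)(m,1)$ and $(m,1)(n,1)$ turn multiplicativity into exactly the three axioms
  of a lax homomorphism.  In the same way $(1,c)$ is a 2-cell iff \<open>c\<close> is one.  This also
  transports the laws of a 2-category from prefibrations to lax monoids, so that only the former
  need to be computed.

  Essential surjectivity.  In a prefibration choose a precartesian $x_m$ above each \<open>m\<close>,
  with $x_1 = 1$.  Every element above \<open>m\<close> is $x_m a$ for a unique \<open>a\<close> in the kernel.
  The equations $a x_m = x_m \phi_m(a)$ and $x_m x_n = x_{mn} \gamma_{m,n}$ therefore define an action
  and a coherence on the kernel.  Cancelling $x_m$ reduces each axiom of a lax monoid to the
  associativity of \<open>E\<close>, and $(m,a) \mapsto x_m a$ is an isomorphism onto \<open>E\<close>.  The assumed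
  injection moves the kernel into the type that carries the lax monoids.

  Restriction to fibrations.  An element $(m,a)$ of a Grothendieck construction is precartesian iff
  \<open>a\<close> is invertible.  Consequently the Grothendieck construction of a lax monoid is a fibration
  iff all $\gamma_{m,n}$ are invertible, and it maps a lax homomorphism to a cartesian morphism
  iff all $\tau_m$ are invertible.  So pseudo monoids and pseudo homomorphisms form the preimage of
  the sub-2-category of fibrations, and pseudo 2-cells the preimage of the invertible 2-cells, and
  local bijectivity passes to preimages (\<open>locally_bijective_preimage\<close>).
\<close>

section \<open>Replacing objects by isomorphic ones\<close>

text \<open>
  Given an isomorphism \<open>p e\<close> from \<open>r e\<close> to \<open>e\<close>, with inverse \<open>q e\<close>, for each object
  \<open>e\<close>, conjugation with these isomorphisms is a 2-functor that is \<open>r\<close> on objects and is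
  isomorphic to the identity.
\<close>

locale object_replacement = two_category D
  for D :: "('p, 'g, 'u) two_cat" +
  fixes r :: "'p \<Rightarrow> 'p" and p q :: "'p \<Rightarrow> 'g"
  assumes r_in: "e \<in> Ob D \<Longrightarrow> r e \<in> Ob D"
    and p_in: "e \<in> Ob D \<Longrightarrow> p e \<in> Hom D (r e) e"
    and q_in: "e \<in> Ob D \<Longrightarrow> q e \<in> Hom D e (r e)"
    and q_p: "e \<in> Ob D \<Longrightarrow> Comp1 D (r e) e (r e) (q e) (p e) = Id1 D (r e)"
    and p_q: "e \<in> Ob D \<Longrightarrow> Comp1 D e (r e) e (p e) (q e) = Id1 D e"
begin

lemmas cell_intros = r_in p_in q_in Id1_in Comp1_in Id2_in VComp_in HComp_in

definition conj1 :: "'p \<Rightarrow> 'p \<Rightarrow> 'g \<Rightarrow> 'g" where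
  "conj1 d e f = Comp1 D (r d) e (r e) (q e) (Comp1 D (r d) d e f (p d))"

definition conj2 :: "'p \<Rightarrow> 'p \<Rightarrow> 'g \<Rightarrow> 'g \<Rightarrow> 'u \<Rightarrow> 'u" where
  "conj2 d e f g s =
    HComp D (r d) e (r e) (Comp1 D (r d) d e f (p d)) (Comp1 D (r d) d e g (p d)) (q e) (q e)
      (Id2 D e (r e) (q e)) (HComp D (r d) d e (p d) (p d) f g s (Id2 D (r d) d (p d)))"

definition replacement :: "('p, 'g, 'u, 'p, 'g, 'u) two_fun" where
  "replacement = \<lparr>F0 = r, F1 = conj1, F2 = conj2\<rparr>"

lemma conj1_in:
  assumes "d \<in> Ob D" "e \<in> Ob D" "f \<in> Hom D d e"
  shows "conj1 d e f \<in> Hom D (r d) (r e)"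
  unfolding conj1_def by (intro cell_intros assms)

lemma conj2_in:
  assumes "d \<in> Ob D" "e \<in> Ob D" "f \<in> Hom D d e" "g \<in> Hom D d e" "s \<in> Cell D d e f g"
  shows "conj2 d e f g s \<in> Cell D (r d) (r e) (conj1 d e f) (conj1 d e g)"
  unfolding conj1_def conj2_def by (intro cell_intros assms)

lemma p_conj1:
  assumes "d \<in> Ob D" "e \<in> Ob D" "f \<in> Hom D d e"
  shows "Comp1 D (r d) (r e) e (p e) (conj1 d e f) = Comp1 D (r d) d e f (p d)"
proof -
  have k: "Comp1 D (r d) d e f (p d) \<in> Hom D (r d) e"
    by (intro cell_intros assms)
  show ?thesis
    unfolding conj1_def
    using Comp1_assoc[OF r_in[OF assms(1)] assms(2) r_in[OF assms(2)] assms(2) k q_in[OF assms(2)]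
        p_in[OF assms(2)]] Comp1_Id1_left[OF r_in[OF assms(1)] assms(2) k]
    by (simp add: p_q assms)
qed

lemma conj1_q:
  assumes "d \<in> Ob D" "e \<in> Ob D" "f \<in> Hom D d e"
  shows "Comp1 D d (r d) (r e) (conj1 d e f) (q d) = Comp1 D d e (r e) (q e) f"
proof -
  note in_D = assms cell_intros
  have "Comp1 D d (r d) (r e) (conj1 d e f) (q d)
      = Comp1 D d e (r e) (q e) (Comp1 D d (r d) e (Comp1 D (r d) d e f (p d)) (q d))"
    unfolding conj1_def by (rule Comp1_assoc) (intro in_D)+
  also have "Comp1 D d (r d) e (Comp1 D (r d) d e f (p d)) (q d)
      = Comp1 D d d e f (Comp1 D d (r d) d (p d) (q d))"
    by (rule Comp1_assoc) (intro in_D)+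
  finally show ?thesis
    by (simp add: p_q assms Comp1_Id1_right)
qed

text \<open>
  In the next two lemmas, whiskering with \<open>p\<close> cancels against whiskering with \<open>q\<close>, because
  the horizontal composite of their identity 2-cells is the identity 2-cell of an identity 1-cell.
\<close>
lemma p_conj2:
  assumes "d \<in> Ob D" "e \<in> Ob D" "f \<in> Hom D d e" "g \<in> Hom D d e" "s \<in> Cell D d e f g"
  shows "HComp D (r d) (r e) e (conj1 d e f) (conj1 d e g) (p e) (p e)
      (Id2 D (r e) e (p e)) (conj2 d e f g s)
    = HComp D (r d) d e (p d) (p d) f g s (Id2 D (r d) d (p d))" (is "?l = ?r")
proof -
  note in_D = assms cell_intros
  let ?fp = "Comp1 D (r d) d e f (p d)" and ?gp = "Comp1 D (r d) d e g (p d)"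
  have "?l = HComp D (r d) e e ?fp ?gp
      (Comp1 D e (r e) e (p e) (q e)) (Comp1 D e (r e) e (p e) (q e))
      (HComp D e (r e) e (q e) (q e) (p e) (p e) (Id2 D (r e) e (p e)) (Id2 D e (r e) (q e))) ?r"
    unfolding conj1_def conj2_def by (rule HComp_assoc[symmetric]) (intro in_D)+
  also have "HComp D e (r e) e (q e) (q e) (p e) (p e) (Id2 D (r e) e (p e)) (Id2 D e (r e) (q e))
      = Id2 D e e (Comp1 D e (r e) e (p e) (q e))"
    by (rule HComp_Id2) (intro in_D)+
  also have "Comp1 D e (r e) e (p e) (q e) = Id1 D e"
    by (rule p_q) fact
  also have "HComp D (r d) e e ?fp ?gp (Id1 D e) (Id1 D e) (Id2 D e e (Id1 D e)) ?r = ?r"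
    by (rule HComp_Id_left) (intro in_D)+
  finally show ?thesis .
qed

lemma conj2_q:
  assumes "d \<in> Ob D" "e \<in> Ob D" "f \<in> Hom D d e" "g \<in> Hom D d e" "s \<in> Cell D d e f g"
  shows "HComp D d (r d) (r e) (q d) (q d) (conj1 d e f) (conj1 d e g)
      (conj2 d e f g s) (Id2 D d (r d) (q d))
    = HComp D d e (r e) f g (q e) (q e) (Id2 D e (r e) (q e)) s" (is "?l = ?r")
proof -
  note in_D = assms cell_intros
  let ?fp = "Comp1 D (r d) d e f (p d)" and ?gp = "Comp1 D (r d) d e g (p d)"
  let ?sp = "HComp D (r d) d e (p d) (p d) f g s (Id2 D (r d) d (p d))"
  have pq: "HComp D d (r d) d (q d) (q d) (p d) (p d) (Id2 D (r d) d (p d)) (Id2 D d (r d) (q d))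
      = Id2 D d d (Comp1 D d (r d) d (p d) (q d))"
    by (rule HComp_Id2) (intro in_D)+
  have "HComp D d (r d) e (q d) (q d) ?fp ?gp ?sp (Id2 D d (r d) (q d))
      = HComp D d d e (Comp1 D d (r d) d (p d) (q d)) (Comp1 D d (r d) d (p d) (q d)) f g s
          (HComp D d (r d) d (q d) (q d) (p d) (p d) (Id2 D (r d) d (p d)) (Id2 D d (r d) (q d)))"
    by (rule HComp_assoc) (intro in_D)+
  also have "\<dots> = s"
    by (simp add: pq p_q assms HComp_Id_right)
  finally have sp: "HComp D d (r d) e (q d) (q d) ?fp ?gp ?sp (Id2 D d (r d) (q d)) = s" .
  have fpq: "Comp1 D d (r d) e (Comp1 D (r d) d e h (p d)) (q d) = h" if h: "h \<in> Hom D d e" for h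
  proof -
    have "Comp1 D d (r d) e (Comp1 D (r d) d e h (p d)) (q d)
      = Comp1 D d d e h (Comp1 D d (r d) d (p d) (q d))"
      by (rule Comp1_assoc) (intro in_D h)+
    then show ?thesis
      by (simp add: p_q assms h Comp1_Id1_right)
  qed
  have "?l = HComp D d e (r e)
      (Comp1 D d (r d) e ?fp (q d)) (Comp1 D d (r d) e ?gp (q d)) (q e) (q e) (Id2 D e (r e) (q e))
      (HComp D d (r d) e (q d) (q d) ?fp ?gp ?sp (Id2 D d (r d) (q d)))"
    unfolding conj1_def conj2_def by (rule HComp_assoc) (intro in_D)+
  also have "\<dots> = ?r"
    by (simp add: sp fpq assms)
  finally show ?thesis .
qed

text \<open>
  Both composition laws rest on the naturality of \<open>p\<close>: it moves \<open>p\<close> past the right factor,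
  where it meets the \<open>q\<close> hidden in that factor.
\<close>
lemma conj1_Comp1:
  assumes "c \<in> Ob D" "d \<in> Ob D" "e \<in> Ob D" "f \<in> Hom D c d" "g \<in> Hom D d e"
  shows "conj1 c e (Comp1 D c d e g f)
    = Comp1 D (r c) (r d) (r e) (conj1 d e g) (conj1 c d f)"
proof -
  note in_D = assms cell_intros conj1_in
  have "Comp1 D (r c) (r d) (r e) (conj1 d e g) (conj1 c d f)
      = Comp1 D (r c) e (r e) (q e)
          (Comp1 D (r c) (r d) e (Comp1 D (r d) d e g (p d)) (conj1 c d f))"
    unfolding conj1_def[of d] by (rule Comp1_assoc) (intro in_D)+
  also have "Comp1 D (r c) (r d) e (Comp1 D (r d) d e g (p d)) (conj1 c d f)
      = Comp1 D (r c) d e g (Comp1 D (r c) (r d) d (p d) (conj1 c d f))"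
    by (rule Comp1_assoc) (intro in_D)+
  also have "Comp1 D (r c) (r d) d (p d) (conj1 c d f) = Comp1 D (r c) c d f (p c)"
    by (rule p_conj1) fact+
  also have "Comp1 D (r c) d e g (Comp1 D (r c) c d f (p c))
      = Comp1 D (r c) c e (Comp1 D c d e g f) (p c)"
    by (rule Comp1_assoc[symmetric]) (intro in_D)+
  finally show ?thesis
    by (simp add: conj1_def)
qed

lemma conj2_HComp:
  assumes "c \<in> Ob D" "d \<in> Ob D" "e \<in> Ob D" "f \<in> Hom D c d" "g \<in> Hom D c d"
    "h \<in> Hom D d e" "k \<in> Hom D d e" "s \<in> Cell D c d f g" "t \<in> Cell D d e h k"
  shows "conj2 c e (Comp1 D c d e h f) (Comp1 D c d e k g) (HComp D c d e f g h k t s)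
    = HComp D (r c) (r d) (r e) (conj1 c d f) (conj1 c d g) (conj1 d e h) (conj1 d e k)
        (conj2 d e h k t) (conj2 c d f g s)"
proof -
  note in_D = assms cell_intros conj1_in conj2_in
  let ?hp = "Comp1 D (r d) d e h (p d)" and ?kp = "Comp1 D (r d) d e k (p d)"
  let ?tp = "HComp D (r d) d e (p d) (p d) h k t (Id2 D (r d) d (p d))"
  have eq1: "Comp1 D (r c) (r d) e (Comp1 D (r d) d e h' (p d)) (conj1 c d f')
      = Comp1 D (r c) c e (Comp1 D c d e h' f') (p c)"
    if "f' \<in> Hom D c d" "h' \<in> Hom D d e" for f' h'
  proof -
    have "Comp1 D (r c) (r d) e (Comp1 D (r d) d e h' (p d)) (conj1 c d f')
      = Comp1 D (r c) d e h' (Comp1 D (r c) (r d) d (p d) (conj1 c d f'))"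
      by (rule Comp1_assoc) (intro in_D that)+
    also have "Comp1 D (r c) (r d) d (p d) (conj1 c d f') = Comp1 D (r c) c d f' (p c)"
      by (rule p_conj1) fact+
    also have "Comp1 D (r c) d e h' (Comp1 D (r c) c d f' (p c))
      = Comp1 D (r c) c e (Comp1 D c d e h' f') (p c)"
      by (rule Comp1_assoc[symmetric]) (intro in_D that)+
    finally show ?thesis .
  qed
  have "HComp D (r c) (r d) e (conj1 c d f) (conj1 c d g) ?hp ?kp ?tp (conj2 c d f g s)
      = HComp D (r c) d e (Comp1 D (r c) (r d) d (p d) (conj1 c d f))
          (Comp1 D (r c) (r d) d (p d) (conj1 c d g)) h k t
          (HComp D (r c) (r d) d (conj1 c d f) (conj1 c d g) (p d) (p d)
            (Id2 D (r d) d (p d)) (conj2 c d f g s))"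
    by (rule HComp_assoc) (intro in_D)+
  also have "\<dots> = HComp D (r c) d e (Comp1 D (r c) c d f (p c)) (Comp1 D (r c) c d g (p c)) h k t
          (HComp D (r c) c d (p c) (p c) f g s (Id2 D (r c) c (p c)))"
    by (simp add: p_conj1 p_conj2 assms)
  also have "\<dots> = HComp D (r c) c e (p c) (p c) (Comp1 D c d e h f) (Comp1 D c d e k g)
      (HComp D c d e f g h k t s) (Id2 D (r c) c (p c))"
    by (rule HComp_assoc[symmetric]) (intro in_D)+
  finally have eq2: "HComp D (r c) (r d) e (conj1 c d f) (conj1 c d g) ?hp ?kp ?tp
      (conj2 c d f g s)
    = HComp D (r c) c e (p c) (p c) (Comp1 D c d e h f) (Comp1 D c d e k g)
      (HComp D c d e f g h k t s) (Id2 D (r c) c (p c))" .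
  have "HComp D (r c) (r d) (r e) (conj1 c d f) (conj1 c d g) (conj1 d e h) (conj1 d e k)
        (conj2 d e h k t) (conj2 c d f g s)
      = HComp D (r c) e (r e) (Comp1 D (r c) (r d) e ?hp (conj1 c d f))
          (Comp1 D (r c) (r d) e ?kp (conj1 c d g)) (q e) (q e) (Id2 D e (r e) (q e))
          (HComp D (r c) (r d) e (conj1 c d f) (conj1 c d g) ?hp ?kp ?tp (conj2 c d f g s))"
    unfolding conj1_def[of d] conj2_def[of d] by (rule HComp_assoc) (intro in_D)+
  then show ?thesis
    by (simp add: conj2_def[of c e] eq1 eq2 assms)
qed

text \<open>
  Writing the identity 2-cells of \<open>p\<close> and \<open>q\<close> as vertical composites of themselves makes
  the interchange law applicable.
\<close>
lemma conj2_VComp: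
  assumes "d \<in> Ob D" "e \<in> Ob D" "f \<in> Hom D d e" "g \<in> Hom D d e" "h \<in> Hom D d e"
    "s \<in> Cell D d e f g" "t \<in> Cell D d e g h"
  shows "conj2 d e f h (VComp D d e f g h t s)
    = VComp D (r d) (r e) (conj1 d e f) (conj1 d e g) (conj1 d e h)
        (conj2 d e g h t) (conj2 d e f g s)"
proof -
  note in_D = assms cell_intros
  let ?P = "Id2 D (r d) d (p d)" and ?Q = "Id2 D e (r e) (q e)"
  have PP: "VComp D (r d) d (p d) (p d) (p d) ?P ?P = ?P"
    by (rule VComp_Id2_left) (intro in_D)+
  have QQ: "VComp D e (r e) (q e) (q e) (q e) ?Q ?Q = ?Q"
    by (rule VComp_Id2_left) (intro in_D)+
  have "HComp D (r d) d e (p d) (p d) f h (VComp D d e f g h t s) ?P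
    = HComp D (r d) d e (p d) (p d) f h (VComp D d e f g h t s)
        (VComp D (r d) d (p d) (p d) (p d) ?P ?P)"
    by (simp add: PP)
  also have "\<dots> = VComp D (r d) e (Comp1 D (r d) d e f (p d)) (Comp1 D (r d) d e g (p d))
        (Comp1 D (r d) d e h (p d))
        (HComp D (r d) d e (p d) (p d) g h t ?P) (HComp D (r d) d e (p d) (p d) f g s ?P)"
    by (rule interchange) (intro in_D)+
  finally have "conj2 d e f h (VComp D d e f g h t s)
    = HComp D (r d) e (r e) (Comp1 D (r d) d e f (p d)) (Comp1 D (r d) d e h (p d)) (q e) (q e)
        (VComp D e (r e) (q e) (q e) (q e) ?Q ?Q)
        (VComp D (r d) e (Comp1 D (r d) d e f (p d)) (Comp1 D (r d) d e g (p d))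
          (Comp1 D (r d) d e h (p d))
          (HComp D (r d) d e (p d) (p d) g h t ?P) (HComp D (r d) d e (p d) (p d) f g s ?P))"
    by (simp add: conj2_def QQ)
  also have "\<dots> = VComp D (r d) (r e) (conj1 d e f) (conj1 d e g) (conj1 d e h)
        (conj2 d e g h t) (conj2 d e f g s)"
    unfolding conj1_def conj2_def by (rule interchange) (intro in_D)+
  finally show ?thesis .
qed

lemma two_functor_replacement: "two_functor D D replacement"
proof
  fix d assume "d \<in> Ob D"
  then show "F1 replacement d d (Id1 D d) = Id1 D (F0 replacement d)"
    by (simp add: replacement_def conj1_def Comp1_Id1_left q_p p_in r_in)
next
  fix d e f assume "d \<in> Ob D" "e \<in> Ob D" "f \<in> Hom D d e"
  then show "F2 replacement d e f f (Id2 D d e f)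
      = Id2 D (F0 replacement d) (F0 replacement e) (F1 replacement d e f)"
    by (simp add: replacement_def conj2_def conj1_def HComp_Id2 cell_intros)
qed (simp_all add: replacement_def r_in conj1_in conj2_in conj1_Comp1 conj2_VComp conj2_HComp)

lemma two_nat_iso_replacement: "two_nat_iso D D replacement two_id p"
  unfolding two_nat_iso_def iso1_def replacement_def two_id_def
  by (auto simp: p_conj1 p_conj2 p_in intro!: bexI[OF _ q_in] q_p p_q)

end

section \<open>Locally bijective 2-functors\<close>

locale locally_bijective_two_functor = two_functor C D F
  for C :: "('o, 'f, 't) two_cat" and D :: "('p, 'g, 'u) two_cat"
    and F :: "('o, 'f, 't, 'p, 'g, 'u) two_fun" +
  assumes F1_bij: "\<lbrakk>x \<in> Ob C; y \<in> Ob C\<rbrakk> \<Longrightarrow> bij_betw (F1 F x y) (Hom C x y) (Hom D (F0 F x) (F0 F y))"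
    and F2_bij: "\<lbrakk>x \<in> Ob C; y \<in> Ob C; f \<in> Hom C x y; g \<in> Hom C x y\<rbrakk>
      \<Longrightarrow> bij_betw (F2 F x y f g) (Cell C x y f g)
            (Cell D (F0 F x) (F0 F y) (F1 F x y f) (F1 F x y g))"
begin

definition lift1 where "lift1 x y = the_inv_into (Hom C x y) (F1 F x y)"
definition lift2 where "lift2 x y f g = the_inv_into (Cell C x y f g) (F2 F x y f g)"

lemma F1_eqD:
  assumes "x \<in> Ob C" "y \<in> Ob C" "f \<in> Hom C x y" "g \<in> Hom C x y" "F1 F x y f = F1 F x y g"
  shows "f = g"
  using F1_bij[of x y] assms by (auto simp: bij_betw_def inj_on_def)

lemma F2_eqD:
  assumes "x \<in> Ob C" "y \<in> Ob C" "f \<in> Hom C x y" "g \<in> Hom C x y"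
    "s \<in> Cell C x y f g" "t \<in> Cell C x y f g" "F2 F x y f g s = F2 F x y f g t"
  shows "s = t"
  using F2_bij[of x y f g] assms by (auto simp: bij_betw_def inj_on_def)

lemma lift1:
  assumes "x \<in> Ob C" "y \<in> Ob C" "f \<in> Hom D (F0 F x) (F0 F y)"
  shows "lift1 x y f \<in> Hom C x y" "F1 F x y (lift1 x y f) = f"
  using F1_bij[of x y] assms f_the_inv_into_f_bij_betw[of "F1 F x y"]
    bij_betw_apply[OF bij_betw_the_inv_into[OF F1_bij[of x y]]]
  by (auto simp: lift1_def)

lemma lift2:
  assumes "x \<in> Ob C" "y \<in> Ob C" "f \<in> Hom C x y" "g \<in> Hom C x y"
    "s \<in> Cell D (F0 F x) (F0 F y) (F1 F x y f) (F1 F x y g)"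
  shows "lift2 x y f g s \<in> Cell C x y f g" "F2 F x y f g (lift2 x y f g s) = s"
  using F2_bij[of x y f g] assms f_the_inv_into_f_bij_betw[of "F2 F x y f g"]
    bij_betw_apply[OF bij_betw_the_inv_into[OF F2_bij[of x y f g]]]
  by (auto simp: lift2_def)

text \<open>
  A 2-functor whose objects lie in the image of a locally bijective one factors through it: take
  preimages of 1-cells and 2-cells.  The preimages satisfy the laws of a 2-functor because \<open>F\<close>
  preserves all operations and is locally injective.
\<close>
lemma ex_lift_two_functor:
  fixes T :: "('e, 'h, 'v, 'p, 'g, 'u) two_fun"
  assumes "two_functor B D T" and g0: "\<And>e. e \<in> Ob B \<Longrightarrow> g0 e \<in> Ob C \<and> F0 F (g0 e) = F0 T e"
  obtains G where "two_functor B C G" "F0 G = g0"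
    "\<And>d e f. \<lbrakk>d \<in> Ob B; e \<in> Ob B; f \<in> Hom B d e\<rbrakk> \<Longrightarrow> F1 F (g0 d) (g0 e) (F1 G d e f) = F1 T d e f"
    "\<And>d e f g s. \<lbrakk>d \<in> Ob B; e \<in> Ob B; f \<in> Hom B d e; g \<in> Hom B d e; s \<in> Cell B d e f g\<rbrakk>
      \<Longrightarrow> F2 F (g0 d) (g0 e) (F1 G d e f) (F1 G d e g) (F2 G d e f g s) = F2 T d e f g s"
proof -
  interpret T: two_functor B D T by fact
  define G where "G = \<lparr>F0 = g0, F1 = \<lambda>d e f. lift1 (g0 d) (g0 e) (F1 T d e f),
    F2 = \<lambda>d e f g s. lift2 (g0 d) (g0 e) (lift1 (g0 d) (g0 e) (F1 T d e f))
      (lift1 (g0 d) (g0 e) (F1 T d e g)) (F2 T d e f g s)\<rparr>"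
  have G0: "F0 G = g0" and G0_in: "\<And>e. e \<in> Ob B \<Longrightarrow> F0 G e \<in> Ob C"
    by (auto simp: G_def g0)
  have G1: "F1 G d e f \<in> Hom C (F0 G d) (F0 G e)" "F1 F (F0 G d) (F0 G e) (F1 G d e f) = F1 T d e f"
    if "d \<in> Ob B" "e \<in> Ob B" "f \<in> Hom B d e" for d e f
    using that lift1[of "g0 d" "g0 e" "F1 T d e f"] g0 T.F1_in by (auto simp: G_def)
  have G2: "F2 G d e f g s \<in> Cell C (F0 G d) (F0 G e) (F1 G d e f) (F1 G d e g)"
    "F2 F (F0 G d) (F0 G e) (F1 G d e f) (F1 G d e g) (F2 G d e f g s) = F2 T d e f g s"
    if "d \<in> Ob B" "e \<in> Ob B" "f \<in> Hom B d e" "g \<in> Hom B d e" "s \<in> Cell B d e f g" for d e f g s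
    using that lift2[of "g0 d" "g0 e" "F1 G d e f" "F1 G d e g" "F2 T d e f g s"]
      g0 T.F2_in[OF that] G1[OF that(1-3)] G1[OF that(1,2,4)]
    by (auto simp: G_def)
  have FG0: "F0 F (F0 G e) = F0 T e" if "e \<in> Ob B" for e
    by (simp add: G0 g0 that)
  note in_rules = G0_in G1(1) G2(1) T.C.Id1_in T.C.Comp1_in T.C.Id2_in T.C.VComp_in T.C.HComp_in
    C.Id1_in C.Comp1_in C.Id2_in C.VComp_in C.HComp_in
  have G_Id: "F1 G x x (Id1 B x) = Id1 C (F0 G x)" if "x \<in> Ob B" for x
    by (rule F1_eqD[of "F0 G x" "F0 G x"])
      (simp_all add: that in_rules G1 FG0 F1_Id1 T.F1_Id1)
  have G_Comp: "F1 G x z (Comp1 B x y z g f)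
      = Comp1 C (F0 G x) (F0 G y) (F0 G z) (F1 G y z g) (F1 G x y f)"
    if "x \<in> Ob B" "y \<in> Ob B" "z \<in> Ob B" "f \<in> Hom B x y" "g \<in> Hom B y z" for x y z f g
  proof (rule F1_eqD[of "F0 G x" "F0 G z"])
    show "F1 G x z (Comp1 B x y z g f) \<in> Hom C (F0 G x) (F0 G z)"
      by (intro in_rules that)
    show "Comp1 C (F0 G x) (F0 G y) (F0 G z) (F1 G y z g) (F1 G x y f) \<in> Hom C (F0 G x) (F0 G z)"
      by (intro in_rules that)
    show "F1 F (F0 G x) (F0 G z) (F1 G x z (Comp1 B x y z g f))
      = F1 F (F0 G x) (F0 G z)
          (Comp1 C (F0 G x) (F0 G y) (F0 G z) (F1 G y z g) (F1 G x y f))"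
      using that F1_Comp1[of "F0 G x" "F0 G y" "F0 G z" "F1 G x y f" "F1 G y z g"]
        T.C.Comp1_in[OF that]
      by (simp add: in_rules G1 FG0 T.F1_Comp1)
  qed (simp_all add: that in_rules)
  have "two_functor B C G"
  proof
    fix x y f assume a: "x \<in> Ob B" "y \<in> Ob B" "f \<in> Hom B x y"
    show "F2 G x y f f (Id2 B x y f) = Id2 C (F0 G x) (F0 G y) (F1 G x y f)"
      by (rule F2_eqD[of "F0 G x" "F0 G y" "F1 G x y f" "F1 G x y f"])
        (simp_all add: a in_rules G1 G2 FG0 F2_Id2 T.F2_Id2)
  next
    fix x y f g h s t
    assume a: "x \<in> Ob B" "y \<in> Ob B" "f \<in> Hom B x y" "g \<in> Hom B x y" "h \<in> Hom B x y"
      "s \<in> Cell B x y f g" "t \<in> Cell B x y g h"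
    show "F2 G x y f h (VComp B x y f g h t s)
      = VComp C (F0 G x) (F0 G y) (F1 G x y f) (F1 G x y g) (F1 G x y h)
          (F2 G x y g h t) (F2 G x y f g s)"
    proof (rule F2_eqD[of "F0 G x" "F0 G y" "F1 G x y f" "F1 G x y h"])
      show "F2 G x y f h (VComp B x y f g h t s)
        \<in> Cell C (F0 G x) (F0 G y) (F1 G x y f) (F1 G x y h)"
        by (intro in_rules a)
      show "VComp C (F0 G x) (F0 G y) (F1 G x y f) (F1 G x y g) (F1 G x y h)
          (F2 G x y g h t) (F2 G x y f g s) \<in> Cell C (F0 G x) (F0 G y) (F1 G x y f) (F1 G x y h)"
        by (intro in_rules a)
      show "F2 F (F0 G x) (F0 G y) (F1 G x y f) (F1 G x y h)
          (F2 G x y f h (VComp B x y f g h t s))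
        = F2 F (F0 G x) (F0 G y) (F1 G x y f) (F1 G x y h)
           (VComp C (F0 G x) (F0 G y) (F1 G x y f) (F1 G x y g) (F1 G x y h)
          (F2 G x y g h t) (F2 G x y f g s))"
        using a T.C.VComp_in[OF a]
          F2_VComp[of "F0 G x" "F0 G y" "F1 G x y f" "F1 G x y g" "F1 G x y h"
            "F2 G x y f g s" "F2 G x y g h t"]
        by (simp add: in_rules G1 G2 FG0 T.F2_VComp)
    qed (simp_all add: a in_rules)
  next
    fix x y z f g h k s t
    assume a: "x \<in> Ob B" "y \<in> Ob B" "z \<in> Ob B" "f \<in> Hom B x y" "g \<in> Hom B x y"
      "h \<in> Hom B y z" "k \<in> Hom B y z" "s \<in> Cell B x y f g" "t \<in> Cell B y z h k"
    let ?f = "F1 G x y f" and ?g = "F1 G x y g" and ?h = "F1 G y z h" and ?k = "F1 G y z k"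
    let ?hf = "Comp1 B x y z h f" and ?kg = "Comp1 B x y z k g"
    have hf: "?hf \<in> Hom B x z" and kg: "?kg \<in> Hom B x z"
      by (intro in_rules a)+
    have ts: "HComp B x y z f g h k t s \<in> Cell B x z ?hf ?kg"
      by (intro in_rules a)
    have C: "Comp1 C (F0 G x) (F0 G y) (F0 G z) ?h ?f = F1 G x z ?hf"
      "Comp1 C (F0 G x) (F0 G y) (F0 G z) ?k ?g = F1 G x z ?kg"
      using a by (simp_all add: G_Comp)
    show "F2 G x z ?hf ?kg (HComp B x y z f g h k t s)
      = HComp C (F0 G x) (F0 G y) (F0 G z) ?f ?g ?h ?k (F2 G y z h k t) (F2 G x y f g s)"
    proof (rule F2_eqD[of "F0 G x" "F0 G z" "F1 G x z ?hf" "F1 G x z ?kg"])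
      show "HComp C (F0 G x) (F0 G y) (F0 G z) ?f ?g ?h ?k (F2 G y z h k t) (F2 G x y f g s)
          \<in> Cell C (F0 G x) (F0 G z) (F1 G x z ?hf) (F1 G x z ?kg)"
        unfolding C[symmetric] by (intro in_rules a)
      have "F2 F (F0 G x) (F0 G z) (F1 G x z ?hf) (F1 G x z ?kg)
          (HComp C (F0 G x) (F0 G y) (F0 G z) ?f ?g ?h ?k (F2 G y z h k t) (F2 G x y f g s))
        = HComp D (F0 T x) (F0 T y) (F0 T z) (F1 T x y f) (F1 T x y g) (F1 T y z h) (F1 T y z k)
          (F2 T y z h k t) (F2 T x y f g s)"
        using a F2_HComp[of "F0 G x" "F0 G y" "F0 G z" ?f ?g ?h ?k
            "F2 G x y f g s" "F2 G y z h k t"]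
        by (simp add: C in_rules G1 G2 FG0)
      then show "F2 F (F0 G x) (F0 G z) (F1 G x z ?hf) (F1 G x z ?kg)
          (F2 G x z ?hf ?kg (HComp B x y z f g h k t s))
        = F2 F (F0 G x) (F0 G z) (F1 G x z ?hf) (F1 G x z ?kg)
          (HComp C (F0 G x) (F0 G y) (F0 G z) ?f ?g ?h ?k (F2 G y z h k t) (F2 G x y f g s))"
        using a hf kg ts by (simp add: G2 T.F2_HComp)
    qed (simp_all add: a hf kg ts in_rules)
  qed (simp_all add: G0_in G1 G2 G_Id G_Comp)
  with that[of G] show thesis
    using G0 G1(2) G2(2) by simp
qed

text \<open>
  The quasi-inverse \<open>G\<close> is the lift along \<open>F\<close> of the replacement 2-functor on \<open>D\<close>.  Then
  $FG$ is that replacement, so its isomorphism with the identity is \<open>p\<close>.  The unit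
  $1 \Rightarrow GF$ is the lift of \<open>q\<close>; it is natural because its image under \<open>F\<close> is.
\<close>
lemma two_equivalence_if_essentially_surjective:
  assumes ess: "\<And>e. e \<in> Ob D \<Longrightarrow> \<exists>x \<in> Ob C. \<exists>h. iso1 D (F0 F x) e h"
  shows "two_equivalence C D F"
proof -
  have "\<forall>e. \<exists>x h k. e \<in> Ob D \<longrightarrow> x \<in> Ob C \<and> h \<in> Hom D (F0 F x) e \<and> k \<in> Hom D e (F0 F x)
    \<and> Comp1 D (F0 F x) e (F0 F x) k h = Id1 D (F0 F x) \<and> Comp1 D e (F0 F x) e h k = Id1 D e"
    using ess unfolding iso1_def by blast
  then obtain g0 p q where g0: "\<And>e. e \<in> Ob D \<Longrightarrow> g0 e \<in> Ob C"
    and pq: "\<And>e. e \<in> Ob D \<Longrightarrow> p e \<in> Hom D (F0 F (g0 e)) e \<and> q e \<in> Hom D e (F0 F (g0 e))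
      \<and> Comp1 D (F0 F (g0 e)) e (F0 F (g0 e)) (q e) (p e) = Id1 D (F0 F (g0 e))
      \<and> Comp1 D e (F0 F (g0 e)) e (p e) (q e) = Id1 D e"
    by metis
  interpret R: object_replacement D "\<lambda>e. F0 F (g0 e)" p q
    by unfold_locales (simp_all add: g0 pq F0_in)
  obtain G where G: "two_functor D C G" and G0: "F0 G = g0"
    and G1: "\<And>d e f. \<lbrakk>d \<in> Ob D; e \<in> Ob D; f \<in> Hom D d e\<rbrakk>
      \<Longrightarrow> F1 F (g0 d) (g0 e) (F1 G d e f) = R.conj1 d e f"
    and G2: "\<And>d e f g s. \<lbrakk>d \<in> Ob D; e \<in> Ob D; f \<in> Hom D d e; g \<in> Hom D d e; s \<in> Cell D d e f g\<rbrakk>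
      \<Longrightarrow> F2 F (g0 d) (g0 e) (F1 G d e f) (F1 G d e g) (F2 G d e f g s) = R.conj2 d e f g s"
    using ex_lift_two_functor[OF R.two_functor_replacement, of g0] g0
    by (auto simp: R.replacement_def)
  interpret G: two_functor D C G by fact
  have \<epsilon>: "two_nat_iso D D (two_comp F G) two_id p"
    using R.two_nat_iso_replacement
    by (simp add: two_nat_iso_def two_comp_def R.replacement_def two_id_def G0 G1 G2)
  define gf where "gf x = g0 (F0 F x)" for x
  define \<eta> where "\<eta> x = lift1 x (gf x) (q (F0 F x))" for x
  define \<theta> where "\<theta> x = lift1 (gf x) x (p (F0 F x))" for x
  define GF1 where "GF1 x y f = F1 G (F0 F x) (F0 F y) (F1 F x y f)" for x y f
  define GF2 where "GF2 x y f g s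
    = F2 G (F0 F x) (F0 F y) (F1 F x y f) (F1 F x y g) (F2 F x y f g s)" for x y f g s
  have gf: "gf x \<in> Ob C" if "x \<in> Ob C" for x
    using that by (simp add: gf_def g0 F0_in)
  have \<eta>: "\<eta> x \<in> Hom C x (gf x)" "F1 F x (gf x) (\<eta> x) = q (F0 F x)"
    and \<theta>: "\<theta> x \<in> Hom C (gf x) x" "F1 F (gf x) x (\<theta> x) = p (F0 F x)" if "x \<in> Ob C" for x
    using that lift1[of x "gf x" "q (F0 F x)"] lift1[of "gf x" x "p (F0 F x)"] pq[of "F0 F x"]
    by (simp_all add: \<eta>_def \<theta>_def gf F0_in) (simp_all add: gf_def)
  have GF1: "GF1 x y f \<in> Hom C (gf x) (gf y)"
      "F1 F (gf x) (gf y) (GF1 x y f) = R.conj1 (F0 F x) (F0 F y) (F1 F x y f)"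
    if "x \<in> Ob C" "y \<in> Ob C" "f \<in> Hom C x y" for x y f
    using that G.F1_in[of "F0 F x" "F0 F y" "F1 F x y f"]
    by (simp_all add: GF1_def gf_def G0 G1 F0_in F1_in)
  have GF2: "GF2 x y f g s \<in> Cell C (gf x) (gf y) (GF1 x y f) (GF1 x y g)"
    "F2 F (gf x) (gf y) (GF1 x y f) (GF1 x y g) (GF2 x y f g s)
      = R.conj2 (F0 F x) (F0 F y) (F1 F x y f) (F1 F x y g) (F2 F x y f g s)"
    if "x \<in> Ob C" "y \<in> Ob C" "f \<in> Hom C x y" "g \<in> Hom C x y" "s \<in> Cell C x y f g" for x y f g s
    using that G.F2_in[of "F0 F x" "F0 F y" "F1 F x y f" "F1 F x y g" "F2 F x y f g s"]
    by (simp_all add: GF1_def GF2_def gf_def G0 G2 F0_in F1_in F2_in)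
  have pq_gf: "Comp1 D (F0 F (gf x)) (F0 F x) (F0 F (gf x)) (q (F0 F x)) (p (F0 F x))
      = Id1 D (F0 F (gf x))"
    "Comp1 D (F0 F x) (F0 F (gf x)) (F0 F x) (p (F0 F x)) (q (F0 F x)) = Id1 D (F0 F x)"
    if "x \<in> Ob C" for x
    using pq[of "F0 F x"] that by (simp_all add: gf_def F0_in)
  note in_rules = gf \<eta>(1) \<theta>(1) GF1(1) GF2(1) C.Id1_in C.Comp1_in C.Id2_in C.HComp_in
  have \<eta>_iso: "iso1 C x (gf x) (\<eta> x)" if x: "x \<in> Ob C" for x
    unfolding iso1_def
  proof (intro conjI bexI)
    show "Comp1 C x (gf x) x (\<theta> x) (\<eta> x) = Id1 C x"
    proof (rule F1_eqD[of x x])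
      show "F1 F x x (Comp1 C x (gf x) x (\<theta> x) (\<eta> x)) = F1 F x x (Id1 C x)"
        using x by (subst F1_Comp1[OF x gf x]) (simp_all add: \<eta> \<theta> F1_Id1 pq_gf)
    qed (simp_all add: x in_rules)
    show "Comp1 C (gf x) x (gf x) (\<eta> x) (\<theta> x) = Id1 C (gf x)"
    proof (rule F1_eqD[of "gf x" "gf x"])
      show "F1 F (gf x) (gf x) (Comp1 C (gf x) x (gf x) (\<eta> x) (\<theta> x))
        = F1 F (gf x) (gf x) (Id1 C (gf x))"
        using x by (subst F1_Comp1[OF gf x gf]) (simp_all add: \<eta> \<theta> F1_Id1 gf pq_gf)
    qed (simp_all add: x in_rules)
  qed (simp_all add: x in_rules)
  have \<eta>_nat1: "Comp1 C x (gf x) (gf y) (GF1 x y f) (\<eta> x) = Comp1 C x y (gf y) (\<eta> y) f"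
    if a: "x \<in> Ob C" "y \<in> Ob C" "f \<in> Hom C x y" for x y f
  proof (rule F1_eqD[of x "gf y"])
    show "Comp1 C x (gf x) (gf y) (GF1 x y f) (\<eta> x) \<in> Hom C x (gf y)"
      "Comp1 C x y (gf y) (\<eta> y) f \<in> Hom C x (gf y)"
      by (intro in_rules a)+
    have "F1 F x (gf y) (Comp1 C x (gf x) (gf y) (GF1 x y f) (\<eta> x))
      = Comp1 D (F0 F x) (F0 F (gf x)) (F0 F (gf y))
          (R.conj1 (F0 F x) (F0 F y) (F1 F x y f)) (q (F0 F x))"
      using a by (subst F1_Comp1[of x "gf x" "gf y"]) (simp_all add: in_rules GF1 \<eta>)
    also have "\<dots> = Comp1 D (F0 F x) (F0 F y) (F0 F (gf y)) (q (F0 F y)) (F1 F x y f)"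
      unfolding gf_def using a by (intro R.conj1_q F0_in F1_in)
    also have "\<dots> = F1 F x (gf y) (Comp1 C x y (gf y) (\<eta> y) f)"
      using a by (subst F1_Comp1[of x y "gf y"]) (simp_all add: in_rules \<eta>)
    finally show "F1 F x (gf y) (Comp1 C x (gf x) (gf y) (GF1 x y f) (\<eta> x))
      = F1 F x (gf y) (Comp1 C x y (gf y) (\<eta> y) f)" .
  qed (simp_all add: a in_rules)
  have \<eta>_nat2: "HComp C x (gf x) (gf y) (\<eta> x) (\<eta> x) (GF1 x y f) (GF1 x y g) (GF2 x y f g s)
        (Id2 C x (gf x) (\<eta> x))
      = HComp C x y (gf y) f g (\<eta> y) (\<eta> y) (Id2 C y (gf y) (\<eta> y)) s" (is "?l = ?r")
    if a: "x \<in> Ob C" "y \<in> Ob C" "f \<in> Hom C x y" "g \<in> Hom C x y" "s \<in> Cell C x y f g"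
    for x y f g s
  proof -
    let ?f = "Comp1 C x y (gf y) (\<eta> y) f" and ?g = "Comp1 C x y (gf y) (\<eta> y) g"
    have f: "Comp1 C x (gf x) (gf y) (GF1 x y f) (\<eta> x) = ?f"
      and g: "Comp1 C x (gf x) (gf y) (GF1 x y g) (\<eta> x) = ?g"
      by (intro \<eta>_nat1 a)+
    show ?thesis
    proof (rule F2_eqD[of x "gf y" ?f ?g])
      show "?l \<in> Cell C x (gf y) ?f ?g"
        unfolding f[symmetric] g[symmetric] by (intro in_rules a)
      show "?r \<in> Cell C x (gf y) ?f ?g" "?f \<in> Hom C x (gf y)" "?g \<in> Hom C x (gf y)"
        by (intro in_rules a)+
      have "F2 F x (gf y) ?f ?g ?l
        = HComp D (F0 F x) (F0 F (gf x)) (F0 F (gf y)) (q (F0 F x)) (q (F0 F x))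
            (R.conj1 (F0 F x) (F0 F y) (F1 F x y f)) (R.conj1 (F0 F x) (F0 F y) (F1 F x y g))
            (R.conj2 (F0 F x) (F0 F y) (F1 F x y f) (F1 F x y g) (F2 F x y f g s))
            (Id2 D (F0 F x) (F0 F (gf x)) (q (F0 F x)))"
        unfolding f[symmetric] g[symmetric]
        using a by (subst F2_HComp[of x "gf x" "gf y"]) (simp_all add: in_rules GF1 GF2 \<eta> F2_Id2)
      also have "\<dots> = HComp D (F0 F x) (F0 F y) (F0 F (gf y)) (F1 F x y f) (F1 F x y g)
          (q (F0 F y)) (q (F0 F y)) (Id2 D (F0 F y) (F0 F (gf y)) (q (F0 F y))) (F2 F x y f g s)"
        unfolding gf_def using a by (intro R.conj2_q F0_in F1_in F2_in)
      also have "\<dots> = F2 F x (gf y) ?f ?g ?r"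
        using a by (subst F2_HComp[of x y "gf y"]) (simp_all add: in_rules \<eta> F2_Id2)
      finally show "F2 F x (gf y) ?f ?g ?l = F2 F x (gf y) ?f ?g ?r" .
    qed (simp_all add: a in_rules)
  qed
  have "two_nat_iso C C two_id (two_comp G F) \<eta>"
    using \<eta>_iso \<eta>_nat1 \<eta>_nat2
    by (simp add: two_nat_iso_def two_comp_def two_id_def G0 GF1_def GF2_def gf_def)
  with G \<epsilon> show ?thesis
    using two_functor_axioms unfolding two_equivalence_def by blast
qed

end

section \<open>Sub-2-categories and preimages\<close>

locale sub_two_category = two_category C for C :: "('o, 'f, 't) two_cat" +
  fixes C' :: "('o, 'f, 't) two_cat"
  assumes same: "Id1 C' = Id1 C" "Comp1 C' = Comp1 C" "Id2 C' = Id2 C" "VComp C' = VComp C"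
      "HComp C' = HComp C"
    and Ob_sub: "x \<in> Ob C' \<Longrightarrow> x \<in> Ob C"
    and Hom_sub: "\<lbrakk>x \<in> Ob C'; y \<in> Ob C'; f \<in> Hom C' x y\<rbrakk> \<Longrightarrow> f \<in> Hom C x y"
    and Cell_sub: "\<lbrakk>x \<in> Ob C'; y \<in> Ob C'; f \<in> Hom C' x y; g \<in> Hom C' x y; s \<in> Cell C' x y f g\<rbrakk>
      \<Longrightarrow> s \<in> Cell C x y f g"
    and Id1_sub: "x \<in> Ob C' \<Longrightarrow> Id1 C x \<in> Hom C' x x"
    and Comp1_sub: "\<lbrakk>x \<in> Ob C'; y \<in> Ob C'; z \<in> Ob C'; f \<in> Hom C' x y; g \<in> Hom C' y z\<rbrakk>
      \<Longrightarrow> Comp1 C x y z g f \<in> Hom C' x z"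
    and Id2_sub: "\<lbrakk>x \<in> Ob C'; y \<in> Ob C'; f \<in> Hom C' x y\<rbrakk> \<Longrightarrow> Id2 C x y f \<in> Cell C' x y f f"
    and VComp_sub: "\<lbrakk>x \<in> Ob C'; y \<in> Ob C'; f \<in> Hom C' x y; g \<in> Hom C' x y; h \<in> Hom C' x y;
        s \<in> Cell C' x y f g; t \<in> Cell C' x y g h\<rbrakk>
      \<Longrightarrow> VComp C x y f g h t s \<in> Cell C' x y f h"
    and HComp_sub: "\<lbrakk>x \<in> Ob C'; y \<in> Ob C'; z \<in> Ob C';
        f \<in> Hom C' x y; g \<in> Hom C' x y; h \<in> Hom C' y z; k \<in> Hom C' y z;
        s \<in> Cell C' x y f g; t \<in> Cell C' y z h k\<rbrakk>
      \<Longrightarrow> HComp C x y z f g h k t s \<in> Cell C' x z (Comp1 C x y z h f) (Comp1 C x y z k g)"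
begin

lemma two_category_sub: "two_category C'"
  by unfold_locales
    (simp_all only: same Id1_sub Comp1_sub Id2_sub VComp_sub HComp_sub,
     auto intro!: Comp1_Id1_left Comp1_Id1_right Comp1_assoc VComp_Id2_left VComp_Id2_right VComp_assoc
        HComp_Id2 interchange HComp_Id_left HComp_Id_right HComp_assoc Ob_sub
        simp: Hom_sub Cell_sub)

end

lemma two_functor_enlarge_target:
  assumes "two_functor C D' F" and "sub_two_category D D'"
  shows "two_functor C D F"
proof -
  interpret F: two_functor C D' F by fact
  interpret D': sub_two_category D D' by fact
  note D'_in = F.F0_in F.F1_in F.F2_in
  show ?thesis
    by unfold_locales
      (use D'_in in \<open>simp_all add: D'.Ob_sub D'.Hom_sub D'.Cell_sub F.F1_Id1 F.F1_Comp1 F.F2_Id2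
        F.F2_VComp F.F2_HComp D'.same\<close>)
qed

text \<open>
  Invertible 2-cells are closed under horizontal composition by the interchange law.
\<close>
lemma sub_two_category_inv_cells:
  assumes "two_category C"
  shows "sub_two_category C (inv_cells C)"
proof -
  interpret two_category C by fact
  show ?thesis
  proof
    fix x y f assume a: "x \<in> Ob (inv_cells C)" "y \<in> Ob (inv_cells C)" "f \<in> Hom (inv_cells C) x y"
    have "Id2 C x y f \<in> Cell C x y f f" "VComp C x y f f f (Id2 C x y f) (Id2 C x y f) = Id2 C x y f"
      using a VComp_Id2_left[of x y f f "Id2 C x y f"] by (simp_all add: inv_cells_def Id2_in)
    then show "Id2 C x y f \<in> Cell (inv_cells C) x y f f"
      by (auto simp: inv_cells_def iso2_def)
  next
    fix x y f g h s t
    assume a: "x \<in> Ob (inv_cells C)" "y \<in> Ob (inv_cells C)" "f \<in> Hom (inv_cells C) x y"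
      "g \<in> Hom (inv_cells C) x y" "h \<in> Hom (inv_cells C) x y"
      and "s \<in> Cell (inv_cells C) x y f g" "t \<in> Cell (inv_cells C) x y g h"
    then obtain s' t' where s: "s \<in> Cell C x y f g" "s' \<in> Cell C x y g f"
      "VComp C x y f g f s' s = Id2 C x y f" "VComp C x y g f g s s' = Id2 C x y g"
      and t: "t \<in> Cell C x y g h" "t' \<in> Cell C x y h g"
      "VComp C x y g h g t' t = Id2 C x y g" "VComp C x y h g h t t' = Id2 C x y h"
      by (auto simp: inv_cells_def iso2_def)
    have inv: "VComp C x y f h f (VComp C x y h g f s' t') (VComp C x y f g h t s) = Id2 C x y f"
      if a: "x \<in> Ob C" "y \<in> Ob C" "f \<in> Hom C x y" "g \<in> Hom C x y" "h \<in> Hom C x y"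
      and s: "s \<in> Cell C x y f g" "s' \<in> Cell C x y g f" "VComp C x y f g f s' s = Id2 C x y f"
      and t: "t \<in> Cell C x y g h" "t' \<in> Cell C x y h g" "VComp C x y g h g t' t = Id2 C x y g"
      for f g h s s' t t'
    proof -
      have "VComp C x y f h f (VComp C x y h g f s' t') (VComp C x y f g h t s)
        = VComp C x y f g f s' (VComp C x y f h g t' (VComp C x y f g h t s))"
        by (rule VComp_assoc) (intro a s t VComp_in)+
      also have "VComp C x y f h g t' (VComp C x y f g h t s)
        = VComp C x y f g g (VComp C x y g h g t' t) s"
        by (rule VComp_assoc[symmetric]) (intro a s t VComp_in)+
      finally show ?thesis
        by (simp add: a s t VComp_Id2_left)
    qed
    have "VComp C x y f g h t s \<in> Cell C x y f h" "VComp C x y h g f s' t' \<in> Cell C x y h f"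
      using a s t VComp_in by (simp_all add: inv_cells_def)
    moreover have "VComp C x y f h f (VComp C x y h g f s' t') (VComp C x y f g h t s) = Id2 C x y f"
      "VComp C x y h f h (VComp C x y f g h t s) (VComp C x y h g f s' t') = Id2 C x y h"
      using inv[of f g h s s' t t'] inv[of h g f t' t s' s] a s t by (simp_all add: inv_cells_def)
    ultimately show "VComp C x y f g h t s \<in> Cell (inv_cells C) x y f h"
      by (auto simp: inv_cells_def iso2_def)
  next
    fix x y z f g h k s t
    assume a: "x \<in> Ob (inv_cells C)" "y \<in> Ob (inv_cells C)" "z \<in> Ob (inv_cells C)"
      "f \<in> Hom (inv_cells C) x y" "g \<in> Hom (inv_cells C) x y"
      "h \<in> Hom (inv_cells C) y z" "k \<in> Hom (inv_cells C) y z"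
      and "s \<in> Cell (inv_cells C) x y f g" "t \<in> Cell (inv_cells C) y z h k"
    then obtain s' t' where s: "s \<in> Cell C x y f g" "s' \<in> Cell C x y g f"
      "VComp C x y f g f s' s = Id2 C x y f" "VComp C x y g f g s s' = Id2 C x y g"
      and t: "t \<in> Cell C y z h k" "t' \<in> Cell C y z k h"
      "VComp C y z h k h t' t = Id2 C y z h" "VComp C y z k h k t t' = Id2 C y z k"
      by (auto simp: inv_cells_def iso2_def)
    let ?hf = "Comp1 C x y z h f" and ?kg = "Comp1 C x y z k g"
    let ?ts = "HComp C x y z f g h k t s" and ?ts' = "HComp C x y z g f k h t' s'"
    have "?ts \<in> Cell C x z ?hf ?kg" "?ts' \<in> Cell C x z ?kg ?hf"
      using a s t HComp_in by (simp_all add: inv_cells_def)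
    moreover have "VComp C x z ?hf ?kg ?hf ?ts' ?ts = Id2 C x z ?hf"
      using a s t interchange[of x y z f g f h k h s s' t t'] by (simp add: inv_cells_def HComp_Id2)
    moreover have "VComp C x z ?kg ?hf ?kg ?ts ?ts' = Id2 C x z ?kg"
      using a s t interchange[of x y z g f g k h k s' s t' t] by (simp add: inv_cells_def HComp_Id2)
    ultimately show "?ts \<in> Cell (inv_cells C) x z ?hf ?kg"
      by (auto simp: inv_cells_def iso2_def)
  qed (auto simp: inv_cells_def iso2_def Id1_in Comp1_in)
qed

lemma bij_betw_restrict:
  assumes f: "bij_betw f A B" and "B' \<subseteq> B" and iff: "\<And>a. a \<in> A' \<longleftrightarrow> a \<in> A \<and> f a \<in> B'"
  shows "bij_betw f A' B'"
  unfolding bij_betw_def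
proof
  show "inj_on f A'"
    using f iff by (auto simp: bij_betw_def intro: inj_on_subset)
  have "B' \<subseteq> f ` A"
    using f \<open>B' \<subseteq> B\<close> by (simp add: bij_betw_def)
  then show "f ` A' = B'"
    by (auto simp: iff)
qed

text \<open>
  The preimage of a sub-2-category is closed under the operations because \<open>F\<close> preserves them.
  This gives in one stroke the 2-category laws of the pseudo monoids, the restricted 2-functor and
  its local bijectivity.
\<close>
lemma (in locally_bijective_two_functor) locally_bijective_preimage:
  fixes C' :: "('o, 'f, 't) two_cat"
  assumes "sub_two_category D D'"
    and same: "Id1 C' = Id1 C" "Comp1 C' = Comp1 C" "Id2 C' = Id2 C" "VComp C' = VComp C"
      "HComp C' = HComp C"
    and Ob_iff: "\<And>x. x \<in> Ob C' \<longleftrightarrow> x \<in> Ob C \<and> F0 F x \<in> Ob D'"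
    and Hom_iff: "\<And>x y f. \<lbrakk>x \<in> Ob C'; y \<in> Ob C'\<rbrakk>
      \<Longrightarrow> f \<in> Hom C' x y \<longleftrightarrow> f \<in> Hom C x y \<and> F1 F x y f \<in> Hom D' (F0 F x) (F0 F y)"
    and Cell_iff: "\<And>x y f g s. \<lbrakk>x \<in> Ob C'; y \<in> Ob C'; f \<in> Hom C' x y; g \<in> Hom C' x y\<rbrakk>
      \<Longrightarrow> s \<in> Cell C' x y f g \<longleftrightarrow> s \<in> Cell C x y f g
        \<and> F2 F x y f g s \<in> Cell D' (F0 F x) (F0 F y) (F1 F x y f) (F1 F x y g)"
  shows "locally_bijective_two_functor C' D' F"
proof -
  interpret D': sub_two_category D D' by fact
  interpret D'': two_category D' by (rule D'.two_category_sub)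
  have Ob: "x \<in> Ob C" "F0 F x \<in> Ob D'" if "x \<in> Ob C'" for x
    using that Ob_iff by auto
  have Hom: "f \<in> Hom C x y" "F1 F x y f \<in> Hom D' (F0 F x) (F0 F y)"
    if "x \<in> Ob C'" "y \<in> Ob C'" "f \<in> Hom C' x y" for x y f
    using that Hom_iff by auto
  have Cell: "s \<in> Cell C x y f g"
    "F2 F x y f g s \<in> Cell D' (F0 F x) (F0 F y) (F1 F x y f) (F1 F x y g)"
    if "x \<in> Ob C'" "y \<in> Ob C'" "f \<in> Hom C' x y" "g \<in> Hom C' x y" "s \<in> Cell C' x y f g" for x y f g s
    using that Cell_iff by auto
  have Id1_in: "Id1 C x \<in> Hom C' x x" if "x \<in> Ob C'" for x
  proof (rule Hom_iff[THEN iffD2, OF _ _ conjI])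
    show "Id1 C x \<in> Hom C x x"
      by (intro C.Id1_in Ob that)
    have "F1 F x x (Id1 C x) = Id1 D (F0 F x)"
      by (intro F1_Id1 Ob that)
    also have "\<dots> \<in> Hom D' (F0 F x) (F0 F x)"
      by (intro D'.Id1_sub Ob that)
    finally show "F1 F x x (Id1 C x) \<in> Hom D' (F0 F x) (F0 F x)" .
  qed (fact that)+
  have Comp1_in: "Comp1 C x y z g f \<in> Hom C' x z"
    if "x \<in> Ob C'" "y \<in> Ob C'" "z \<in> Ob C'" "f \<in> Hom C' x y" "g \<in> Hom C' y z" for x y z f g
  proof (rule Hom_iff[THEN iffD2, OF _ _ conjI])
    show "Comp1 C x y z g f \<in> Hom C x z"
      by (intro C.Comp1_in Ob Hom that)
    have "F1 F x z (Comp1 C x y z g f)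
        = Comp1 D (F0 F x) (F0 F y) (F0 F z) (F1 F y z g) (F1 F x y f)"
      by (intro F1_Comp1 Ob Hom that)
    also have "\<dots> \<in> Hom D' (F0 F x) (F0 F z)"
      by (intro D'.Comp1_sub Ob Hom that)
    finally show "F1 F x z (Comp1 C x y z g f) \<in> Hom D' (F0 F x) (F0 F z)" .
  qed (fact that)+
  interpret C': sub_two_category C C'
  proof
    show "VComp C x y f g h t s \<in> Cell C' x y f h"
      if "x \<in> Ob C'" "y \<in> Ob C'" "f \<in> Hom C' x y" "g \<in> Hom C' x y" "h \<in> Hom C' x y"
        "s \<in> Cell C' x y f g" "t \<in> Cell C' x y g h" for x y f g h s t
    proof (rule Cell_iff[THEN iffD2, OF _ _ _ _ conjI])
      show "VComp C x y f g h t s \<in> Cell C x y f h"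
        by (intro C.VComp_in Ob Hom Cell that)
      have "F2 F x y f h (VComp C x y f g h t s) = VComp D (F0 F x) (F0 F y)
          (F1 F x y f) (F1 F x y g) (F1 F x y h) (F2 F x y g h t) (F2 F x y f g s)"
        by (intro F2_VComp Ob Hom Cell that)
      also have "\<dots> \<in> Cell D' (F0 F x) (F0 F y) (F1 F x y f) (F1 F x y h)"
        by (intro D'.VComp_sub Ob Hom Cell that)
      finally show "F2 F x y f h (VComp C x y f g h t s)
        \<in> Cell D' (F0 F x) (F0 F y) (F1 F x y f) (F1 F x y h)" .
    qed (fact that)+
    show "HComp C x y z f g h k t s \<in> Cell C' x z (Comp1 C x y z h f) (Comp1 C x y z k g)"
      if "x \<in> Ob C'" "y \<in> Ob C'" "z \<in> Ob C'" "f \<in> Hom C' x y" "g \<in> Hom C' x y"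
        "h \<in> Hom C' y z" "k \<in> Hom C' y z" "s \<in> Cell C' x y f g" "t \<in> Cell C' y z h k"
      for x y z f g h k s t
    proof (rule Cell_iff[THEN iffD2, OF _ _ _ _ conjI])
      show "HComp C x y z f g h k t s \<in> Cell C x z (Comp1 C x y z h f) (Comp1 C x y z k g)"
        by (intro C.HComp_in Ob Hom Cell that)
      have "F2 F x z (Comp1 C x y z h f) (Comp1 C x y z k g) (HComp C x y z f g h k t s)
          = HComp D (F0 F x) (F0 F y) (F0 F z) (F1 F x y f) (F1 F x y g) (F1 F y z h) (F1 F y z k)
              (F2 F y z h k t) (F2 F x y f g s)"
        by (intro F2_HComp Ob Hom Cell that)
      also have "\<dots> \<in> Cell D' (F0 F x) (F0 F z)
          (Comp1 D (F0 F x) (F0 F y) (F0 F z) (F1 F y z h) (F1 F x y f))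
          (Comp1 D (F0 F x) (F0 F y) (F0 F z) (F1 F y z k) (F1 F x y g))"
        by (intro D'.HComp_sub Ob Hom Cell that)
      also have "Comp1 D (F0 F x) (F0 F y) (F0 F z) (F1 F y z h) (F1 F x y f)
          = F1 F x z (Comp1 C x y z h f)"
        by (intro F1_Comp1[symmetric] Ob Hom that)
      also have "Comp1 D (F0 F x) (F0 F y) (F0 F z) (F1 F y z k) (F1 F x y g)
          = F1 F x z (Comp1 C x y z k g)"
        by (intro F1_Comp1[symmetric] Ob Hom that)
      finally show "F2 F x z (Comp1 C x y z h f) (Comp1 C x y z k g) (HComp C x y z f g h k t s)
          \<in> Cell D' (F0 F x) (F0 F z) (F1 F x z (Comp1 C x y z h f)) (F1 F x z (Comp1 C x y z k g))" .
    qed (intro Comp1_in that)+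
    show "Id2 C x y f \<in> Cell C' x y f f" if "x \<in> Ob C'" "y \<in> Ob C'" "f \<in> Hom C' x y" for x y f
    proof (rule Cell_iff[THEN iffD2, OF _ _ _ _ conjI])
      show "Id2 C x y f \<in> Cell C x y f f"
        by (intro C.Id2_in Ob Hom that)
      have "F2 F x y f f (Id2 C x y f) = Id2 D (F0 F x) (F0 F y) (F1 F x y f)"
        by (intro F2_Id2 Ob Hom that)
      also have "\<dots> \<in> Cell D' (F0 F x) (F0 F y) (F1 F x y f) (F1 F x y f)"
        by (intro D'.Id2_sub Ob Hom that)
      finally show "F2 F x y f f (Id2 C x y f)
        \<in> Cell D' (F0 F x) (F0 F y) (F1 F x y f) (F1 F x y f)" .
    qed (fact that)+
  qed (fact same | fact Ob(1) | fact Hom(1) | fact Cell(1) | fact Id1_in | fact Comp1_in)+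
  interpret C'': two_category C' by (rule C'.two_category_sub)
  show ?thesis
  proof
    show "bij_betw (F1 F x y) (Hom C' x y) (Hom D' (F0 F x) (F0 F y))"
      if "x \<in> Ob C'" "y \<in> Ob C'" for x y
      by (rule bij_betw_restrict[OF F1_bij]) (use that in \<open>auto simp: Ob Hom_iff D'.Hom_sub\<close>)
    show "bij_betw (F2 F x y f g) (Cell C' x y f g)
        (Cell D' (F0 F x) (F0 F y) (F1 F x y f) (F1 F x y g))"
      if "x \<in> Ob C'" "y \<in> Ob C'" "f \<in> Hom C' x y" "g \<in> Hom C' x y" for x y f g
      by (rule bij_betw_restrict[OF F2_bij]) (use that in \<open>auto simp: Ob Hom Cell_iff D'.Cell_sub\<close>)
  qed (simp_all only: same D'.same, (fact Ob(2) Hom(2) Cell(2) | intro F1_Id1 F1_Comp1 F2_Id2 F2_VComp F2_HComp Ob Hom Cell; assumption)+)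
qed

text \<open>
  A structure \<open>C\<close> that is mapped injectively and compatibly with all operations into a
  2-category is itself a 2-category.  2-cells are assumed to be detected by \<open>F\<close>, so that their
  closure properties come from \<open>D\<close>; 1-cells are not, since a function or pair of functions may
  fail to be a 1-cell although its image is one.
\<close>
lemma two_functor_reflect:
  assumes "two_category D"
    and F0_in: "\<And>x. x \<in> Ob C \<Longrightarrow> F0 F x \<in> Ob D"
    and F1_in: "\<And>x y f. \<lbrakk>x \<in> Ob C; y \<in> Ob C; f \<in> Hom C x y\<rbrakk> \<Longrightarrow> F1 F x y f \<in> Hom D (F0 F x) (F0 F y)"
    and F1_inj: "\<And>x y. \<lbrakk>x \<in> Ob C; y \<in> Ob C\<rbrakk> \<Longrightarrow> inj_on (F1 F x y) (Hom C x y)"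
    and F2_iff: "\<And>x y f g s. \<lbrakk>x \<in> Ob C; y \<in> Ob C; f \<in> Hom C x y; g \<in> Hom C x y\<rbrakk>
      \<Longrightarrow> F2 F x y f g s \<in> Cell D (F0 F x) (F0 F y) (F1 F x y f) (F1 F x y g) \<longleftrightarrow> s \<in> Cell C x y f g"
    and F2_inj: "\<And>x y f g. \<lbrakk>x \<in> Ob C; y \<in> Ob C; f \<in> Hom C x y; g \<in> Hom C x y\<rbrakk>
      \<Longrightarrow> inj_on (F2 F x y f g) (Cell C x y f g)"
    and Id1_in: "\<And>x. x \<in> Ob C \<Longrightarrow> Id1 C x \<in> Hom C x x"
    and Comp1_in: "\<And>x y z f g. \<lbrakk>x \<in> Ob C; y \<in> Ob C; z \<in> Ob C; f \<in> Hom C x y; g \<in> Hom C y z\<rbrakk>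
      \<Longrightarrow> Comp1 C x y z g f \<in> Hom C x z"
    and F1_Id1: "\<And>x. x \<in> Ob C \<Longrightarrow> F1 F x x (Id1 C x) = Id1 D (F0 F x)"
    and F1_Comp1: "\<And>x y z f g. \<lbrakk>x \<in> Ob C; y \<in> Ob C; z \<in> Ob C; f \<in> Hom C x y; g \<in> Hom C y z\<rbrakk>
      \<Longrightarrow> F1 F x z (Comp1 C x y z g f)
          = Comp1 D (F0 F x) (F0 F y) (F0 F z) (F1 F y z g) (F1 F x y f)"
    and F2_Id2: "\<And>x y f. \<lbrakk>x \<in> Ob C; y \<in> Ob C; f \<in> Hom C x y\<rbrakk>
      \<Longrightarrow> F2 F x y f f (Id2 C x y f) = Id2 D (F0 F x) (F0 F y) (F1 F x y f)"
    and F2_VComp: "\<And>x y f g h s t. \<lbrakk>x \<in> Ob C; y \<in> Ob C; f \<in> Hom C x y; g \<in> Hom C x y; h \<in> Hom C x y;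
        s \<in> Cell C x y f g; t \<in> Cell C x y g h\<rbrakk>
      \<Longrightarrow> F2 F x y f h (VComp C x y f g h t s)
          = VComp D (F0 F x) (F0 F y) (F1 F x y f) (F1 F x y g) (F1 F x y h)
              (F2 F x y g h t) (F2 F x y f g s)"
    and F2_HComp: "\<And>x y z f g h k s t. \<lbrakk>x \<in> Ob C; y \<in> Ob C; z \<in> Ob C;
        f \<in> Hom C x y; g \<in> Hom C x y; h \<in> Hom C y z; k \<in> Hom C y z;
        s \<in> Cell C x y f g; t \<in> Cell C y z h k\<rbrakk>
      \<Longrightarrow> F2 F x z (Comp1 C x y z h f) (Comp1 C x y z k g) (HComp C x y z f g h k t s)
          = HComp D (F0 F x) (F0 F y) (F0 F z)
              (F1 F x y f) (F1 F x y g) (F1 F y z h) (F1 F y z k)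
              (F2 F y z h k t) (F2 F x y f g s)"
  shows "two_functor C D F"
proof -
  interpret D: two_category D by fact
  note F2_in = F2_iff[THEN iffD2]
  note pres = F1_Id1 F1_Comp1 F2_Id2 F2_VComp F2_HComp
  note F_in = F0_in F1_in F2_in
  have Id2_in: "Id2 C x y f \<in> Cell C x y f f" if "x \<in> Ob C" "y \<in> Ob C" "f \<in> Hom C x y" for x y f
    using F2_iff[of x y f f "Id2 C x y f"] that by (simp add: pres F_in D.Id2_in)
  have VComp_in: "VComp C x y f g h t s \<in> Cell C x y f h"
    if "x \<in> Ob C" "y \<in> Ob C" "f \<in> Hom C x y" "g \<in> Hom C x y" "h \<in> Hom C x y"
        "s \<in> Cell C x y f g" "t \<in> Cell C x y g h" for x y f g h s t
    using F2_iff[of x y f h "VComp C x y f g h t s"] that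
      D.VComp_in[of "F0 F x" "F0 F y" "F1 F x y f" "F1 F x y g" "F1 F x y h"]
    by (simp add: pres F_in)
  have HComp_in: "HComp C x y z f g h k t s \<in> Cell C x z (Comp1 C x y z h f) (Comp1 C x y z k g)"
    if "x \<in> Ob C" "y \<in> Ob C" "z \<in> Ob C"
        "f \<in> Hom C x y" "g \<in> Hom C x y" "h \<in> Hom C y z" "k \<in> Hom C y z"
        "s \<in> Cell C x y f g" "t \<in> Cell C y z h k" for x y z f g h k s t
    using F2_iff[of x z "Comp1 C x y z h f" "Comp1 C x y z k g" "HComp C x y z f g h k t s"] that
      D.HComp_in[of "F0 F x" "F0 F y" "F0 F z" "F1 F x y f" "F1 F x y g" "F1 F y z h" "F1 F y z k"]
    by (simp add: pres F_in Comp1_in)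
  note C_in = Id1_in Comp1_in Id2_in VComp_in HComp_in
  note F1_eqD = F1_inj[THEN inj_onD] and F2_eqD = F2_inj[THEN inj_onD]
  have Id_left: "Comp1 C x y y (Id1 C y) f = f"
    if "x \<in> Ob C" "y \<in> Ob C" "f \<in> Hom C x y" for x y f
    by (rule F1_eqD[of x y]) (use that in \<open>simp_all add: C_in pres F_in D.Comp1_Id1_left\<close>)
  have Id_right: "Comp1 C x x y f (Id1 C x) = f"
    if "x \<in> Ob C" "y \<in> Ob C" "f \<in> Hom C x y" for x y f
    by (rule F1_eqD[of x y]) (use that in \<open>simp_all add: C_in pres F_in D.Comp1_Id1_right\<close>)
  have assoc: "Comp1 C w x z (Comp1 C x y z h g) f = Comp1 C w y z h (Comp1 C w x y g f)"
    if "w \<in> Ob C" "x \<in> Ob C" "y \<in> Ob C" "z \<in> Ob C"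
        "f \<in> Hom C w x" "g \<in> Hom C x y" "h \<in> Hom C y z" for w x y z f g h
    by (rule F1_eqD[of w z])
      (use that D.Comp1_assoc[of "F0 F w" "F0 F x" "F0 F y" "F0 F z"]
        C_in(2)[of w y z] C_in(2)[of w x y] C_in(2)[of w x z] C_in(2)[of x y z]
       in \<open>simp_all add: F1_Comp1[of w x z] F1_Comp1[of w x y] F1_Comp1[of w y z]
         F1_Comp1[of x y z] F_in\<close>)
  show ?thesis
  proof
    fix w x y z f f' g g' h h' s t u
    assume a: "w \<in> Ob C" "x \<in> Ob C" "y \<in> Ob C" "z \<in> Ob C"
        "f \<in> Hom C w x" "f' \<in> Hom C w x" "g \<in> Hom C x y" "g' \<in> Hom C x y"
        "h \<in> Hom C y z" "h' \<in> Hom C y z"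
        "s \<in> Cell C w x f f'" "t \<in> Cell C x y g g'" "u \<in> Cell C y z h h'"
    let ?hg = "Comp1 C x y z h g" and ?hg' = "Comp1 C x y z h' g'"
    let ?gf = "Comp1 C w x y g f" and ?gf' = "Comp1 C w x y g' f'"
    let ?hgf = "Comp1 C w x z ?hg f" and ?hgf' = "Comp1 C w x z ?hg' f'"
    let ?l = "HComp C w x z f f' ?hg ?hg' (HComp C x y z g g' h h' u t) s"
    let ?r = "HComp C w y z ?gf ?gf' h h' u (HComp C w x y f f' g g' t s)"
    have eq: "?hgf = Comp1 C w y z h ?gf" "?hgf' = Comp1 C w y z h' ?gf'"
      by (intro assoc a)+
    have comps: "?hg \<in> Hom C x z" "?hg' \<in> Hom C x z" "?gf \<in> Hom C w y" "?gf' \<in> Hom C w y"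
      "HComp C x y z g g' h h' u t \<in> Cell C x z ?hg ?hg'"
      "HComp C w x y f f' g g' t s \<in> Cell C w y ?gf ?gf'"
      by (intro C_in a)+
    have l: "F2 F w z ?hgf ?hgf' ?l
      = HComp D (F0 F w) (F0 F x) (F0 F z) (F1 F w x f) (F1 F w x f') (F1 F x z ?hg) (F1 F x z ?hg')
          (F2 F x z ?hg ?hg' (HComp C x y z g g' h h' u t)) (F2 F w x f f' s)"
      by (intro F2_HComp a comps)
    have r: "F2 F w z ?hgf ?hgf' ?r
      = HComp D (F0 F w) (F0 F y) (F0 F z) (F1 F w y ?gf) (F1 F w y ?gf') (F1 F y z h) (F1 F y z h')
          (F2 F y z h h' u) (F2 F w y ?gf ?gf' (HComp C w x y f f' g g' t s))"
      unfolding eq by (intro F2_HComp a comps)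
    show "?l = ?r"
    proof (rule F2_eqD)
      show "?l \<in> Cell C w z ?hgf ?hgf'" "?hgf \<in> Hom C w z" "?hgf' \<in> Hom C w z"
        by (intro C_in a)+
      show "?r \<in> Cell C w z ?hgf ?hgf'"
        unfolding eq by (intro C_in a)
      show "F2 F w z ?hgf ?hgf' ?l = F2 F w z ?hgf ?hgf' ?r"
        unfolding l r using a
        by (simp only: F2_HComp F1_Comp1) (intro D.HComp_assoc F_in a)
    qed (fact a)+
  next
    fix x y z f f' f'' h h' h'' s s' t t'
    assume a: "x \<in> Ob C" "y \<in> Ob C" "z \<in> Ob C"
        "f \<in> Hom C x y" "f' \<in> Hom C x y" "f'' \<in> Hom C x y"
        "h \<in> Hom C y z" "h' \<in> Hom C y z" "h'' \<in> Hom C y z"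
        "s \<in> Cell C x y f f'" "s' \<in> Cell C x y f' f''"
        "t \<in> Cell C y z h h'" "t' \<in> Cell C y z h' h''"
    let ?hf = "Comp1 C x y z h f" and ?hf' = "Comp1 C x y z h' f'" and ?hf'' = "Comp1 C x y z h'' f''"
    let ?s = "VComp C x y f f' f'' s' s" and ?t = "VComp C y z h h' h'' t' t"
    let ?l = "HComp C x y z f f'' h h'' ?t ?s"
    let ?u = "HComp C x y z f f' h h' t s" and ?u' = "HComp C x y z f' f'' h' h'' t' s'"
    let ?r = "VComp C x z ?hf ?hf' ?hf'' ?u' ?u"
    have in_C: "?hf \<in> Hom C x z" "?hf' \<in> Hom C x z" "?hf'' \<in> Hom C x z"
      "?s \<in> Cell C x y f f''" "?t \<in> Cell C y z h h''"
      "?u \<in> Cell C x z ?hf ?hf'" "?u' \<in> Cell C x z ?hf' ?hf''"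
      "?l \<in> Cell C x z ?hf ?hf''" "?r \<in> Cell C x z ?hf ?hf''"
      by (intro C_in a)+
    show "?l = ?r"
    proof (rule F2_eqD)
      have l: "F2 F x z ?hf ?hf'' ?l
        = HComp D (F0 F x) (F0 F y) (F0 F z) (F1 F x y f) (F1 F x y f'') (F1 F y z h) (F1 F y z h'')
            (F2 F y z h h'' ?t) (F2 F x y f f'' ?s)"
        by (intro F2_HComp a in_C)
      have r: "F2 F x z ?hf ?hf'' ?r
        = VComp D (F0 F x) (F0 F z) (F1 F x z ?hf) (F1 F x z ?hf') (F1 F x z ?hf'')
            (F2 F x z ?hf' ?hf'' ?u') (F2 F x z ?hf ?hf' ?u)"
        by (intro F2_VComp a in_C)
      show "F2 F x z ?hf ?hf'' ?l = F2 F x z ?hf ?hf'' ?r"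
        unfolding l r using a
        by (simp only: F2_HComp F2_VComp F1_Comp1) (intro D.interchange F_in a)
    qed (intro a in_C)+
  next
    fix x y f g h k s t u
    assume a: "x \<in> Ob C" "y \<in> Ob C"
        "f \<in> Hom C x y" "g \<in> Hom C x y" "h \<in> Hom C x y" "k \<in> Hom C x y"
        "s \<in> Cell C x y f g" "t \<in> Cell C x y g h" "u \<in> Cell C x y h k"
    have "VComp C x y g h k u t \<in> Cell C x y g k" "VComp C x y f g h t s \<in> Cell C x y f h"
      by (intro C_in a)+
    with a show "VComp C x y f g k (VComp C x y g h k u t) s
          = VComp C x y f h k u (VComp C x y f g h t s)"
      by (intro F2_eqD[of x y f k])
        (simp_all only: F2_VComp, auto intro!: D.VComp_assoc F_in C_in)
  next
    fix x y f g s
    assume a: "x \<in> Ob C" "y \<in> Ob C" "f \<in> Hom C x y" "g \<in> Hom C x y" "s \<in> Cell C x y f g"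
    show "VComp C x y f g g (Id2 C x y g) s = s"
      by (rule F2_eqD[of x y f g])
        (use a D.VComp_Id2_left[of "F0 F x" "F0 F y" "F1 F x y f" "F1 F x y g"]
          in \<open>simp_all add: C_in F2_VComp F2_Id2 F_in\<close>)
    show "VComp C x y f f g s (Id2 C x y f) = s"
      by (rule F2_eqD[of x y f g])
        (use a D.VComp_Id2_right[of "F0 F x" "F0 F y" "F1 F x y f" "F1 F x y g"]
          in \<open>simp_all add: C_in F2_VComp F2_Id2 F_in\<close>)
    have "HComp C x y y f g (Id1 C y) (Id1 C y) (Id2 C y y (Id1 C y)) s \<in> Cell C x y f g"
      using HComp_in[of x y y f g "Id1 C y" "Id1 C y" s "Id2 C y y (Id1 C y)"] a
      by (simp add: Id_left C_in)
    moreover have "F2 F x y f g (HComp C x y y f g (Id1 C y) (Id1 C y) (Id2 C y y (Id1 C y)) s)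
        = F2 F x y f g s"
      using F2_HComp[of x y y f g "Id1 C y" "Id1 C y" s "Id2 C y y (Id1 C y)"] a
        D.HComp_Id_left[of "F0 F x" "F0 F y" "F1 F x y f" "F1 F x y g" "F2 F x y f g s"]
      by (simp add: Id_left C_in F2_Id2 F1_Id1 F_in)
    ultimately show "HComp C x y y f g (Id1 C y) (Id1 C y) (Id2 C y y (Id1 C y)) s = s"
      using F2_eqD[of x y f g] a by blast
    have "HComp C x x y (Id1 C x) (Id1 C x) f g s (Id2 C x x (Id1 C x)) \<in> Cell C x y f g"
      using HComp_in[of x x y "Id1 C x" "Id1 C x" f g "Id2 C x x (Id1 C x)" s] a
      by (simp add: Id_right C_in)
    moreover have "F2 F x y f g (HComp C x x y (Id1 C x) (Id1 C x) f g s (Id2 C x x (Id1 C x)))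
        = F2 F x y f g s"
      using F2_HComp[of x x y "Id1 C x" "Id1 C x" f g "Id2 C x x (Id1 C x)" s] a
        D.HComp_Id_right[of "F0 F x" "F0 F y" "F1 F x y f" "F1 F x y g" "F2 F x y f g s"]
      by (simp add: Id_right C_in F2_Id2 F1_Id1 F_in)
    ultimately show "HComp C x x y (Id1 C x) (Id1 C x) f g s (Id2 C x x (Id1 C x)) = s"
      using F2_eqD[of x y f g] a by blast
  next
    fix x y z f h
    assume a: "x \<in> Ob C" "y \<in> Ob C" "z \<in> Ob C" "f \<in> Hom C x y" "h \<in> Hom C y z"
    show "HComp C x y z f f h h (Id2 C y z h) (Id2 C x y f) = Id2 C x z (Comp1 C x y z h f)"
      by (rule F2_eqD[of x z "Comp1 C x y z h f" "Comp1 C x y z h f"])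
        (use a D.HComp_Id2[of "F0 F x" "F0 F y" "F0 F z" "F1 F x y f" "F1 F y z h"]
          in \<open>simp_all add: C_in F2_HComp F2_Id2 F1_Comp1 F_in\<close>)
  qed (simp_all add: C_in F_in pres Id_left Id_right assoc)
qed

section \<open>The 2-category of prefibrations\<close>

lemma over_hom_iff:
  "f \<in> over_hom E E' \<longleftrightarrow> f \<in> carrier E \<rightarrow>\<^sub>E carrier E' \<and> f \<one>\<^bsub>E\<^esub> = \<one>\<^bsub>E'\<^esub>
    \<and> (\<forall>x \<in> carrier E. \<forall>y \<in> carrier E. f (x \<otimes>\<^bsub>E\<^esub> y) = f x \<otimes>\<^bsub>E'\<^esub> f y)
    \<and> (\<forall>x \<in> carrier E. proj E' (f x) = proj E x)"
  by (auto simp: over_hom_def mon_hom_def hom_def PiE_def)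

lemma over_homD:
  assumes "f \<in> over_hom E E'"
  shows "x \<in> carrier E \<Longrightarrow> f x \<in> carrier E'" "f \<one>\<^bsub>E\<^esub> = \<one>\<^bsub>E'\<^esub>"
    "\<lbrakk>x \<in> carrier E; y \<in> carrier E\<rbrakk> \<Longrightarrow> f (x \<otimes>\<^bsub>E\<^esub> y) = f x \<otimes>\<^bsub>E'\<^esub> f y"
    "x \<in> carrier E \<Longrightarrow> proj E' (f x) = proj E x" "f \<in> extensional (carrier E)"
  using assms by (auto simp: over_hom_iff PiE_def)

lemma over_cellD:
  assumes "c \<in> over_cell M E E' f g"
  shows "c \<in> carrier E'" "proj E' c = \<one>\<^bsub>M\<^esub>" "x \<in> carrier E \<Longrightarrow> c \<otimes>\<^bsub>E'\<^esub> f x = g x \<otimes>\<^bsub>E'\<^esub> c"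
  using assms by (auto simp: over_cell_def)

lemma monoid_overD:
  assumes "monoid_over M E"
  shows "monoid M" "monoid E" "x \<in> carrier E \<Longrightarrow> proj E x \<in> carrier M" "proj E \<one>\<^bsub>E\<^esub> = \<one>\<^bsub>M\<^esub>"
    "\<lbrakk>x \<in> carrier E; y \<in> carrier E\<rbrakk> \<Longrightarrow> proj E (x \<otimes>\<^bsub>E\<^esub> y) = proj E x \<otimes>\<^bsub>M\<^esub> proj E y"
  using assms by (auto simp: monoid_over_def mon_hom_def hom_def)

lemma two_category_PFib: "two_category (PFib M :: ('e, 'm) over_two_cat)"
proof -
  have mon: "monoid_over M E" if "E \<in> Ob (PFib M)" for E :: "('e, 'm) mon_over"
    using that by (simp add: PFib_def prefibration_def)
  have comp_in: "compose (carrier E) g f \<in> over_hom E E''"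
    if "f \<in> over_hom E E'" "g \<in> over_hom E' E''" "monoid_over M E"
    for E E' E'' :: "('e, 'm) mon_over" and f g
    using over_homD[OF that(1)] over_homD[OF that(2)] monoid_overD(2)[OF that(3)]
    by (simp add: over_hom_iff compose_def monoid.m_closed monoid.one_closed)
  have cell_mult: "d \<otimes>\<^bsub>E'\<^esub> c \<in> over_cell M E E' f h"
    if E: "monoid_over M E'"
      and f: "f \<in> over_hom E E'" and g: "g \<in> over_hom E E'" and h: "h \<in> over_hom E E'"
      and c: "c \<in> over_cell M E E' f g" and d: "d \<in> over_cell M E E' g h"
    for E E' :: "('e, 'm) mon_over" and f g h c d
  proof -
    interpret E': monoid E' by (rule monoid_overD[OF E])
    have "d \<otimes>\<^bsub>E'\<^esub> c \<otimes>\<^bsub>E'\<^esub> f x = h x \<otimes>\<^bsub>E'\<^esub> (d \<otimes>\<^bsub>E'\<^esub> c)" if x: "x \<in> carrier E" for x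
    proof -
      note in_E' = over_cellD(1)[OF c] over_cellD(1)[OF d] over_homD(1)[OF f x]
        over_homD(1)[OF g x] over_homD(1)[OF h x]
      have "d \<otimes>\<^bsub>E'\<^esub> c \<otimes>\<^bsub>E'\<^esub> f x = d \<otimes>\<^bsub>E'\<^esub> (g x \<otimes>\<^bsub>E'\<^esub> c)"
        using in_E' by (simp add: E'.m_assoc over_cellD(3)[OF c x])
      also have "\<dots> = h x \<otimes>\<^bsub>E'\<^esub> d \<otimes>\<^bsub>E'\<^esub> c"
        using in_E' by (simp add: E'.m_assoc[symmetric] over_cellD(3)[OF d x])
      finally show ?thesis
        using in_E' by (simp add: E'.m_assoc)
    qed
    moreover have "monoid M" by (rule monoid_overD[OF E])
    ultimately show ?thesis
      using over_cellD(1,2)[OF c] over_cellD(1,2)[OF d] monoid_overD(5)[OF E]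
      by (simp add: over_cell_def monoid.l_one)
  qed
  have whisker_left: "h c \<in> over_cell M E E'' (compose (carrier E) h f) (compose (carrier E) h g)"
    if f: "f \<in> over_hom E E'" and g: "g \<in> over_hom E E'" and h: "h \<in> over_hom E' E''"
      and c: "c \<in> over_cell M E E' f g"
    for E E' E'' :: "('e, 'm) mon_over" and f g h c
    using over_cellD[OF c] over_homD[OF f] over_homD[OF g] over_homD[OF h]
    by (simp add: over_cell_def compose_def flip: over_homD(3)[OF h])
  have whisker_right: "d \<in> over_cell M E E'' (compose (carrier E) h f) (compose (carrier E) k f)"
    if f: "f \<in> over_hom E E'" and d: "d \<in> over_cell M E' E'' h k"
    for E E' E'' :: "('e, 'm) mon_over" and f h k d
    using over_cellD[OF d] over_homD[OF f] by (simp add: over_cell_def compose_def)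
  show ?thesis
  proof
    fix w x y z :: "('e, 'm) mon_over" and f f' f'' g g' g'' h h' s s' t t' u
    show "x \<in> Ob (PFib M) \<Longrightarrow> Id1 (PFib M) x \<in> Hom (PFib M) x x"
      by (auto simp: PFib_def over_hom_iff prefibration_def monoid_overD monoid.m_closed)
    show "\<lbrakk>x \<in> Ob (PFib M); y \<in> Ob (PFib M); f \<in> Hom (PFib M) x y\<rbrakk>
        \<Longrightarrow> Comp1 (PFib M) x y y (Id1 (PFib M) y) f = f"
      by (auto simp: PFib_def fun_eq_iff compose_def over_hom_iff dest: PiE_mem PiE_arb)
    show "\<lbrakk>x \<in> Ob (PFib M); y \<in> Ob (PFib M); f \<in> Hom (PFib M) x y\<rbrakk>
        \<Longrightarrow> Comp1 (PFib M) x x y f (Id1 (PFib M) x) = f"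
      by (auto simp: PFib_def fun_eq_iff compose_def over_hom_iff dest: PiE_mem PiE_arb)
    show "\<lbrakk>w \<in> Ob (PFib M); x \<in> Ob (PFib M); y \<in> Ob (PFib M); z \<in> Ob (PFib M);
        f \<in> Hom (PFib M) w x; g \<in> Hom (PFib M) x y; h \<in> Hom (PFib M) y z\<rbrakk>
      \<Longrightarrow> Comp1 (PFib M) w x z (Comp1 (PFib M) x y z h g) f
        = Comp1 (PFib M) w y z h (Comp1 (PFib M) w x y g f)"
      by (simp add: PFib_def fun_eq_iff compose_def over_homD(1))
    show "\<lbrakk>x \<in> Ob (PFib M); y \<in> Ob (PFib M); f \<in> Hom (PFib M) x y\<rbrakk>
        \<Longrightarrow> Id2 (PFib M) x y f \<in> Cell (PFib M) x y f f"
      using monoid_overD[OF mon, of y]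
      by (simp add: PFib_def over_cell_def over_homD(1) monoid.one_closed monoid.l_one monoid.r_one)
    assume a: "x \<in> Ob (PFib M)" "y \<in> Ob (PFib M)" "z \<in> Ob (PFib M)"
      and hom: "f \<in> Hom (PFib M) x y" "f' \<in> Hom (PFib M) x y" "f'' \<in> Hom (PFib M) x y"
          "h \<in> Hom (PFib M) y z" "g' \<in> Hom (PFib M) y z" "g'' \<in> Hom (PFib M) y z"
      and cell: "s \<in> Cell (PFib M) x y f f'" "s' \<in> Cell (PFib M) x y f' f''"
          "t \<in> Cell (PFib M) y z h g'" "t' \<in> Cell (PFib M) y z g' g''"
    interpret z: monoid z by (rule monoid_overD[OF mon]) fact
    have h: "h \<in> over_hom y z" and g': "g' \<in> over_hom y z"
      and s: "s \<in> over_cell M x y f f'" and s': "s' \<in> over_cell M x y f' f''"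
      and t: "t \<in> over_cell M y z h g'" and t': "t' \<in> over_cell M y z g' g''"
      using hom cell by (simp_all add: PFib_def)
    note in_carrier = over_cellD(1)[OF s] over_cellD(1)[OF s'] over_cellD(1)[OF t]
      over_cellD(1)[OF t'] over_homD(1)[OF h] over_homD(1)[OF g']
    have "t' \<otimes>\<^bsub>z\<^esub> t \<otimes>\<^bsub>z\<^esub> h (s' \<otimes>\<^bsub>y\<^esub> s) = t' \<otimes>\<^bsub>z\<^esub> (t \<otimes>\<^bsub>z\<^esub> h s') \<otimes>\<^bsub>z\<^esub> h s"
      using in_carrier by (simp add: over_homD(3)[OF h] z.m_assoc)
    also have "t \<otimes>\<^bsub>z\<^esub> h s' = g' s' \<otimes>\<^bsub>z\<^esub> t"
      by (rule over_cellD(3)[OF t]) (rule in_carrier)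
    also have "t' \<otimes>\<^bsub>z\<^esub> (g' s' \<otimes>\<^bsub>z\<^esub> t) \<otimes>\<^bsub>z\<^esub> h s = t' \<otimes>\<^bsub>z\<^esub> g' s' \<otimes>\<^bsub>z\<^esub> (t \<otimes>\<^bsub>z\<^esub> h s)"
      using in_carrier by (simp add: z.m_assoc)
    finally show "HComp (PFib M) x y z f f'' h g'' (VComp (PFib M) y z h g' g'' t' t)
          (VComp (PFib M) x y f f' f'' s' s)
        = VComp (PFib M) x z (Comp1 (PFib M) x y z h f) (Comp1 (PFib M) x y z g' f')
            (Comp1 (PFib M) x y z g'' f'')
            (HComp (PFib M) x y z f' f'' g' g'' t' s') (HComp (PFib M) x y z f f' h g' t s)"
      by (simp add: PFib_def)
  next
    fix x y z :: "('e, 'm) mon_over" and f g h k s t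
    assume a: "x \<in> Ob (PFib M)" "y \<in> Ob (PFib M)" "z \<in> Ob (PFib M)"
      and hom: "f \<in> Hom (PFib M) x y" "g \<in> Hom (PFib M) x y"
        "h \<in> Hom (PFib M) y z" "k \<in> Hom (PFib M) y z"
      and cell: "s \<in> Cell (PFib M) x y f g" "t \<in> Cell (PFib M) y z h k"
    have "t \<otimes>\<^bsub>z\<^esub> h s \<in> over_cell M x z (compose (carrier x) h f) (compose (carrier x) k g)"
      by (rule cell_mult[OF mon comp_in comp_in comp_in whisker_left whisker_right])
        (use a hom cell mon in \<open>simp_all add: PFib_def\<close>)
    then show "HComp (PFib M) x y z f g h k t s
        \<in> Cell (PFib M) x z (Comp1 (PFib M) x y z h f) (Comp1 (PFib M) x y z k g)"
      by (simp add: PFib_def)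
  next
    fix w x y z :: "('e, 'm) mon_over" and f f' g g' h h' s t u
    assume a: "x \<in> Ob (PFib M)" "y \<in> Ob (PFib M)" "z \<in> Ob (PFib M)"
      "g \<in> Hom (PFib M) x y" "h \<in> Hom (PFib M) y z"
      "s \<in> Cell (PFib M) w x f f'" "t \<in> Cell (PFib M) x y g g'" "u \<in> Cell (PFib M) y z h h'"
    interpret z: monoid z by (rule monoid_overD[OF mon]) fact
    show "HComp (PFib M) w x z f f' (Comp1 (PFib M) x y z h g) (Comp1 (PFib M) x y z h' g')
            (HComp (PFib M) x y z g g' h h' u t) s
          = HComp (PFib M) w y z (Comp1 (PFib M) w x y g f) (Comp1 (PFib M) w x y g' f') h h'
              u (HComp (PFib M) w x y f f' g g' t s)"
      using a by (simp add: PFib_def compose_def over_cellD(1) over_homD(1,3) z.m_assoc)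
  next
    fix x y z :: "('e, 'm) mon_over" and f h
    assume "z \<in> Ob (PFib M)" "h \<in> Hom (PFib M) y z"
    then show "HComp (PFib M) x y z f f h h (Id2 (PFib M) y z h) (Id2 (PFib M) x y f)
      = Id2 (PFib M) x z (Comp1 (PFib M) x y z h f)"
      using monoid_overD(2)[OF mon[of z]]
      by (simp add: PFib_def over_homD(2) monoid.l_one monoid.one_closed)
  next
    fix x y :: "('e, 'm) mon_over" and f g s
    assume "y \<in> Ob (PFib M)" "g \<in> Hom (PFib M) x y" "f \<in> Hom (PFib M) x y" "s \<in> Cell (PFib M) x y f g"
    then show "HComp (PFib M) x x y (Id1 (PFib M) x) (Id1 (PFib M) x) f g s
        (Id2 (PFib M) x x (Id1 (PFib M) x)) = s"
      using monoid_overD(2)[OF mon[of y]]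
      by (simp add: PFib_def over_homD(2) over_cellD(1) monoid.r_one)
  qed (use monoid_overD(2)[OF mon] in \<open>auto simp: PFib_def cell_mult[OF mon] comp_in[OF _ _ mon]
        over_cellD(1) monoid.m_assoc monoid.l_one monoid.r_one\<close>)
qed

section \<open>The Grothendieck construction of a lax monoid\<close>

lemma groth_obj_simps [simp]:
  "carrier (groth_obj M A) = carrier M \<times> carrier A"
  "\<one>\<^bsub>groth_obj M A\<^esub> = (\<one>\<^bsub>M\<^esub>, \<one>\<^bsub>A\<^esub>)"
  "(m, a) \<otimes>\<^bsub>groth_obj M A\<^esub> (n, b) = (m \<otimes>\<^bsub>M\<^esub> n, coh A m n \<otimes>\<^bsub>A\<^esub> act A n a \<otimes>\<^bsub>A\<^esub> b)"
  "m \<in> carrier M \<Longrightarrow> a \<in> carrier A \<Longrightarrow> proj (groth_obj M A) (m, a) = m"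
  "proj (groth_obj M A) \<in> extensional (carrier M \<times> carrier A)"
  by (simp_all add: groth_obj_def)

abbreviation groth_map where "groth_map M A A' \<equiv> F1 (Groth M) A A'"

lemma groth_map_apply [simp]:
  "m \<in> carrier M \<Longrightarrow> a \<in> carrier A \<Longrightarrow> groth_map M A A' f (m, a) = (m, snd f m \<otimes>\<^bsub>A'\<^esub> fst f a)"
  by (simp add: Groth_def split: prod.splits)

lemma groth_map_extensional: "groth_map M A A' f \<in> extensional (carrier M \<times> carrier A)"
  by (simp add: Groth_def split: prod.splits)

lemma Groth_simps [simp]: "F0 (Groth M) = groth_obj M" "F2 (Groth M) A A' f g c = (\<one>\<^bsub>M\<^esub>, c)"
  by (simp_all add: Groth_def)

context lax_monoid
begin

lemma act_closed [simp]: "m \<in> carrier M \<Longrightarrow> a \<in> carrier A \<Longrightarrow> act A m a \<in> carrier A"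
  using act_in by (blast dest: PiE_mem)

lemma coh_closed [simp]: "m \<in> carrier M \<Longrightarrow> n \<in> carrier M \<Longrightarrow> coh A m n \<in> carrier A"
  using coh_in by (blast dest: PiE_mem)

lemmas [simp] = act_one coh_one_left coh_one_right act_of_one

text \<open>
  Associativity combines the cocycle law, which rebrackets the coherences, with the law relating
  $\phi_k \phi_n$ and $\phi_{nk}$, which moves $\gamma_{n,k}$ to the right of the action.
\<close>
lemma groth_assoc:
  assumes m: "m \<in> carrier M" "n \<in> carrier M" "k \<in> carrier M"
    and a: "a \<in> carrier A" "b \<in> carrier A" "c \<in> carrier A"
  shows "coh A (m \<otimes>\<^bsub>M\<^esub> n) k \<otimes>\<^bsub>A\<^esub> act A k (coh A m n \<otimes>\<^bsub>A\<^esub> act A n a \<otimes>\<^bsub>A\<^esub> b) \<otimes>\<^bsub>A\<^esub> c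
    = coh A m (n \<otimes>\<^bsub>M\<^esub> k) \<otimes>\<^bsub>A\<^esub> act A (n \<otimes>\<^bsub>M\<^esub> k) a \<otimes>\<^bsub>A\<^esub> (coh A n k \<otimes>\<^bsub>A\<^esub> act A k b \<otimes>\<^bsub>A\<^esub> c)"
proof -
  have "coh A (m \<otimes>\<^bsub>M\<^esub> n) k \<otimes>\<^bsub>A\<^esub> act A k (coh A m n \<otimes>\<^bsub>A\<^esub> act A n a \<otimes>\<^bsub>A\<^esub> b) \<otimes>\<^bsub>A\<^esub> c
    = coh A (m \<otimes>\<^bsub>M\<^esub> n) k \<otimes>\<^bsub>A\<^esub> act A k (coh A m n) \<otimes>\<^bsub>A\<^esub> act A k (act A n a) \<otimes>\<^bsub>A\<^esub> (act A k b \<otimes>\<^bsub>A\<^esub> c)"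
    using m a by (simp add: act_mult A.m_assoc)
  also have "\<dots> = coh A m (n \<otimes>\<^bsub>M\<^esub> k) \<otimes>\<^bsub>A\<^esub> (coh A n k \<otimes>\<^bsub>A\<^esub> act A k (act A n a)) \<otimes>\<^bsub>A\<^esub> (act A k b \<otimes>\<^bsub>A\<^esub> c)"
    using m a by (simp add: coh_cocycle A.m_assoc)
  also have "\<dots> = coh A m (n \<otimes>\<^bsub>M\<^esub> k) \<otimes>\<^bsub>A\<^esub> (act A (n \<otimes>\<^bsub>M\<^esub> k) a \<otimes>\<^bsub>A\<^esub> coh A n k) \<otimes>\<^bsub>A\<^esub> (act A k b \<otimes>\<^bsub>A\<^esub> c)"
    using m a by (simp add: coh_act)
  finally show ?thesis
    using m a by (simp add: A.m_assoc)
qed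

lemma monoid_groth_obj: "monoid (groth_obj M A)"
  by (rule monoidI) (auto simp: groth_assoc M.m_assoc)

lemma monoid_over_groth_obj: "monoid_over M (groth_obj M A)"
proof -
  have "proj (groth_obj M A) \<in> mon_hom (groth_obj M A) M"
    by (auto simp: mon_hom_def hom_def)
  then show ?thesis
    by (simp add: monoid_over_def monoid_groth_obj M.monoid_axioms)
qed

lemma kernel_groth_obj: "kernel (groth_obj M A) M (proj (groth_obj M A)) = {\<one>\<^bsub>M\<^esub>} \<times> carrier A"
  by (auto simp: kernel_def)

text \<open>
  Since $(m,a)(1,b) = (m,ab)$, the element $(m,a)$ is precartesian iff left multiplication by
  \<open>a\<close> is bijective, which in a monoid means that \<open>a\<close> is invertible.
\<close>
lemma precartesian_groth_obj_iff:
  assumes m: "m \<in> carrier M" and a: "a \<in> carrier A"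
  shows "precartesian M (groth_obj M A) (m, a) \<longleftrightarrow> a \<in> Units A"
proof -
  have "precartesian M (groth_obj M A) (m, a)
      \<longleftrightarrow> (\<forall>c \<in> carrier A. \<exists>!b. b \<in> carrier A \<and> c = a \<otimes>\<^bsub>A\<^esub> b)" (is "_ \<longleftrightarrow> ?bij")
  proof -
    have "(\<exists>!y. y \<in> {\<one>\<^bsub>M\<^esub>} \<times> carrier A \<and> (m, c) = (m, a) \<otimes>\<^bsub>groth_obj M A\<^esub> y)
        \<longleftrightarrow> (\<exists>!b. b \<in> carrier A \<and> c = a \<otimes>\<^bsub>A\<^esub> b)" for c
      using m a by (auto simp: Ex1_def)
    then show ?thesis
      using m a by (auto simp: precartesian_def kernel_groth_obj)
  qed
  also have "\<dots> \<longleftrightarrow> a \<in> Units A"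
  proof
    assume bij: ?bij
    obtain b where b: "b \<in> carrier A" "\<one>\<^bsub>A\<^esub> = a \<otimes>\<^bsub>A\<^esub> b"
      using bij A.one_closed by blast
    have "a = a \<otimes>\<^bsub>A\<^esub> (b \<otimes>\<^bsub>A\<^esub> a)" "a = a \<otimes>\<^bsub>A\<^esub> \<one>\<^bsub>A\<^esub>"
      using a b by (simp_all add: A.m_assoc[symmetric] flip: b(2))
    moreover have "b \<otimes>\<^bsub>A\<^esub> a \<in> carrier A" "\<one>\<^bsub>A\<^esub> \<in> carrier A"
      using a b by simp_all
    ultimately have "b \<otimes>\<^bsub>A\<^esub> a = \<one>\<^bsub>A\<^esub>"
      using bij a by blast
    then show "a \<in> Units A"
      using a b by (auto simp: Units_def)
  next
    assume u: "a \<in> Units A"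
    show ?bij
    proof
      fix c assume c: "c \<in> carrier A"
      show "\<exists>!b. b \<in> carrier A \<and> c = a \<otimes>\<^bsub>A\<^esub> b"
      proof (rule ex1I)
        show "inv\<^bsub>A\<^esub> a \<otimes>\<^bsub>A\<^esub> c \<in> carrier A \<and> c = a \<otimes>\<^bsub>A\<^esub> (inv\<^bsub>A\<^esub> a \<otimes>\<^bsub>A\<^esub> c)"
          using u a c by (simp add: A.m_assoc[symmetric])
      qed (use u a in \<open>auto simp: A.m_assoc[symmetric]\<close>)
    qed
  qed
  finally show ?thesis .
qed

lemma prefibration_groth_obj: "prefibration M (groth_obj M A)"
  unfolding prefibration_def
proof (intro conjI ballI)
  fix m assume "m \<in> carrier M"
  then show "\<exists>x. precartesian M (groth_obj M A) x \<and> proj (groth_obj M A) x = m"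
    by (intro exI[of _ "(m, \<one>\<^bsub>A\<^esub>)"]) (simp add: precartesian_groth_obj_iff)
qed (rule monoid_over_groth_obj)

end

section \<open>Lax homomorphisms are homomorphisms over \<open>M\<close>\<close>

lemma lax_homD:
  assumes "f \<in> lax_hom M A A'"
  shows "fst f \<in> carrier A \<rightarrow>\<^sub>E carrier A'" "snd f \<in> carrier M \<rightarrow>\<^sub>E carrier A'"
    "fst f \<one>\<^bsub>A\<^esub> = \<one>\<^bsub>A'\<^esub>" "snd f \<one>\<^bsub>M\<^esub> = \<one>\<^bsub>A'\<^esub>"
    "a \<in> carrier A \<Longrightarrow> fst f a \<in> carrier A'" "m \<in> carrier M \<Longrightarrow> snd f m \<in> carrier A'"
    "\<lbrakk>a \<in> carrier A; b \<in> carrier A\<rbrakk> \<Longrightarrow> fst f (a \<otimes>\<^bsub>A\<^esub> b) = fst f a \<otimes>\<^bsub>A'\<^esub> fst f b"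
  using assms by (auto simp: lax_hom_def mon_hom_def hom_def PiE_def)

locale lax_monoid_pair = A: lax_monoid M A + A': lax_monoid M A'
  for M :: "'m monoid" and A :: "('a, 'm) lax_mon" and A' :: "('a, 'm) lax_mon"
begin

text \<open>
  The three laws of a lax homomorphism are the cases $(1,a)(1,b)$, $(1,a)(m,1)$ and $(m,1)(n,1)$ of
  multiplicativity, and these cases imply the general one.  Normalisation of $\alpha$ and $\tau$
  separately has to be assumed: the image of the unit only determines $\tau_1 \alpha(1)$.
\<close>
lemma lax_hom_iff_over_hom:
  assumes \<alpha>: "\<alpha> \<in> carrier A \<rightarrow>\<^sub>E carrier A'" "\<alpha> \<one>\<^bsub>A\<^esub> = \<one>\<^bsub>A'\<^esub>"
    and \<tau>: "\<tau> \<in> carrier M \<rightarrow>\<^sub>E carrier A'" "\<tau> \<one>\<^bsub>M\<^esub> = \<one>\<^bsub>A'\<^esub>"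
  shows "(\<alpha>, \<tau>) \<in> lax_hom M A A'
    \<longleftrightarrow> groth_map M A A' (\<alpha>, \<tau>) \<in> over_hom (groth_obj M A) (groth_obj M A')"
    (is "_ \<longleftrightarrow> ?f \<in> _")
proof
  note [simp] = PiE_mem[OF \<alpha>(1)] PiE_mem[OF \<tau>(1)] \<alpha>(2) \<tau>(2)
  assume l: "(\<alpha>, \<tau>) \<in> lax_hom M A A'"
  have hom: "\<alpha> (a \<otimes>\<^bsub>A\<^esub> b) = \<alpha> a \<otimes>\<^bsub>A'\<^esub> \<alpha> b" if "a \<in> carrier A" "b \<in> carrier A" for a b
    using l that by (auto simp: lax_hom_def mon_hom_def hom_def)
  have nat: "act A' m (\<alpha> a) \<otimes>\<^bsub>A'\<^esub> \<tau> m = \<tau> m \<otimes>\<^bsub>A'\<^esub> \<alpha> (act A m a)"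
    if "m \<in> carrier M" "a \<in> carrier A" for m a
    using l that by (auto simp: lax_hom_def)
  have coh: "\<tau> (m \<otimes>\<^bsub>M\<^esub> n) \<otimes>\<^bsub>A'\<^esub> \<alpha> (coh A m n) = coh A' m n \<otimes>\<^bsub>A'\<^esub> act A' n (\<tau> m) \<otimes>\<^bsub>A'\<^esub> \<tau> n"
    if "m \<in> carrier M" "n \<in> carrier M" for m n
    using l that by (auto simp: lax_hom_def)
  have "\<tau> (m \<otimes>\<^bsub>M\<^esub> n) \<otimes>\<^bsub>A'\<^esub> \<alpha> (coh A m n \<otimes>\<^bsub>A\<^esub> act A n a \<otimes>\<^bsub>A\<^esub> b)
      = coh A' m n \<otimes>\<^bsub>A'\<^esub> act A' n (\<tau> m \<otimes>\<^bsub>A'\<^esub> \<alpha> a) \<otimes>\<^bsub>A'\<^esub> (\<tau> n \<otimes>\<^bsub>A'\<^esub> \<alpha> b)"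
    if m: "m \<in> carrier M" "n \<in> carrier M" "a \<in> carrier A" "b \<in> carrier A" for m n a b
  proof -
    have "\<tau> (m \<otimes>\<^bsub>M\<^esub> n) \<otimes>\<^bsub>A'\<^esub> \<alpha> (coh A m n \<otimes>\<^bsub>A\<^esub> act A n a \<otimes>\<^bsub>A\<^esub> b)
      = (\<tau> (m \<otimes>\<^bsub>M\<^esub> n) \<otimes>\<^bsub>A'\<^esub> \<alpha> (coh A m n)) \<otimes>\<^bsub>A'\<^esub> \<alpha> (act A n a) \<otimes>\<^bsub>A'\<^esub> \<alpha> b"
      using m by (simp add: hom A'.A.m_assoc)
    also have "\<dots> = coh A' m n \<otimes>\<^bsub>A'\<^esub> act A' n (\<tau> m) \<otimes>\<^bsub>A'\<^esub> (\<tau> n \<otimes>\<^bsub>A'\<^esub> \<alpha> (act A n a)) \<otimes>\<^bsub>A'\<^esub> \<alpha> b"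
      using m by (simp add: coh A'.A.m_assoc)
    also have "\<dots> = coh A' m n \<otimes>\<^bsub>A'\<^esub> act A' n (\<tau> m) \<otimes>\<^bsub>A'\<^esub> (act A' n (\<alpha> a) \<otimes>\<^bsub>A'\<^esub> \<tau> n) \<otimes>\<^bsub>A'\<^esub> \<alpha> b"
      using m by (simp add: nat)
    finally show ?thesis
      using m by (simp add: A'.act_mult A'.A.m_assoc)
  qed
  then show "?f \<in> over_hom (groth_obj M A) (groth_obj M A')"
    using groth_map_extensional[of M A A' "(\<alpha>, \<tau>)"] by (auto simp: over_hom_iff PiE_def)
next
  note [simp] = PiE_mem[OF \<alpha>(1)] PiE_mem[OF \<tau>(1)] \<alpha>(2) \<tau>(2)
  assume f: "?f \<in> over_hom (groth_obj M A) (groth_obj M A')"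
  have mult: "\<tau> (m \<otimes>\<^bsub>M\<^esub> n) \<otimes>\<^bsub>A'\<^esub> \<alpha> (coh A m n \<otimes>\<^bsub>A\<^esub> act A n a \<otimes>\<^bsub>A\<^esub> b)
      = coh A' m n \<otimes>\<^bsub>A'\<^esub> act A' n (\<tau> m \<otimes>\<^bsub>A'\<^esub> \<alpha> a) \<otimes>\<^bsub>A'\<^esub> (\<tau> n \<otimes>\<^bsub>A'\<^esub> \<alpha> b)"
    if "m \<in> carrier M" "n \<in> carrier M" "a \<in> carrier A" "b \<in> carrier A" for m n a b
    using over_homD(3)[OF f, of "(m, a)" "(n, b)"] that by simp
  have "\<alpha> (a \<otimes>\<^bsub>A\<^esub> b) = \<alpha> a \<otimes>\<^bsub>A'\<^esub> \<alpha> b" if "a \<in> carrier A" "b \<in> carrier A" for a b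
    using mult[of "\<one>\<^bsub>M\<^esub>" "\<one>\<^bsub>M\<^esub>" a b] that by simp
  moreover have "act A' m (\<alpha> a) \<otimes>\<^bsub>A'\<^esub> \<tau> m = \<tau> m \<otimes>\<^bsub>A'\<^esub> \<alpha> (act A m a)"
    if "m \<in> carrier M" "a \<in> carrier A" for m a
    using mult[of "\<one>\<^bsub>M\<^esub>" m a "\<one>\<^bsub>A\<^esub>"] that by simp
  moreover have "coh A' m n \<otimes>\<^bsub>A'\<^esub> act A' n (\<tau> m) \<otimes>\<^bsub>A'\<^esub> \<tau> n = \<tau> (m \<otimes>\<^bsub>M\<^esub> n) \<otimes>\<^bsub>A'\<^esub> \<alpha> (coh A m n)"
    if "m \<in> carrier M" "n \<in> carrier M" for m n
    using mult[of m n "\<one>\<^bsub>A\<^esub>" "\<one>\<^bsub>A\<^esub>"] that by simp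
  ultimately show "(\<alpha>, \<tau>) \<in> lax_hom M A A'"
    using \<alpha> \<tau> by (simp add: lax_hom_def mon_hom_def hom_def PiE_def)
qed

text \<open>
  The inverse reads $\alpha$ off the elements $(1,a)$ and $\tau$ off the elements $(m,1)$.
\<close>
lemma bij_betw_groth_map:
  "bij_betw (groth_map M A A') (lax_hom M A A') (over_hom (groth_obj M A) (groth_obj M A'))"
  unfolding bij_betw_def
proof (intro conjI inj_onI subset_antisym subsetI)
  fix f g assume f: "f \<in> lax_hom M A A'" and g: "g \<in> lax_hom M A A'"
    and eq: "groth_map M A A' f = groth_map M A A' g"
  have "fst f a = fst g a" if "a \<in> carrier A" for a
    using fun_cong[OF eq, of "(\<one>\<^bsub>M\<^esub>, a)"] that by (simp add: lax_homD[OF f] lax_homD[OF g])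
  moreover have "snd f m = snd g m" if "m \<in> carrier M" for m
    using fun_cong[OF eq, of "(m, \<one>\<^bsub>A\<^esub>)"] that by (simp add: lax_homD[OF f] lax_homD[OF g])
  ultimately show "f = g"
    using lax_homD(1,2)[OF f] lax_homD(1,2)[OF g] by (blast intro: prod_eqI PiE_ext)
next
  fix h assume "h \<in> groth_map M A A' ` lax_hom M A A'"
  then obtain \<alpha> \<tau> where at: "(\<alpha>, \<tau>) \<in> lax_hom M A A'" and h: "h = groth_map M A A' (\<alpha>, \<tau>)"
    by auto
  then show "h \<in> over_hom (groth_obj M A) (groth_obj M A')"
    using lax_hom_iff_over_hom[of \<alpha> \<tau>] lax_homD(1-4)[OF at] by simp
next
  fix h assume h: "h \<in> over_hom (groth_obj M A) (groth_obj M A')"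
  define \<alpha> where "\<alpha> = (\<lambda>a \<in> carrier A. snd (h (\<one>\<^bsub>M\<^esub>, a)))"
  define \<tau> where "\<tau> = (\<lambda>m \<in> carrier M. snd (h (m, \<one>\<^bsub>A\<^esub>)))"
  have h_fst: "fst (h (m, a)) = m" and h_snd: "snd (h (m, a)) \<in> carrier A'"
    if "m \<in> carrier M" "a \<in> carrier A" for m a
    using over_homD(1,4)[OF h, of "(m, a)"] that by (cases "h (m, a)"; simp)+
  have ext: "\<alpha> \<in> carrier A \<rightarrow>\<^sub>E carrier A'" "\<alpha> \<one>\<^bsub>A\<^esub> = \<one>\<^bsub>A'\<^esub>"
    "\<tau> \<in> carrier M \<rightarrow>\<^sub>E carrier A'" "\<tau> \<one>\<^bsub>M\<^esub> = \<one>\<^bsub>A'\<^esub>"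
    using h_snd over_homD(2)[OF h] by (auto simp: \<alpha>_def \<tau>_def)
  have h_apply: "h (m, a) = (m, \<tau> m \<otimes>\<^bsub>A'\<^esub> \<alpha> a)" if "m \<in> carrier M" "a \<in> carrier A" for m a
  proof -
    have "h (m, \<one>\<^bsub>A\<^esub>) = (m, \<tau> m)" "h (\<one>\<^bsub>M\<^esub>, a) = (\<one>\<^bsub>M\<^esub>, \<alpha> a)"
      using h_fst that by (auto intro!: prod_eqI simp: \<alpha>_def \<tau>_def)
    then show ?thesis
      using over_homD(3)[OF h, of "(m, \<one>\<^bsub>A\<^esub>)" "(\<one>\<^bsub>M\<^esub>, a)"] that
        PiE_mem[OF ext(1)] PiE_mem[OF ext(3)] by simp
  qed
  have eq: "h = groth_map M A A' (\<alpha>, \<tau>)"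
  proof (rule extensionalityI[of _ "carrier M \<times> carrier A"])
    show "h x = groth_map M A A' (\<alpha>, \<tau>) x" if "x \<in> carrier M \<times> carrier A" for x
      using that h_apply by auto
  qed (use over_homD(5)[OF h] groth_map_extensional in simp_all)
  moreover have "(\<alpha>, \<tau>) \<in> lax_hom M A A'"
    using h by (simp add: eq lax_hom_iff_over_hom ext)
  ultimately show "h \<in> groth_map M A A' ` lax_hom M A A'"
    by blast
qed

text \<open>
  Commutation of $(1,c)$ with $(1,a)$ and with $(m,1)$ gives the two conditions on \<open>c\<close>; since
  these elements generate, they suffice.
\<close>
lemma over_cell_groth_iff:
  assumes f: "f \<in> lax_hom M A A'" and g: "g \<in> lax_hom M A A'"
  shows "(\<one>\<^bsub>M\<^esub>, c) \<in> over_cell M (groth_obj M A) (groth_obj M A') (groth_map M A A' f) (groth_map M A A' g)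
    \<longleftrightarrow> c \<in> lax_cell M A A' f g" (is "?l \<longleftrightarrow> ?r")
proof -
  note [simp] = lax_homD(3-6)[OF f] lax_homD(3-6)[OF g]
  have l: "?l \<longleftrightarrow> c \<in> carrier A' \<and> (\<forall>m \<in> carrier M. \<forall>a \<in> carrier A.
      act A' m c \<otimes>\<^bsub>A'\<^esub> (snd f m \<otimes>\<^bsub>A'\<^esub> fst f a) = snd g m \<otimes>\<^bsub>A'\<^esub> fst g a \<otimes>\<^bsub>A'\<^esub> c)"
    by (auto simp: over_cell_def)
  have r: "?r \<longleftrightarrow> c \<in> carrier A' \<and> (\<forall>a \<in> carrier A. c \<otimes>\<^bsub>A'\<^esub> fst f a = fst g a \<otimes>\<^bsub>A'\<^esub> c) \<and>
    (\<forall>m \<in> carrier M. act A' m c \<otimes>\<^bsub>A'\<^esub> snd f m = snd g m \<otimes>\<^bsub>A'\<^esub> c)"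
    by (simp add: lax_cell_def split: prod.splits)
  show ?thesis
  proof
    assume ?l
    then have c: "c \<in> carrier A'" and *: "\<And>m a. m \<in> carrier M \<Longrightarrow> a \<in> carrier A
      \<Longrightarrow> act A' m c \<otimes>\<^bsub>A'\<^esub> (snd f m \<otimes>\<^bsub>A'\<^esub> fst f a) = snd g m \<otimes>\<^bsub>A'\<^esub> fst g a \<otimes>\<^bsub>A'\<^esub> c"
      by (auto simp: l)
    show ?r
      unfolding r
    proof (intro conjI ballI)
      show "c \<otimes>\<^bsub>A'\<^esub> fst f a = fst g a \<otimes>\<^bsub>A'\<^esub> c" if "a \<in> carrier A" for a
        using *[of "\<one>\<^bsub>M\<^esub>" a] c that by simp
      show "act A' m c \<otimes>\<^bsub>A'\<^esub> snd f m = snd g m \<otimes>\<^bsub>A'\<^esub> c" if "m \<in> carrier M" for m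
        using *[of m "\<one>\<^bsub>A\<^esub>"] c that by simp
    qed (fact c)
  next
    assume ?r
    then have c: "c \<in> carrier A'"
      and \<alpha>: "\<And>a. a \<in> carrier A \<Longrightarrow> c \<otimes>\<^bsub>A'\<^esub> fst f a = fst g a \<otimes>\<^bsub>A'\<^esub> c"
      and \<tau>: "\<And>m. m \<in> carrier M \<Longrightarrow> act A' m c \<otimes>\<^bsub>A'\<^esub> snd f m = snd g m \<otimes>\<^bsub>A'\<^esub> c"
      by (auto simp: r)
    have "act A' m c \<otimes>\<^bsub>A'\<^esub> (snd f m \<otimes>\<^bsub>A'\<^esub> fst f a) = snd g m \<otimes>\<^bsub>A'\<^esub> fst g a \<otimes>\<^bsub>A'\<^esub> c"
      if m: "m \<in> carrier M" and a: "a \<in> carrier A" for m a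
    proof -
      have "act A' m c \<otimes>\<^bsub>A'\<^esub> (snd f m \<otimes>\<^bsub>A'\<^esub> fst f a) = snd g m \<otimes>\<^bsub>A'\<^esub> (c \<otimes>\<^bsub>A'\<^esub> fst f a)"
        using m a c by (simp add: A'.A.m_assoc[symmetric] \<tau>)
      then show ?thesis
        using m a c by (simp add: A'.A.m_assoc \<alpha>)
    qed
    with c show ?l
      by (simp add: l)
  qed
qed

end

section \<open>The 2-functor from lax monoids to prefibrations\<close>

lemma LaxMon_simps [simp]:
  "Ob (LaxMon M) = {A. lax_monoid M A}" "Hom (LaxMon M) = lax_hom M" "Cell (LaxMon M) = lax_cell M"
  "Id1 (LaxMon M) A = (\<lambda>a \<in> carrier A. a, \<lambda>m \<in> carrier M. \<one>\<^bsub>A\<^esub>)"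
  "Id2 (LaxMon M) A A' f = \<one>\<^bsub>A'\<^esub>"
  "VComp (LaxMon M) A A' f g h d c = d \<otimes>\<^bsub>A'\<^esub> c"
  "HComp (LaxMon M) A A' A'' f g h k d c = d \<otimes>\<^bsub>A''\<^esub> fst h c"
  by (simp_all add: LaxMon_def)

lemma PFib_simps [simp]:
  "Ob (PFib M) = {E. prefibration M E}" "Hom (PFib M) = over_hom" "Cell (PFib M) = over_cell M"
  "Id1 (PFib M) E = (\<lambda>x \<in> carrier E. x)" "Comp1 (PFib M) E E' E'' \<beta> \<alpha> = compose (carrier E) \<beta> \<alpha>"
  "Id2 (PFib M) E E' \<alpha> = \<one>\<^bsub>E'\<^esub>" "VComp (PFib M) E E' \<alpha> \<beta> \<delta> d c = d \<otimes>\<^bsub>E'\<^esub> c"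
  "HComp (PFib M) E E' E'' \<alpha> \<beta> \<alpha>' \<beta>' d c = d \<otimes>\<^bsub>E''\<^esub> \<alpha>' c"
  by (simp_all add: PFib_def)

lemma Comp1_LaxMon:
  "Comp1 (LaxMon M) A A' A'' g f
    = (compose (carrier A) (fst g) (fst f), \<lambda>m \<in> carrier M. snd g m \<otimes>\<^bsub>A''\<^esub> fst g (snd f m))"
  by (simp add: LaxMon_def split: prod.splits)

lemma groth_map_Id1:
  assumes "lax_monoid M A"
  shows "Id1 (LaxMon M) A \<in> lax_hom M A A"
    "groth_map M A A (Id1 (LaxMon M) A) = Id1 (PFib M) (groth_obj M A)"
proof -
  interpret lax_monoid M A by fact
  show "Id1 (LaxMon M) A \<in> lax_hom M A A"
    by (auto simp: lax_hom_def mon_hom_def hom_def)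
  show "groth_map M A A (Id1 (LaxMon M) A) = Id1 (PFib M) (groth_obj M A)"
    by (auto simp: fun_eq_iff Groth_def)
qed

text \<open>
  That the composite of lax homomorphisms is again one needs no computation with the axioms: its
  image is a composite of homomorphisms over \<open>M\<close>.
\<close>
lemma groth_map_Comp1:
  assumes "lax_monoid M A" "lax_monoid M A'" "lax_monoid M A''"
    and f: "f \<in> lax_hom M A A'" and g: "g \<in> lax_hom M A' A''"
  shows "groth_map M A A'' (Comp1 (LaxMon M) A A' A'' g f)
      = compose (carrier (groth_obj M A)) (groth_map M A' A'' g) (groth_map M A A' f)" (is ?eq)
    and "Comp1 (LaxMon M) A A' A'' g f \<in> lax_hom M A A''"
proof -
  interpret A: lax_monoid M A by fact
  interpret A': lax_monoid M A' by fact
  interpret A'': lax_monoid M A'' by fact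
  interpret AA': lax_monoid_pair M A A' ..
  interpret A'A'': lax_monoid_pair M A' A'' ..
  interpret AA'': lax_monoid_pair M A A'' ..
  note [simp] = lax_homD(3-7)[OF f] lax_homD(3-7)[OF g]
  let ?gf = "Comp1 (LaxMon M) A A' A'' g f"
  show ?eq
  proof (rule extensionalityI[of _ "carrier M \<times> carrier A"])
    show "groth_map M A A'' ?gf x = compose (carrier (groth_obj M A)) (groth_map M A' A'' g) (groth_map M A A' f) x"
      if "x \<in> carrier M \<times> carrier A" for x
      using that by (auto simp: compose_def Comp1_LaxMon A''.A.m_assoc)
  qed (simp_all add: groth_map_extensional)
  also have "\<dots> \<in> over_hom (groth_obj M A) (groth_obj M A'')"
    using two_category.Comp1_in[OF two_category_PFib, of "groth_obj M A" M "groth_obj M A'" "groth_obj M A''"]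
     bij_betw_apply[OF AA'.bij_betw_groth_map f] bij_betw_apply[OF A'A''.bij_betw_groth_map g]
     by (simp add: A.prefibration_groth_obj A'.prefibration_groth_obj A''.prefibration_groth_obj)
  finally show "?gf \<in> lax_hom M A A''"
    unfolding Comp1_LaxMon by (subst AA''.lax_hom_iff_over_hom) (auto simp: compose_def)
qed

lemma two_functor_Groth:
  shows "two_functor (LaxMon M :: ('a, 'm) lax_two_cat) (PFib M) (Groth M)"
proof (rule two_functor_reflect[OF two_category_PFib])
  fix A A' A'' :: "('a, 'm) lax_mon" and f g h k c d
  {
    assume "A \<in> Ob (LaxMon M)"
    then interpret A: lax_monoid M A by simp
    show "F0 (Groth M) A \<in> Ob (PFib M)"
      by (simp add: A.prefibration_groth_obj)
    show "Id1 (LaxMon M) A \<in> Hom (LaxMon M) A A"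
      "F1 (Groth M) A A (Id1 (LaxMon M) A) = Id1 (PFib M) (F0 (Groth M) A)"
      using groth_map_Id1[OF A.lax_monoid_axioms] by simp_all
    assume "A' \<in> Ob (LaxMon M)"
    then interpret A': lax_monoid M A' by simp
    interpret lax_monoid_pair M A A' ..
    show "inj_on (F1 (Groth M) A A') (Hom (LaxMon M) A A')"
      using bij_betw_groth_map by (simp add: bij_betw_def)
    show "F1 (Groth M) A A' f \<in> Hom (PFib M) (F0 (Groth M) A) (F0 (Groth M) A')"
      if "f \<in> Hom (LaxMon M) A A'"
      using bij_betw_apply[OF bij_betw_groth_map] that by simp
    show "F2 (Groth M) A A' f f (Id2 (LaxMon M) A A' f)
      = Id2 (PFib M) (F0 (Groth M) A) (F0 (Groth M) A') (F1 (Groth M) A A' f)"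
      by simp
    assume fg: "f \<in> Hom (LaxMon M) A A'" "g \<in> Hom (LaxMon M) A A'"
    show "F2 (Groth M) A A' f g c
        \<in> Cell (PFib M) (F0 (Groth M) A) (F0 (Groth M) A') (F1 (Groth M) A A' f) (F1 (Groth M) A A' g)
      \<longleftrightarrow> c \<in> Cell (LaxMon M) A A' f g"
      using over_cell_groth_iff[of f g c] fg by simp
    show "inj_on (F2 (Groth M) A A' f g) (Cell (LaxMon M) A A' f g)"
      by (simp add: inj_on_def)
    assume "c \<in> Cell (LaxMon M) A A' f g" "d \<in> Cell (LaxMon M) A A' g h"
    then have "c \<in> carrier A'" "d \<in> carrier A'"
      by (auto simp: lax_cell_def split: prod.splits)
    then show "F2 (Groth M) A A' f h (VComp (LaxMon M) A A' f g h d c)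
      = VComp (PFib M) (F0 (Groth M) A) (F0 (Groth M) A')
          (F1 (Groth M) A A' f) (F1 (Groth M) A A' g) (F1 (Groth M) A A' h)
          (F2 (Groth M) A A' g h d) (F2 (Groth M) A A' f g c)"
      by simp
  next
    assume "A \<in> Ob (LaxMon M)" "A' \<in> Ob (LaxMon M)" "A'' \<in> Ob (LaxMon M)"
      and f: "f \<in> Hom (LaxMon M) A A'" and h: "h \<in> Hom (LaxMon M) A' A''"
    then show "Comp1 (LaxMon M) A A' A'' h f \<in> Hom (LaxMon M) A A''"
      "F1 (Groth M) A A'' (Comp1 (LaxMon M) A A' A'' h f)
        = Comp1 (PFib M) (F0 (Groth M) A) (F0 (Groth M) A') (F0 (Groth M) A'')
            (F1 (Groth M) A' A'' h) (F1 (Groth M) A A' f)"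
      using groth_map_Comp1[of M A A' A'' f h] by simp_all
  next
    assume "A' \<in> Ob (LaxMon M)" "A'' \<in> Ob (LaxMon M)" and h: "h \<in> Hom (LaxMon M) A' A''"
      and "c \<in> Cell (LaxMon M) A A' f g" "d \<in> Cell (LaxMon M) A' A'' h k"
    then interpret A': lax_monoid M A' + A'': lax_monoid M A'' by simp_all
    have "c \<in> carrier A'" "d \<in> carrier A''"
      using \<open>c \<in> _\<close> \<open>d \<in> _\<close> by (auto simp: lax_cell_def split: prod.splits)
    then show "F2 (Groth M) A A'' (Comp1 (LaxMon M) A A' A'' h f) (Comp1 (LaxMon M) A A' A'' k g)
        (HComp (LaxMon M) A A' A'' f g h k d c)
      = HComp (PFib M) (F0 (Groth M) A) (F0 (Groth M) A') (F0 (Groth M) A'')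
          (F1 (Groth M) A A' f) (F1 (Groth M) A A' g) (F1 (Groth M) A' A'' h) (F1 (Groth M) A' A'' k)
          (F2 (Groth M) A' A'' h k d) (F2 (Groth M) A A' f g c)"
      using lax_homD[of h M A' A''] h by simp
  }
qed

lemma locally_bijective_Groth:
  shows "locally_bijective_two_functor (LaxMon M :: ('a, 'm) lax_two_cat) (PFib M) (Groth M)"
proof -
  interpret two_functor "LaxMon M :: ('a, 'm) lax_two_cat" "PFib M" "Groth M"
    by (rule two_functor_Groth)
  show ?thesis
  proof
    fix A A' :: "('a, 'm) lax_mon" assume "A \<in> Ob (LaxMon M)" "A' \<in> Ob (LaxMon M)"
    then interpret lax_monoid_pair M A A'
      by (simp add: lax_monoid_pair_def)
    show "bij_betw (F1 (Groth M) A A') (Hom (LaxMon M) A A')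
        (Hom (PFib M) (F0 (Groth M) A) (F0 (Groth M) A'))"
      using bij_betw_groth_map by simp
    fix f g assume fg: "f \<in> Hom (LaxMon M) A A'" "g \<in> Hom (LaxMon M) A A'"
    have "x \<in> (\<lambda>c. (\<one>\<^bsub>M\<^esub>, c)) ` lax_cell M A A' f g"
      if "x \<in> over_cell M (groth_obj M A) (groth_obj M A') (groth_map M A A' f) (groth_map M A A' g)" for x
    proof -
      have "fst x = \<one>\<^bsub>M\<^esub>"
        using over_cellD(1,2)[OF that] by auto
      then have "x = (\<one>\<^bsub>M\<^esub>, snd x)"
        by (simp add: prod_eq_iff)
      then show ?thesis
        using that over_cell_groth_iff[of f g "snd x"] fg by auto
    qed
    then show "bij_betw (F2 (Groth M) A A' f g) (Cell (LaxMon M) A A' f g)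
        (Cell (PFib M) (F0 (Groth M) A) (F0 (Groth M) A') (F1 (Groth M) A A' f) (F1 (Groth M) A A' g))"
      using fg over_cell_groth_iff[of f g] by (auto simp: bij_betw_def inj_on_def)
  qed
qed

section \<open>Cartesian elements and isomorphisms over \<open>M\<close>\<close>

context
  fixes M :: "'m monoid" and E :: "('e, 'm) mon_over" and E' :: "('d, 'm) mon_over" and h
  assumes h: "h \<in> over_hom E E'" and bij: "bij_betw h (carrier E) (carrier E')"
    and E: "monoid_over M E"
begin

lemma over_iso_inverse:
  obtains k where "k \<in> over_hom E' E" "bij_betw k (carrier E') (carrier E)"
    "compose (carrier E) k h = (\<lambda>x \<in> carrier E. x)" "compose (carrier E') h k = (\<lambda>x \<in> carrier E'. x)"
proof -
  interpret E: monoid E by (rule monoid_overD[OF E])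
  define k where "k = (\<lambda>z \<in> carrier E'. the_inv_into (carrier E) h z)"
  have k: "k (h x) = x" if "x \<in> carrier E" for x
    using that bij over_homD(1)[OF h] by (simp add: k_def the_inv_into_f_f bij_betw_def)
  have surj: "carrier E' = h ` carrier E"
    using bij by (simp add: bij_betw_def)
  have "k \<one>\<^bsub>E'\<^esub> = \<one>\<^bsub>E\<^esub>"
    using k[OF E.one_closed] by (simp add: over_homD(2)[OF h])
  moreover have "k (h x \<otimes>\<^bsub>E'\<^esub> h y) = x \<otimes>\<^bsub>E\<^esub> y" if "x \<in> carrier E" "y \<in> carrier E" for x y
    using k[OF E.m_closed[OF that]] that by (simp add: over_homD(3)[OF h])
  moreover have "k \<in> extensional (h ` carrier E)"
    by (simp add: k_def surj)
  ultimately have "k \<in> over_hom E' E"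
    unfolding over_hom_iff PiE_def Pi_def by (auto simp: surj k over_homD(4)[OF h])
  moreover have "bij_betw k (carrier E') (carrier E)"
    by (rule bij_betw_byWitness[where f' = h]) (auto simp: surj k)
  moreover have "compose (carrier E) k h = (\<lambda>x \<in> carrier E. x)"
    "compose (carrier E') h k = (\<lambda>x \<in> carrier E'. x)"
    using surj by (auto simp: compose_def fun_eq_iff k)
  ultimately show thesis
    by (rule that)
qed

lemma precartesian_image:
  assumes x: "precartesian M E x"
  shows "precartesian M E' (h x)"
  unfolding precartesian_def
proof (intro conjI ballI impI)
  interpret E: monoid E by (rule monoid_overD[OF E])
  have xE: "x \<in> carrier E"
    using x by (simp add: precartesian_def)
  then show "h x \<in> carrier E'"
    by (rule over_homD[OF h])
  fix z' assume "z' \<in> carrier E'" and proj: "proj E' z' = proj E' (h x)"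
  then obtain z where z: "z \<in> carrier E" "z' = h z"
    using bij by (auto simp: bij_betw_def)
  have "proj E z = proj E x"
    using proj z xE by (simp add: over_homD(4)[OF h])
  then have "\<exists>!y. y \<in> kernel E M (proj E) \<and> z = x \<otimes>\<^bsub>E\<^esub> y"
    using x z unfolding precartesian_def by blast
  then obtain y where y: "y \<in> kernel E M (proj E)" "z = x \<otimes>\<^bsub>E\<^esub> y"
    and uniq: "\<And>w. w \<in> kernel E M (proj E) \<Longrightarrow> z = x \<otimes>\<^bsub>E\<^esub> w \<Longrightarrow> w = y"
    by (elim ex1E) blast
  show "\<exists>!y'. y' \<in> kernel E' M (proj E') \<and> z' = h x \<otimes>\<^bsub>E'\<^esub> y'"
  proof (rule ex1I)
    show "h y \<in> kernel E' M (proj E') \<and> z' = h x \<otimes>\<^bsub>E'\<^esub> h y"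
      using y z xE over_homD[OF h] by (auto simp: kernel_def)
    fix w' assume w': "w' \<in> kernel E' M (proj E') \<and> z' = h x \<otimes>\<^bsub>E'\<^esub> w'"
    then obtain w where w: "w \<in> carrier E" "w' = h w"
      using bij by (auto simp: bij_betw_def kernel_def)
    have "h z = h (x \<otimes>\<^bsub>E\<^esub> w)"
      using w w' xE z by (simp add: over_homD(3)[OF h])
    then have "z = x \<otimes>\<^bsub>E\<^esub> w"
      using bij z w xE by (auto simp: bij_betw_def inj_on_def)
    moreover have "w \<in> kernel E M (proj E)"
      using w w' by (simp add: kernel_def over_homD(4)[OF h])
    ultimately show "w' = h y"
      using uniq w by blast
  qed
qed

lemma cartesian_image:
  assumes x: "cartesian M E x"
  shows "cartesian M E' (h x)"
  unfolding cartesian_def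
proof (intro conjI ballI impI)
  interpret E: monoid E by (rule monoid_overD[OF E])
  have xE: "x \<in> carrier E"
    using x by (simp add: cartesian_def)
  have surj: "carrier E' = h ` carrier E"
    using bij by (simp add: bij_betw_def)
  show "h x \<in> carrier E'"
    using xE by (rule over_homD[OF h])
  fix z' v assume "z' \<in> carrier E'" and v: "v \<in> carrier M" "proj E' z' = proj E' (h x) \<otimes>\<^bsub>M\<^esub> v"
  then obtain z where z: "z \<in> carrier E" "z' = h z"
    by (auto simp: surj)
  then have "proj E z = proj E x \<otimes>\<^bsub>M\<^esub> v"
    using v xE by (simp add: over_homD(4)[OF h])
  then obtain y where "y \<in> carrier E" "z = x \<otimes>\<^bsub>E\<^esub> y" "proj E y = v"
    using x z v unfolding cartesian_def by blast
  then show "\<exists>y \<in> carrier E'. z' = h x \<otimes>\<^bsub>E'\<^esub> y \<and> proj E' y = v"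
    using xE z by (intro bexI[of _ "h y"]) (auto simp: over_homD[OF h])
next
  interpret E: monoid E by (rule monoid_overD[OF E])
  have xE: "x \<in> carrier E"
    using x by (simp add: cartesian_def)
  fix y1' y2' assume in_E': "y1' \<in> carrier E'" "y2' \<in> carrier E'"
    and eq: "h x \<otimes>\<^bsub>E'\<^esub> y1' = h x \<otimes>\<^bsub>E'\<^esub> y2' \<and> proj E' y1' = proj E' y2'"
  obtain y1 y2 where y: "y1 \<in> carrier E" "y1' = h y1" "y2 \<in> carrier E" "y2' = h y2"
    using in_E' bij_betw_imp_surj_on[OF bij] by (metis imageE)
  have "h (x \<otimes>\<^bsub>E\<^esub> y1) = h (x \<otimes>\<^bsub>E\<^esub> y2)" "proj E y1 = proj E y2"
    using eq y xE by (simp_all add: over_homD(3,4)[OF h])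
  then have "x \<otimes>\<^bsub>E\<^esub> y1 = x \<otimes>\<^bsub>E\<^esub> y2"
    using bij y xE by (auto simp: bij_betw_def inj_on_def)
  then show "y1' = y2'"
    using x y \<open>proj E y1 = proj E y2\<close> unfolding cartesian_def by blast
qed

end

context
  fixes M :: "'m monoid" and E :: "('e, 'm) mon_over"
  assumes E: "monoid_over M E"
begin

interpretation E: monoid E by (rule monoid_overD[OF E])
interpretation M: monoid M by (rule monoid_overD[OF E])

text \<open>Apply the lifting property with \<open>v = \<one>\<close>.\<close>
lemma cartesian_imp_precartesian:
  assumes x: "cartesian M E x"
  shows "precartesian M E x"
  unfolding precartesian_def
proof (intro conjI ballI impI)
  show xE: "x \<in> carrier E"
    using x by (simp add: cartesian_def)
  fix z assume "z \<in> carrier E" "proj E z = proj E x"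
  then have "proj E z = proj E x \<otimes>\<^bsub>M\<^esub> \<one>\<^bsub>M\<^esub>"
    using monoid_overD(3)[OF E xE] by simp
  with x \<open>z \<in> carrier E\<close> obtain y where y: "y \<in> carrier E" "z = x \<otimes>\<^bsub>E\<^esub> y" "proj E y = \<one>\<^bsub>M\<^esub>"
    unfolding cartesian_def by blast
  then show "\<exists>!y. y \<in> kernel E M (proj E) \<and> z = x \<otimes>\<^bsub>E\<^esub> y"
    using x unfolding cartesian_def kernel_def by (intro ex1I[of _ y]) auto
qed

lemma cartesian_mult:
  assumes x: "cartesian M E x" and y: "cartesian M E y"
  shows "cartesian M E (x \<otimes>\<^bsub>E\<^esub> y)"
  unfolding cartesian_def
proof (intro conjI ballI impI)
  have xE: "x \<in> carrier E" and yE: "y \<in> carrier E"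
    using x y by (simp_all add: cartesian_def)
  then show "x \<otimes>\<^bsub>E\<^esub> y \<in> carrier E"
    by simp
  fix z v assume z: "z \<in> carrier E" and v: "v \<in> carrier M" "proj E z = proj E (x \<otimes>\<^bsub>E\<^esub> y) \<otimes>\<^bsub>M\<^esub> v"
  then have "proj E z = proj E x \<otimes>\<^bsub>M\<^esub> (proj E y \<otimes>\<^bsub>M\<^esub> v)" "proj E y \<otimes>\<^bsub>M\<^esub> v \<in> carrier M"
    using xE yE monoid_overD(3,5)[OF E] by (simp_all add: M.m_assoc)
  then obtain w where w: "w \<in> carrier E" "z = x \<otimes>\<^bsub>E\<^esub> w" "proj E w = proj E y \<otimes>\<^bsub>M\<^esub> v"
    using x z unfolding cartesian_def by blast
  then obtain u where "u \<in> carrier E" "w = y \<otimes>\<^bsub>E\<^esub> u" "proj E u = v"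
    using y v unfolding cartesian_def by blast
  then show "\<exists>u \<in> carrier E. z = x \<otimes>\<^bsub>E\<^esub> y \<otimes>\<^bsub>E\<^esub> u \<and> proj E u = v"
    using w xE yE by (auto simp: E.m_assoc)
next
  have xE: "x \<in> carrier E" and yE: "y \<in> carrier E"
    using x y by (simp_all add: cartesian_def)
  fix u v assume uv: "u \<in> carrier E" "v \<in> carrier E"
    and "x \<otimes>\<^bsub>E\<^esub> y \<otimes>\<^bsub>E\<^esub> u = x \<otimes>\<^bsub>E\<^esub> y \<otimes>\<^bsub>E\<^esub> v \<and> proj E u = proj E v"
  then have eq: "x \<otimes>\<^bsub>E\<^esub> (y \<otimes>\<^bsub>E\<^esub> u) = x \<otimes>\<^bsub>E\<^esub> (y \<otimes>\<^bsub>E\<^esub> v)" "proj E u = proj E v"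
    using xE yE by (simp_all add: E.m_assoc)
  then have "proj E (y \<otimes>\<^bsub>E\<^esub> u) = proj E (y \<otimes>\<^bsub>E\<^esub> v)"
    using yE uv by (simp add: monoid_overD(5)[OF E])
  then have "y \<otimes>\<^bsub>E\<^esub> u = y \<otimes>\<^bsub>E\<^esub> v"
    using x eq uv yE E.m_closed unfolding cartesian_def by blast
  then show "u = v"
    using y eq uv unfolding cartesian_def by blast
qed

lemma Units_imp_cartesian:
  assumes x: "x \<in> Units E"
  shows "cartesian M E x"
  unfolding cartesian_def
proof (intro conjI ballI impI)
  show "x \<in> carrier E"
    using x by (rule E.Units_closed)
  fix z v assume z: "z \<in> carrier E" and v: "v \<in> carrier M" "proj E z = proj E x \<otimes>\<^bsub>M\<^esub> v"
  have "proj E (inv\<^bsub>E\<^esub> x) \<otimes>\<^bsub>M\<^esub> proj E x = \<one>\<^bsub>M\<^esub>"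
    using x E.Units_closed[OF x] by (simp add: monoid_overD(4)[OF E] flip: monoid_overD(5)[OF E])
  then have "proj E (inv\<^bsub>E\<^esub> x \<otimes>\<^bsub>E\<^esub> z) = v"
    using x z v E.Units_closed[OF x] by (simp add: monoid_overD(3,5)[OF E] flip: M.m_assoc)
  moreover have "x \<otimes>\<^bsub>E\<^esub> (inv\<^bsub>E\<^esub> x \<otimes>\<^bsub>E\<^esub> z) = z"
    using E.m_assoc[of x "inv\<^bsub>E\<^esub> x" z] x z E.Units_closed[OF x] by simp
  ultimately show "\<exists>y \<in> carrier E. z = x \<otimes>\<^bsub>E\<^esub> y \<and> proj E y = v"
    using E.m_closed[OF E.Units_inv_closed[OF x] z]
    by (intro bexI[of _ "inv\<^bsub>E\<^esub> x \<otimes>\<^bsub>E\<^esub> z"] conjI) (rule sym)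
qed (use x in auto)

end

lemma fibration_imp_prefibration:
  assumes "fibration M E"
  shows "prefibration M E"
  using assms unfolding fibration_def prefibration_def by (meson cartesian_imp_precartesian)

section \<open>Pseudo monoids and fibrations\<close>

context lax_monoid
begin

text \<open>
  An invertible element of the Grothendieck construction is cartesian, hence precartesian, and
  for precartesian elements the invertibility of \<open>a\<close> is known.
\<close>
lemma Units_groth_obj_iff:
  assumes "a \<in> carrier A"
  shows "(\<one>\<^bsub>M\<^esub>, a) \<in> Units (groth_obj M A) \<longleftrightarrow> a \<in> Units A"
proof
  assume "(\<one>\<^bsub>M\<^esub>, a) \<in> Units (groth_obj M A)"
  then have "cartesian M (groth_obj M A) (\<one>\<^bsub>M\<^esub>, a)"
    by (rule Units_imp_cartesian[OF monoid_over_groth_obj])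
  then show "a \<in> Units A"
    using cartesian_imp_precartesian[OF monoid_over_groth_obj]
      precartesian_groth_obj_iff[OF M.one_closed assms] by blast
next
  assume u: "a \<in> Units A"
  then show "(\<one>\<^bsub>M\<^esub>, a) \<in> Units (groth_obj M A)"
    by (auto simp: Units_def intro!: exI[of _ "inv\<^bsub>A\<^esub> a"] bexI[of _ "(\<one>\<^bsub>M\<^esub>, inv\<^bsub>A\<^esub> a)"])
qed

text \<open>
  If the Grothendieck construction is a fibration, then each $(m,1)$ is cartesian, because it differs
  from a cartesian element above \<open>m\<close> by an invertible element.  Hence $(m,1)(n,1) =
  (mn,\gamma_{m,n})$ is cartesian, and $\gamma_{m,n}$ is invertible.  Conversely, if the $\gamma_{m,v}$
  are invertible, then $(m,1)(v,b) = (mv,\gamma_{m,v} b)$ can be solved uniquely for \<open>b\<close>.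
\<close>
lemma fibration_groth_obj_iff: "fibration M (groth_obj M A) \<longleftrightarrow> pseudo_monoid M A"
proof
  assume fib: "fibration M (groth_obj M A)"
  have cart: "cartesian M (groth_obj M A) (m, \<one>\<^bsub>A\<^esub>)" if m: "m \<in> carrier M" for m
  proof -
    obtain x where x: "cartesian M (groth_obj M A) x" "proj (groth_obj M A) x = m"
      using fib m unfolding fibration_def by blast
    then have "x \<in> carrier (groth_obj M A)"
      by (simp add: cartesian_def)
    with x obtain a where a: "a \<in> carrier A" "x = (m, a)"
      by auto
    then have u: "a \<in> Units A"
      using cartesian_imp_precartesian[OF monoid_over_groth_obj x(1)] m
      by (simp add: precartesian_groth_obj_iff)
    then have "cartesian M (groth_obj M A) (x \<otimes>\<^bsub>groth_obj M A\<^esub> (\<one>\<^bsub>M\<^esub>, inv\<^bsub>A\<^esub> a))"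
      by (intro cartesian_mult Units_imp_cartesian monoid_over_groth_obj x)
        (simp add: Units_groth_obj_iff)
    then show ?thesis
      using m u a by simp
  qed
  have "coh A m n \<in> Units A" if "m \<in> carrier M" "n \<in> carrier M" for m n
  proof -
    have "cartesian M (groth_obj M A) ((m, \<one>\<^bsub>A\<^esub>) \<otimes>\<^bsub>groth_obj M A\<^esub> (n, \<one>\<^bsub>A\<^esub>))"
      by (intro cartesian_mult monoid_over_groth_obj cart that)
    then have "precartesian M (groth_obj M A) (m \<otimes>\<^bsub>M\<^esub> n, coh A m n)"
      using cartesian_imp_precartesian[OF monoid_over_groth_obj] that by fastforce
    then show ?thesis
      using that by (simp add: precartesian_groth_obj_iff)
  qed
  then show "pseudo_monoid M A"
    by (simp add: pseudo_monoid_def lax_monoid_axioms)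
next
  assume "pseudo_monoid M A"
  then have u: "coh A m n \<in> Units A" if "m \<in> carrier M" "n \<in> carrier M" for m n
    using that by (simp add: pseudo_monoid_def)
  have "cartesian M (groth_obj M A) (m, \<one>\<^bsub>A\<^esub>)" if m: "m \<in> carrier M" for m
    unfolding cartesian_def
  proof (intro conjI ballI impI)
    fix z v assume z: "z \<in> carrier (groth_obj M A)" and v: "v \<in> carrier M"
      "proj (groth_obj M A) z = proj (groth_obj M A) (m, \<one>\<^bsub>A\<^esub>) \<otimes>\<^bsub>M\<^esub> v"
    obtain a where a: "a \<in> carrier A" "z = (m \<otimes>\<^bsub>M\<^esub> v, a)"
      using z v m by auto
    show "\<exists>y \<in> carrier (groth_obj M A). z = (m, \<one>\<^bsub>A\<^esub>) \<otimes>\<^bsub>groth_obj M A\<^esub> y \<and> proj (groth_obj M A) y = v"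
      using a m v u[of m v]
      by (intro bexI[of _ "(v, inv\<^bsub>A\<^esub> (coh A m v) \<otimes>\<^bsub>A\<^esub> a)"]) (simp_all flip: A.m_assoc)
  next
    fix y1 y2 assume "y1 \<in> carrier (groth_obj M A)" "y2 \<in> carrier (groth_obj M A)"
      "(m, \<one>\<^bsub>A\<^esub>) \<otimes>\<^bsub>groth_obj M A\<^esub> y1 = (m, \<one>\<^bsub>A\<^esub>) \<otimes>\<^bsub>groth_obj M A\<^esub> y2
        \<and> proj (groth_obj M A) y1 = proj (groth_obj M A) y2"
    then show "y1 = y2"
      using m u A.Units_l_cancel by auto
  qed (use m in simp)
  then show "fibration M (groth_obj M A)"
    unfolding fibration_def using monoid_over_groth_obj A.one_closed
    by (metis groth_obj_simps(4))
qed

end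

text \<open>
  The precartesian element $(m,1)$ is mapped to $(m,\tau_m)$, and a general one $(m,a)$ with
  invertible \<open>a\<close> to $(m,\tau_m \alpha(a))$.
\<close>
lemma (in lax_monoid_pair) cart_hom_iff_pseudo_hom:
  assumes f: "f \<in> lax_hom M A A'"
  shows "groth_map M A A' f \<in> cart_hom M (groth_obj M A) (groth_obj M A') \<longleftrightarrow> f \<in> pseudo_hom M A A'"
proof -

  note f_simps [simp] = lax_homD(3-7)[OF f]
  have over: "groth_map M A A' f \<in> over_hom (groth_obj M A) (groth_obj M A')"
    using bij_betw_apply[OF bij_betw_groth_map f] .
  have pseudo: "f \<in> pseudo_hom M A A' \<longleftrightarrow> (\<forall>m \<in> carrier M. snd f m \<in> Units A')"
    using f by (auto simp: pseudo_hom_def)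
  have Units: "fst f a \<in> Units A'" if "a \<in> Units A" for a
  proof -
    have "fst f a \<otimes>\<^bsub>A'\<^esub> fst f (inv\<^bsub>A\<^esub> a) = \<one>\<^bsub>A'\<^esub>" "fst f (inv\<^bsub>A\<^esub> a) \<otimes>\<^bsub>A'\<^esub> fst f a = \<one>\<^bsub>A'\<^esub>"
      using that A.A.Units_closed[OF that] by (simp_all flip: f_simps(5))
    moreover have "fst f a \<in> carrier A'" "fst f (inv\<^bsub>A\<^esub> a) \<in> carrier A'"
      using that by (simp_all add: A.A.Units_closed)
    ultimately show ?thesis
      unfolding Units_def by blast
  qed
  show ?thesis
    unfolding pseudo
  proof (intro iffI ballI)
    fix m assume cart: "groth_map M A A' f \<in> cart_hom M (groth_obj M A) (groth_obj M A')"
      and m: "m \<in> carrier M"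
    have "precartesian M (groth_obj M A) (m, \<one>\<^bsub>A\<^esub>)"
      using m by (simp add: A.precartesian_groth_obj_iff)
    then have "precartesian M (groth_obj M A') (groth_map M A A' f (m, \<one>\<^bsub>A\<^esub>))"
      using cart unfolding cart_hom_def by blast
    then show "snd f m \<in> Units A'"
      using m by (simp add: A'.precartesian_groth_obj_iff)
  next
    assume \<tau>: "\<forall>m \<in> carrier M. snd f m \<in> Units A'"
    have "precartesian M (groth_obj M A') (groth_map M A A' f x)"
      if x: "precartesian M (groth_obj M A) x" for x
    proof -
      obtain m a where ma: "m \<in> carrier M" "a \<in> carrier A" "x = (m, a)"
        using x by (auto simp: precartesian_def)
      then show ?thesis
        using x \<tau> Units[of a]
        by (simp add: A.precartesian_groth_obj_iff A'.precartesian_groth_obj_iff)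
    qed
    then show "groth_map M A A' f \<in> cart_hom M (groth_obj M A) (groth_obj M A')"
      using over by (simp add: cart_hom_def)
  qed
qed

section \<open>The lax monoid of a normalised cleavage\<close>

text \<open>
  The kernel enters through a monoid isomorphism \<open>j\<close> from a monoid \<open>A\<close>, so that the elements of
  \<open>A\<close> may belong to another type than those of \<open>E\<close>.  In the comments, \<open>j\<close> is suppressed.
\<close>
locale cleavage =
  fixes M :: "'m monoid" and E :: "('e, 'm) mon_over" and A :: "'a monoid"
    and j :: "'a \<Rightarrow> 'e" and x :: "'m \<Rightarrow> 'e"
  assumes monoid_over: "monoid_over M E" and monoid_A: "monoid A"
    and bij_j: "bij_betw j (carrier A) (kernel E M (proj E))"
    and j_one [simp]: "j \<one>\<^bsub>A\<^esub> = \<one>\<^bsub>E\<^esub>"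
    and j_mult [simp]: "\<lbrakk>a \<in> carrier A; b \<in> carrier A\<rbrakk> \<Longrightarrow> j (a \<otimes>\<^bsub>A\<^esub> b) = j a \<otimes>\<^bsub>E\<^esub> j b"
    and precartesian_x: "m \<in> carrier M \<Longrightarrow> precartesian M E (x m)"
    and proj_x [simp]: "m \<in> carrier M \<Longrightarrow> proj E (x m) = m"
    and x_one [simp]: "x \<one>\<^bsub>M\<^esub> = \<one>\<^bsub>E\<^esub>"
begin

sublocale M: monoid M by (rule monoid_overD[OF monoid_over])
sublocale E: monoid E by (rule monoid_overD[OF monoid_over])
sublocale A: monoid A by (rule monoid_A)

lemmas proj_simps [simp] = monoid_overD(3-5)[OF monoid_over]

lemma j_in [simp]: "a \<in> carrier A \<Longrightarrow> j a \<in> carrier E" "a \<in> carrier A \<Longrightarrow> proj E (j a) = \<one>\<^bsub>M\<^esub>"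
  using bij_betw_apply[OF bij_j] by (auto simp: kernel_def)

lemma x_in [simp]: "m \<in> carrier M \<Longrightarrow> x m \<in> carrier E"
  using precartesian_x by (simp add: precartesian_def)

lemma ex1_coordinate:
  assumes z: "z \<in> carrier E" "proj E z = m"
  shows "\<exists>!a. a \<in> carrier A \<and> x m \<otimes>\<^bsub>E\<^esub> j a = z"
proof -
  have m: "m \<in> carrier M"
    using z by auto
  obtain y where y: "y \<in> kernel E M (proj E)" "z = x m \<otimes>\<^bsub>E\<^esub> y"
    and uniq: "\<And>w. w \<in> kernel E M (proj E) \<Longrightarrow> z = x m \<otimes>\<^bsub>E\<^esub> w \<Longrightarrow> w = y"
    using precartesian_x[OF m] z proj_x[OF m] unfolding precartesian_def by metis
  obtain a where a: "a \<in> carrier A" "y = j a"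
    using y bij_betw_imp_surj_on[OF bij_j] by blast
  show ?thesis
  proof (rule ex1I[of _ a])
    fix b assume b: "b \<in> carrier A \<and> x m \<otimes>\<^bsub>E\<^esub> j b = z"
    then have "j b = j a"
      using uniq[of "j b"] bij_betw_apply[OF bij_j] a by blast
    then show "b = a"
      using a b bij_betw_imp_inj_on[OF bij_j] by (simp add: inj_on_def)
  qed (use a y in simp)
qed

definition coordinate :: "'e \<Rightarrow> 'a" where
  "coordinate z = (THE a. a \<in> carrier A \<and> x (proj E z) \<otimes>\<^bsub>E\<^esub> j a = z)"

lemma coordinate:
  assumes "z \<in> carrier E" "proj E z = m"
  shows "coordinate z \<in> carrier A" "x m \<otimes>\<^bsub>E\<^esub> j (coordinate z) = z"
  using theI'[OF ex1_coordinate[OF assms]] assms(2) by (simp_all add: coordinate_def)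

lemma coordinate_cancel:
  assumes "m \<in> carrier M" "a \<in> carrier A" "b \<in> carrier A" "x m \<otimes>\<^bsub>E\<^esub> j a = x m \<otimes>\<^bsub>E\<^esub> j b"
  shows "a = b"
  using ex1_coordinate[of "x m \<otimes>\<^bsub>E\<^esub> j a" m] assms by auto

definition kernel_lax :: "('a, 'm) lax_mon" where
  "kernel_lax = \<lparr>carrier = carrier A, mult = mult A, one = one A,
    act = \<lambda>m \<in> carrier M. \<lambda>a \<in> carrier A. coordinate (j a \<otimes>\<^bsub>E\<^esub> x m),
    coh = \<lambda>m \<in> carrier M. \<lambda>n \<in> carrier M. coordinate (x m \<otimes>\<^bsub>E\<^esub> x n)\<rparr>"

lemma kernel_lax_simps [simp]:
  "carrier kernel_lax = carrier A" "mult kernel_lax = mult A" "one kernel_lax = one A"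
  by (simp_all add: kernel_lax_def)

text \<open>
  The defining equations $x_m \phi_m(a) = a x_m$ and $x_{mn} \gamma_{m,n} = x_m x_n$, and below the
  same equations with a further factor on the right, as rewrite rules for right-nested products.
\<close>
lemma act_kernel_lax:
  assumes "m \<in> carrier M" "a \<in> carrier A"
  shows "act kernel_lax m a \<in> carrier A" "x m \<otimes>\<^bsub>E\<^esub> j (act kernel_lax m a) = j a \<otimes>\<^bsub>E\<^esub> x m"
  using assms coordinate[of "j a \<otimes>\<^bsub>E\<^esub> x m" m] by (simp_all add: kernel_lax_def)

lemma coh_kernel_lax:
  assumes "m \<in> carrier M" "n \<in> carrier M"
  shows "coh kernel_lax m n \<in> carrier A"
    "x (m \<otimes>\<^bsub>M\<^esub> n) \<otimes>\<^bsub>E\<^esub> j (coh kernel_lax m n) = x m \<otimes>\<^bsub>E\<^esub> x n"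
  using assms coordinate[of "x m \<otimes>\<^bsub>E\<^esub> x n" "m \<otimes>\<^bsub>M\<^esub> n"] by (simp_all add: kernel_lax_def)

lemma act_kernel_lax_left:
  assumes "m \<in> carrier M" "a \<in> carrier A" "z \<in> carrier E"
  shows "x m \<otimes>\<^bsub>E\<^esub> (j (act kernel_lax m a) \<otimes>\<^bsub>E\<^esub> z) = j a \<otimes>\<^bsub>E\<^esub> (x m \<otimes>\<^bsub>E\<^esub> z)"
  using act_kernel_lax[OF assms(1,2)] assms by (simp flip: E.m_assoc)

lemma coh_kernel_lax_left:
  assumes "m \<in> carrier M" "n \<in> carrier M" "z \<in> carrier E"
  shows "x (m \<otimes>\<^bsub>M\<^esub> n) \<otimes>\<^bsub>E\<^esub> (j (coh kernel_lax m n) \<otimes>\<^bsub>E\<^esub> z) = x m \<otimes>\<^bsub>E\<^esub> (x n \<otimes>\<^bsub>E\<^esub> z)"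
  using coh_kernel_lax[OF assms(1,2)] assms by (simp flip: E.m_assoc)

text \<open>
  For each axiom, multiply both sides by the appropriate $x_m$ on the left.  The defining
  equations then move all chosen elements to the right of the kernel elements or eliminate the
  coherences, and both sides become the same product in \<open>E\<close>.  For the cocycle law this product is
  $x_m x_n x_k$.
\<close>
lemma lax_monoid_kernel_lax: "lax_monoid M kernel_lax"
proof (intro lax_monoid.intro lax_monoid_axioms.intro)
  note [simp] = act_kernel_lax coh_kernel_lax act_kernel_lax_left coh_kernel_lax_left E.m_assoc
  show "monoid M" by (rule M.monoid_axioms)
  show "monoid kernel_lax"
    by (rule monoidI) (simp_all add: A.m_assoc)
  show "act kernel_lax \<in> carrier M \<rightarrow>\<^sub>E carrier kernel_lax \<rightarrow>\<^sub>E carrier kernel_lax"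
    using act_kernel_lax(1) by (auto simp: PiE_iff extensional_def) (auto simp: kernel_lax_def)
  show "coh kernel_lax \<in> carrier M \<rightarrow>\<^sub>E carrier M \<rightarrow>\<^sub>E carrier kernel_lax"
    using coh_kernel_lax(1) by (auto simp: PiE_iff extensional_def) (auto simp: kernel_lax_def)
  fix m n k a b
  show "a \<in> carrier kernel_lax \<Longrightarrow> act kernel_lax \<one>\<^bsub>M\<^esub> a = a"
    using act_kernel_lax[of "\<one>\<^bsub>M\<^esub>" a] by (intro coordinate_cancel[of "\<one>\<^bsub>M\<^esub>"]) simp_all
  show "\<lbrakk>a \<in> carrier kernel_lax; m \<in> carrier M; n \<in> carrier M\<rbrakk>
      \<Longrightarrow> coh kernel_lax m n \<otimes>\<^bsub>kernel_lax\<^esub> act kernel_lax n (act kernel_lax m a)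
        = act kernel_lax (m \<otimes>\<^bsub>M\<^esub> n) a \<otimes>\<^bsub>kernel_lax\<^esub> coh kernel_lax m n"
    by (intro coordinate_cancel[of "m \<otimes>\<^bsub>M\<^esub> n"]) simp_all
  show "\<lbrakk>m \<in> carrier M; n \<in> carrier M; k \<in> carrier M\<rbrakk>
      \<Longrightarrow> coh kernel_lax (m \<otimes>\<^bsub>M\<^esub> n) k \<otimes>\<^bsub>kernel_lax\<^esub> act kernel_lax k (coh kernel_lax m n)
        = coh kernel_lax m (n \<otimes>\<^bsub>M\<^esub> k) \<otimes>\<^bsub>kernel_lax\<^esub> coh kernel_lax n k"
    using coh_kernel_lax_left[of "m \<otimes>\<^bsub>M\<^esub> n" k "j (act kernel_lax k (coh kernel_lax m n))"]
      coh_kernel_lax_left[of m "n \<otimes>\<^bsub>M\<^esub> k" "j (coh kernel_lax n k)"]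
      coh_kernel_lax_left[of m n "x k"]
    by (intro coordinate_cancel[of "m \<otimes>\<^bsub>M\<^esub> n \<otimes>\<^bsub>M\<^esub> k"]) (simp_all add: M.m_assoc)
  show "m \<in> carrier M \<Longrightarrow> coh kernel_lax \<one>\<^bsub>M\<^esub> m = \<one>\<^bsub>kernel_lax\<^esub>"
    using coh_kernel_lax[of "\<one>\<^bsub>M\<^esub>" m] by (intro coordinate_cancel[of m]) simp_all
  show "m \<in> carrier M \<Longrightarrow> coh kernel_lax m \<one>\<^bsub>M\<^esub> = \<one>\<^bsub>kernel_lax\<^esub>"
    using coh_kernel_lax[of m "\<one>\<^bsub>M\<^esub>"] by (intro coordinate_cancel[of m]) simp_all
  show "m \<in> carrier M \<Longrightarrow> act kernel_lax m \<one>\<^bsub>kernel_lax\<^esub> = \<one>\<^bsub>kernel_lax\<^esub>"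
    by (intro coordinate_cancel[of m]) simp_all
  show "\<lbrakk>a \<in> carrier kernel_lax; b \<in> carrier kernel_lax; m \<in> carrier M\<rbrakk>
      \<Longrightarrow> act kernel_lax m (a \<otimes>\<^bsub>kernel_lax\<^esub> b)
        = act kernel_lax m a \<otimes>\<^bsub>kernel_lax\<^esub> act kernel_lax m b"
    by (intro coordinate_cancel[of m]) simp_all
qed

lemma groth_kernel_lax_iso:
  "(\<lambda>(m, a) \<in> carrier M \<times> carrier A. x m \<otimes>\<^bsub>E\<^esub> j a) \<in> over_hom (groth_obj M kernel_lax) E"
  "bij_betw (\<lambda>(m, a) \<in> carrier M \<times> carrier A. x m \<otimes>\<^bsub>E\<^esub> j a) (carrier M \<times> carrier A) (carrier E)"
proof -
  let ?h = "\<lambda>(m, a) \<in> carrier M \<times> carrier A. x m \<otimes>\<^bsub>E\<^esub> j a"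
  note [simp] = act_kernel_lax coh_kernel_lax act_kernel_lax_left coh_kernel_lax_left E.m_assoc
  show "?h \<in> over_hom (groth_obj M kernel_lax) E"
    by (auto simp: over_hom_iff)
  show "bij_betw ?h (carrier M \<times> carrier A) (carrier E)"
  proof (rule bij_betw_byWitness[where f' = "\<lambda>z. (proj E z, coordinate z)"])
    show "\<forall>p \<in> carrier M \<times> carrier A. (proj E (?h p), coordinate (?h p)) = p"
      using coordinate[of "x _ \<otimes>\<^bsub>E\<^esub> j _"] by (auto intro: coordinate_cancel)
  qed (use coordinate in auto)
qed

end

text \<open>
  A precartesian element above the unit of \<open>M\<close> need not be the unit of \<open>E\<close>, so the chosen family
  is modified there.  The kernel is copied along $\iota$.
\<close>
lemma ex_groth_iso:
  fixes E :: "('e, 'm) mon_over" and \<iota> :: "'e \<Rightarrow> 'a"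
  assumes E: "prefibration M E" and inj: "inj \<iota>"
  obtains A :: "('a, 'm) lax_mon" and h where "lax_monoid M A"
    "h \<in> over_hom (groth_obj M A) E" "bij_betw h (carrier (groth_obj M A)) (carrier E)"
proof -
  have over: "monoid_over M E"
    using E by (simp add: prefibration_def)
  interpret E: monoid E by (rule monoid_overD[OF over])
  interpret M: monoid M by (rule monoid_overD[OF over])
  let ?K = "kernel E M (proj E)"
  define j where "j = the_inv \<iota>"
  have j: "j (\<iota> z) = z" for z
    using inj by (simp add: j_def the_inv_f_f)
  define A :: "'a monoid" where
    "A = \<lparr>carrier = \<iota> ` ?K, mult = \<lambda>a b. \<iota> (j a \<otimes>\<^bsub>E\<^esub> j b), one = \<iota> \<one>\<^bsub>E\<^esub>\<rparr>"
  have K: "\<one>\<^bsub>E\<^esub> \<in> ?K" "\<And>y z. y \<in> ?K \<Longrightarrow> z \<in> ?K \<Longrightarrow> y \<otimes>\<^bsub>E\<^esub> z \<in> ?K" "\<And>y. y \<in> ?K \<Longrightarrow> y \<in> carrier E"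
    using monoid_overD(3-5)[OF over] by (auto simp: kernel_def)
  have "monoid A"
    by (rule monoidI) (auto simp: A_def j K E.m_assoc)
  have one: "precartesian M E \<one>\<^bsub>E\<^esub>"
    by (intro cartesian_imp_precartesian Units_imp_cartesian over E.Units_one_closed)
  have "\<exists>x. \<forall>m \<in> carrier M. precartesian M E (x m) \<and> proj E (x m) = m"
    using E unfolding prefibration_def by metis
  then obtain x0 where x0: "\<And>m. m \<in> carrier M \<Longrightarrow> precartesian M E (x0 m) \<and> proj E (x0 m) = m"
    by blast
  define x where "x m = (if m = \<one>\<^bsub>M\<^esub> then \<one>\<^bsub>E\<^esub> else x0 m)" for m
  interpret cleavage M E A j x
  proof (rule cleavage.intro)
    show "monoid A" by fact
    show "bij_betw j (carrier A) ?K"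
      by (rule bij_betw_byWitness[where f' = \<iota>]) (auto simp: A_def j)
  qed (use x0 one in \<open>auto simp: over A_def j x_def monoid_overD(4)[OF over]\<close>)
  show thesis
    using that[OF lax_monoid_kernel_lax groth_kernel_lax_iso(1)] groth_kernel_lax_iso(2) by simp
qed

section \<open>The restrictions to pseudo monoids\<close>

lemma Fib_simps [simp]:
  "Ob (Fib M) = {E. fibration M E}" "Hom (Fib M) = cart_hom M" "Cell (Fib M) = Cell (PFib M)"
  "Id1 (Fib M) = Id1 (PFib M)" "Comp1 (Fib M) = Comp1 (PFib M)" "Id2 (Fib M) = Id2 (PFib M)"
  "VComp (Fib M) = VComp (PFib M)" "HComp (Fib M) = HComp (PFib M)"
  by (simp_all add: Fib_def)

lemma sub_two_category_Fib: "sub_two_category (PFib M) (Fib M)"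
proof -
  interpret two_category "PFib M" by (rule two_category_PFib)
  show ?thesis
  proof
    show "Id1 (PFib M) E \<in> Hom (Fib M) E E" if "E \<in> Ob (Fib M)" for E
      using that Id1_in[of E] by (simp add: cart_hom_def fibration_imp_prefibration precartesian_def)
    show "Comp1 (PFib M) E E' E'' g f \<in> Hom (Fib M) E E''"
      if "E \<in> Ob (Fib M)" "E' \<in> Ob (Fib M)" "E'' \<in> Ob (Fib M)"
        "f \<in> Hom (Fib M) E E'" "g \<in> Hom (Fib M) E' E''" for E E' E'' f g
      using that Comp1_in[of E E' E'' f g] precartesian_def[of M E]
      by (simp add: cart_hom_def fibration_imp_prefibration compose_def)
  qed (auto simp: cart_hom_def intro: fibration_imp_prefibration
      Id2_in[simplified] VComp_in[simplified] HComp_in[simplified])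
qed

text \<open>
  If $c \alpha(x) = \beta(x) c$ and \<open>c\<close> is invertible, then multiplying by the inverse on both
  sides shows that the inverse is a 2-cell in the opposite direction.
\<close>
lemma iso2_Fib_iff:
  assumes E': "monoid_over M E'" and f: "f \<in> over_hom E E'" and g: "g \<in> over_hom E E'"
  shows "iso2 (Fib M) E E' f g c \<longleftrightarrow> c \<in> over_cell M E E' f g \<and> c \<in> Units E'"
proof -
  interpret E': monoid E' by (rule monoid_overD[OF E'])
  interpret M: monoid M by (rule monoid_overD[OF E'])
  have "inv\<^bsub>E'\<^esub> c \<in> over_cell M E E' g f" if c: "c \<in> over_cell M E E' f g" and u: "c \<in> Units E'"
  proof -
    let ?d = "inv\<^bsub>E'\<^esub> c"
    have cd: "?d \<in> carrier E'" "c \<in> carrier E'" "?d \<otimes>\<^bsub>E'\<^esub> c = \<one>\<^bsub>E'\<^esub>" "c \<otimes>\<^bsub>E'\<^esub> ?d = \<one>\<^bsub>E'\<^esub>"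
      using u by (simp_all add: E'.Units_closed)
    have "proj E' ?d = proj E' (?d \<otimes>\<^bsub>E'\<^esub> c)"
      using cd monoid_overD(3,5)[OF E'] over_cellD(2)[OF c] cd(3) by (metis M.r_one)
    then have "proj E' ?d = \<one>\<^bsub>M\<^esub>"
      by (simp add: cd monoid_overD(4)[OF E'])
    moreover have "?d \<otimes>\<^bsub>E'\<^esub> g x = f x \<otimes>\<^bsub>E'\<^esub> ?d" if x: "x \<in> carrier E" for x
    proof -
      note fg = over_homD(1)[OF f x] over_homD(1)[OF g x]
      have "?d \<otimes>\<^bsub>E'\<^esub> g x = ?d \<otimes>\<^bsub>E'\<^esub> (g x \<otimes>\<^bsub>E'\<^esub> c) \<otimes>\<^bsub>E'\<^esub> ?d"
        using cd fg by (simp add: E'.m_assoc)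
      also have "\<dots> = (?d \<otimes>\<^bsub>E'\<^esub> c) \<otimes>\<^bsub>E'\<^esub> f x \<otimes>\<^bsub>E'\<^esub> ?d"
        using cd(1,2) fg by (simp only: over_cellD(3)[OF c x, symmetric] E'.m_assoc E'.m_closed)
      finally show ?thesis
        using cd fg by simp
    qed
    ultimately show ?thesis
      using cd by (simp add: over_cell_def)
  qed
  then have "\<exists>d \<in> over_cell M E E' g f. d \<otimes>\<^bsub>E'\<^esub> c = \<one>\<^bsub>E'\<^esub> \<and> c \<otimes>\<^bsub>E'\<^esub> d = \<one>\<^bsub>E'\<^esub>"
    if "c \<in> over_cell M E E' f g" "c \<in> Units E'"
    using that E'.Units_l_inv E'.Units_r_inv by blast
  moreover have "c \<in> Units E'"
    if "c \<in> over_cell M E E' f g" "d \<in> over_cell M E E' g f" "d \<otimes>\<^bsub>E'\<^esub> c = \<one>\<^bsub>E'\<^esub>" "c \<otimes>\<^bsub>E'\<^esub> d = \<one>\<^bsub>E'\<^esub>" for d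
    unfolding Units_def using that over_cellD(1)[OF that(1)] over_cellD(1)[OF that(2)] by blast
  ultimately show ?thesis
    unfolding iso2_def Fib_simps PFib_simps by blast
qed

lemma PsMonLax_simps [simp]:
  "Ob (PsMonLax M) = {A. pseudo_monoid M A}" "Hom (PsMonLax M) = pseudo_hom M"
  "Cell (PsMonLax M) = Cell (LaxMon M)"
  "Id1 (PsMonLax M) = Id1 (LaxMon M)" "Comp1 (PsMonLax M) = Comp1 (LaxMon M)"
  "Id2 (PsMonLax M) = Id2 (LaxMon M)"
  "VComp (PsMonLax M) = VComp (LaxMon M)" "HComp (PsMonLax M) = HComp (LaxMon M)"
  by (simp_all add: PsMonLax_def)

lemma PsMon_simps [simp]:
  "Ob (PsMon M) = Ob (PsMonLax M)" "Hom (PsMon M) = Hom (PsMonLax M)"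
  "Cell (PsMon M) A A' f g = lax_cell M A A' f g \<inter> Units A'"
  "Id1 (PsMon M) = Id1 (LaxMon M)" "Comp1 (PsMon M) = Comp1 (LaxMon M)"
  "Id2 (PsMon M) = Id2 (LaxMon M)"
  "VComp (PsMon M) = VComp (LaxMon M)" "HComp (PsMon M) = HComp (LaxMon M)"
  by (simp_all add: PsMon_def)

lemma inv_cells_simps [simp]:
  "Ob (inv_cells C) = Ob C" "Hom (inv_cells C) = Hom C"
  "Cell (inv_cells C) x y f g = {s. iso2 C x y f g s}" "iso1 (inv_cells C) = iso1 C"
  by (simp_all add: inv_cells_def iso1_def fun_eq_iff)

lemma pseudo_hom_subset: "pseudo_hom M A A' \<subseteq> lax_hom M A A'"
  by (auto simp: pseudo_hom_def)

lemma locally_bijective_Groth_Fib: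
  shows "locally_bijective_two_functor (PsMonLax M :: ('a, 'm) lax_two_cat) (Fib M) (Groth M)"
proof -
  interpret locally_bijective_two_functor "LaxMon M :: ('a, 'm) lax_two_cat" "PFib M" "Groth M"
    by (rule locally_bijective_Groth)
  show ?thesis
  proof (rule locally_bijective_preimage[OF sub_two_category_Fib])
    fix A A' :: "('a, 'm) lax_mon" and f g c
    show "A \<in> Ob (PsMonLax M) \<longleftrightarrow> A \<in> Ob (LaxMon M) \<and> F0 (Groth M) A \<in> Ob (Fib M)"
      using lax_monoid.fibration_groth_obj_iff[of M A] by (auto simp: pseudo_monoid_def)
    assume AA': "A \<in> Ob (PsMonLax M)" "A' \<in> Ob (PsMonLax M)"
    then interpret lax_monoid_pair M A A'
      by (simp add: lax_monoid_pair_def pseudo_monoid_def)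
    show "f \<in> Hom (PsMonLax M) A A' \<longleftrightarrow> f \<in> Hom (LaxMon M) A A'
      \<and> F1 (Groth M) A A' f \<in> Hom (Fib M) (F0 (Groth M) A) (F0 (Groth M) A')"
      using cart_hom_iff_pseudo_hom[of f] pseudo_hom_subset[of M A A'] by auto
    assume "f \<in> Hom (PsMonLax M) A A'" "g \<in> Hom (PsMonLax M) A A'"
    then show "c \<in> Cell (PsMonLax M) A A' f g \<longleftrightarrow> c \<in> Cell (LaxMon M) A A' f g
      \<and> F2 (Groth M) A A' f g c
        \<in> Cell (Fib M) (F0 (Groth M) A) (F0 (Groth M) A') (F1 (Groth M) A A' f) (F1 (Groth M) A A' g)"
      using over_cell_groth_iff[of f g c] pseudo_hom_subset[of M A A'] by auto
  qed simp_all
qed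

lemma locally_bijective_Groth_inv_cells_Fib:
  shows "locally_bijective_two_functor (PsMon M :: ('a, 'm) lax_two_cat) (inv_cells (Fib M)) (Groth M)"
proof -
  interpret locally_bijective_two_functor "PsMonLax M :: ('a, 'm) lax_two_cat" "Fib M" "Groth M"
    by (rule locally_bijective_Groth_Fib)
  show ?thesis
  proof (rule locally_bijective_preimage[OF sub_two_category_inv_cells[OF D.two_category_axioms]])
    fix A A' :: "('a, 'm) lax_mon" and f g c
    show "A \<in> Ob (PsMon M) \<longleftrightarrow> A \<in> Ob (PsMonLax M) \<and> F0 (Groth M) A \<in> Ob (inv_cells (Fib M))"
      using F0_in[of A] by auto
    assume AA': "A \<in> Ob (PsMon M)" "A' \<in> Ob (PsMon M)"
    then interpret lax_monoid_pair M A A'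
      by (simp add: lax_monoid_pair_def pseudo_monoid_def)
    show "f \<in> Hom (PsMon M) A A' \<longleftrightarrow> f \<in> Hom (PsMonLax M) A A'
      \<and> F1 (Groth M) A A' f \<in> Hom (inv_cells (Fib M)) (F0 (Groth M) A) (F0 (Groth M) A')"
      using F1_in[of A A' f] AA' by auto
    assume "f \<in> Hom (PsMon M) A A'" "g \<in> Hom (PsMon M) A A'"
    then have f: "f \<in> lax_hom M A A'" and g: "g \<in> lax_hom M A A'"
      using pseudo_hom_subset[of M A A'] by auto
    have "iso2 (Fib M) (groth_obj M A) (groth_obj M A') (groth_map M A A' f) (groth_map M A A' g)
        (\<one>\<^bsub>M\<^esub>, c) \<longleftrightarrow> c \<in> lax_cell M A A' f g \<and> (\<one>\<^bsub>M\<^esub>, c) \<in> Units (groth_obj M A')"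
      using iso2_Fib_iff[OF A'.monoid_over_groth_obj, of "groth_map M A A' f" _ "groth_map M A A' g"]
        bij_betw_apply[OF bij_betw_groth_map] over_cell_groth_iff[OF f g] f g by simp
    moreover have "c \<in> carrier A'" if "c \<in> lax_cell M A A' f g"
      using that by (auto simp: lax_cell_def split: prod.splits)
    ultimately show "c \<in> Cell (PsMon M) A A' f g \<longleftrightarrow> c \<in> Cell (PsMonLax M) A A' f g
      \<and> F2 (Groth M) A A' f g c \<in> Cell (inv_cells (Fib M)) (F0 (Groth M) A) (F0 (Groth M) A')
          (F1 (Groth M) A A' f) (F1 (Groth M) A A' g)"
      using A'.Units_groth_obj_iff by auto
  qed (simp_all add: inv_cells_def)
qed

text \<open>
  An isomorphism over \<open>M\<close> preserves precartesian and cartesian elements in both directions.  So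
  the isomorphism found for a prefibration serves for fibrations, too, and the lax
  monoid obtained from a fibration is automatically pseudo.
\<close>
lemma essentially_surjective_Groth:
  fixes M :: "'m monoid" and E :: "('m \<times> 'a, 'm) mon_over" and \<iota> :: "'m \<times> 'a \<Rightarrow> 'a"
  assumes "inj \<iota>" and "prefibration M E"
  obtains A :: "('a, 'm) lax_mon" and h where "lax_monoid M A" "iso1 (PFib M) (groth_obj M A) E h"
    "fibration M E \<Longrightarrow> fibration M (groth_obj M A) \<and> iso1 (Fib M) (groth_obj M A) E h"
proof -
  obtain A :: "('a, 'm) lax_mon" and h where A: "lax_monoid M A"
    and h: "h \<in> over_hom (groth_obj M A) E" "bij_betw h (carrier (groth_obj M A)) (carrier E)"
    using ex_groth_iso[OF assms(2,1)] .
  interpret lax_monoid M A by fact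
  have E: "monoid_over M E"
    using assms(2) by (simp add: prefibration_def)
  obtain k where k: "k \<in> over_hom E (groth_obj M A)" "bij_betw k (carrier E) (carrier (groth_obj M A))"
    and kh: "compose (carrier (groth_obj M A)) k h = (\<lambda>x \<in> carrier (groth_obj M A). x)"
    and hk: "compose (carrier E) h k = (\<lambda>x \<in> carrier E. x)"
    using over_iso_inverse[OF h monoid_over_groth_obj] .
  have cart: "h \<in> cart_hom M (groth_obj M A) E" "k \<in> cart_hom M E (groth_obj M A)"
    using h k precartesian_image[OF h monoid_over_groth_obj] precartesian_image[OF k E]
    by (simp_all add: cart_hom_def)
  have "iso1 (PFib M) (groth_obj M A) E h"
    unfolding iso1_def using h k kh hk by auto
  moreover have "iso1 (Fib M) (groth_obj M A) E h"
    unfolding iso1_def using cart kh hk by auto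
  moreover have "fibration M (groth_obj M A)" if fib: "fibration M E"
    unfolding fibration_def
  proof (intro conjI ballI)
    fix m assume "m \<in> carrier M"
    then obtain x where x: "cartesian M E x" "proj E x = m"
      using fib unfolding fibration_def by blast
    then have "proj (groth_obj M A) (k x) = m"
      by (simp add: over_homD(4)[OF k(1)] cartesian_def)
    then show "\<exists>x. cartesian M (groth_obj M A) x \<and> proj (groth_obj M A) x = m"
      using cartesian_image[OF k E x(1)] by blast
  qed (rule monoid_over_groth_obj)
  ultimately show thesis
    using that[OF A, of h] by blast
qed

section \<open>The 2-equivalences\<close>

theorem theorem4p6:
  fixes M :: "'m monoid"
  assumes "monoid M"
    and "\<exists>\<iota> :: 'm \<times> 'a \<Rightarrow> 'a. inj \<iota>"
  shows "two_functor (LaxMon M :: ('a, 'm) lax_two_cat) (PFib M) (Groth M)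
    \<and> two_functor (PsMon M :: ('a, 'm) lax_two_cat) (Fib M) (Groth M)
    \<and> two_equivalence (LaxMon M :: ('a, 'm) lax_two_cat) (PFib M) (Groth M)
    \<and> two_equivalence (PsMon M :: ('a, 'm) lax_two_cat) (inv_cells (Fib M)) (Groth M)
    \<and> two_equivalence (PsMonLax M :: ('a, 'm) lax_two_cat) (Fib M) (Groth M)"
proof -
  obtain \<iota> :: "'m \<times> 'a \<Rightarrow> 'a" where inj: "inj \<iota>"
    using assms(2) by blast
  interpret pf: locally_bijective_two_functor "LaxMon M :: ('a, 'm) lax_two_cat" "PFib M" "Groth M"
    by (rule locally_bijective_Groth)
  interpret f: locally_bijective_two_functor "PsMonLax M :: ('a, 'm) lax_two_cat" "Fib M" "Groth M"
    by (rule locally_bijective_Groth_Fib)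
  interpret ps: locally_bijective_two_functor "PsMon M :: ('a, 'm) lax_two_cat"
      "inv_cells (Fib M)" "Groth M"
    by (rule locally_bijective_Groth_inv_cells_Fib)
  have ess_pf: "\<exists>A \<in> Ob (LaxMon M :: ('a, 'm) lax_two_cat). \<exists>h. iso1 (PFib M) (F0 (Groth M) A) E h"
    if "E \<in> Ob (PFib M)" for E
    using essentially_surjective_Groth[OF inj, of M E] that by (simp; metis)
  have ess_f: "\<exists>A \<in> Ob (PsMonLax M :: ('a, 'm) lax_two_cat). \<exists>h. iso1 (Fib M) (F0 (Groth M) A) E h"
    if E: "E \<in> Ob (Fib M)" for E
  proof -
    have fib: "fibration M E" and "prefibration M E"
      using E by (simp_all add: fibration_imp_prefibration)
    then obtain A :: "('a, 'm) lax_mon" and h where "lax_monoid M A"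
      "fibration M (groth_obj M A)" "iso1 (Fib M) (groth_obj M A) E h"
      using essentially_surjective_Groth[OF inj] by metis
    then show ?thesis
      by (auto simp: lax_monoid.fibration_groth_obj_iff)
  qed
  have "two_functor (PsMon M :: ('a, 'm) lax_two_cat) (Fib M) (Groth M)"
    using ps.two_functor_axioms sub_two_category_inv_cells[OF f.D.two_category_axioms]
    by (rule two_functor_enlarge_target)
  moreover have "two_equivalence (LaxMon M :: ('a, 'm) lax_two_cat) (PFib M) (Groth M)"
    by (rule pf.two_equivalence_if_essentially_surjective) (rule ess_pf)
  moreover have "two_equivalence (PsMonLax M :: ('a, 'm) lax_two_cat) (Fib M) (Groth M)"
    by (rule f.two_equivalence_if_essentially_surjective) (rule ess_f)
  moreover have "two_equivalence (PsMon M :: ('a, 'm) lax_two_cat) (inv_cells (Fib M)) (Groth M)"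
    by (rule ps.two_equivalence_if_essentially_surjective) (use ess_f in simp)
  ultimately show ?thesis
    using pf.two_functor_axioms by simp
qed

end
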